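(* Let $n\ge1$, let $W_n$ be the symmetric group on $\{1,\dots,n\}$ viewed as a Coxeter group of type $A_{n-1}$, let $\lambda$ be a partition of $n$, and let $W_J$ be the column stabilizer of $\mathrm t_\lambda$, with longest element $w_J$. Let $v_\lambda$ be the element of $W_n$ such that $v_\lambda\mathrm t_\lambda=\mathrm t^\lambda$, and let $\mathscr I_\lambda=\{v\in W_n\mid v\le_Lv_\lambda\}$. Then the Kazhdan–Lusztig left cell of $W_n$ that contains $w_J$ is $\mathscr I_\lambda w_J=\{vw_J\mid v\in\mathscr I_\lambda\}$.
   Context: **Type $A$ and tableaux.** $W_n$ acts on $\{1,\dots,n\}$ on the left, with simple reflections $s_i=(i,i+1)$, $1\le i\le n-1$, and length function $l$. The left weak order: $u\le_Lw$ iff $l(w)=l(wu^{-1})+l(u)$. For a partition $\lambda=(\lambda_1\ge\dots\ge\lambda_k)$ of $n$, $[\lambda]=\{(i,j)\mid1\le i\le k,\ 1\le j\le\lambda_i\}$ ($i$ is the row index, $j$ the column index). A $\lambda$-tableau is a bijection $t\colon[\lambda]\to\{1,\dots,n\}$, and $W_n$ acts by $(wt)(i,j)=w(t(i,j))$. $\mathrm t^\lambda$ is the $\lambda$-tableau in which $1,\dots,n$ fill the rows in order, left to right in each row, first row first. $\mathrm t_\lambda$ is the one in which $1,\dots,n$ fill the columns in order, top to bottom in each column, first column first. The column stabilizer of $\mathrm t_\lambda$ is the parabolic subgroup $W_J$ generated by $J=J_\lambda$, the set of $s_i$ with $i,i+1$ in the same column of $\mathrm t_\lambda$. **Left cells.**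 For a Coxeter group $W$ with simple reflections $S$ and Bruhat order $\le$, put $\mathcal L(w)=\{s\in S\mid sw<w\}$, and for $y<w$ let $\mu(y,w)=\mu(w,y)$ be the coefficient of degree $(l(w)-l(y)-1)/2$ in the Kazhdan–Lusztig polynomial $P_{y,w}$ ($0$ if that number is not an integer; also $\mu=0$ on Bruhat-incomparable pairs). Let $\le_\Gamma$ be the reflexive transitive closure of the relation on $W$ defined by $u\leftarrow v$ iff $\mathcal L(u)\nsubseteq\mathcal L(v)$ and $\mu(u,v)\ne0$. The left cells of $W$ are the classes of the equivalence relation ($u\le_\Gamma v$ and $v\le_\Gamma u$). *)

theory Defs
  imports
    "HOL-Combinatorics.Permutations"
    "HOL-Computational_Algebra.Polynomial"
    "HOL-Library.Poly_Mapping"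
begin

section \<open>The symmetric group as a Coxeter group\<close>

text \<open>
  Permutations are functions on \<^typ>\<open>nat\<close> fixing everything outside \<open>{1..n}\<close>. The product
  is composition, so permutations act on the left.
\<close>

type_synonym perm = "nat \<Rightarrow> nat"

definition Sym :: "nat \<Rightarrow> perm set" where
  "Sym n = {w. w permutes {1..n}}"

definition simple :: "nat \<Rightarrow> perm" where
  "simple i = transpose i (Suc i)"

definition simples :: "nat \<Rightarrow> perm set" where
  "simples n = simple ` {i. 1 \<le> i \<and> i < n}"

definition word_prod :: "perm list \<Rightarrow> perm" where
  "word_prod ss = foldr (\<circ>) ss id"

definition len :: "nat \<Rightarrow> perm \<Rightarrow> nat" where
  "len n w = (LEAST k. \<exists>ss. set ss \<subseteq> simples n \<and> length ss = k \<and> word_prod ss = w)"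

definition reduced_word :: "nat \<Rightarrow> perm list \<Rightarrow> perm \<Rightarrow> bool" where
  "reduced_word n ss w \<longleftrightarrow> set ss \<subseteq> simples n \<and> word_prod ss = w \<and> length ss = len n w"

text \<open>The simple reflections are involutions, so products of words form the generated subgroup.\<close>

definition parabolic :: "perm set \<Rightarrow> perm set" where
  "parabolic J = {word_prod ss | ss. set ss \<subseteq> J}"

definition left_weak_le :: "nat \<Rightarrow> perm \<Rightarrow> perm \<Rightarrow> bool" where
  "left_weak_le n u w \<longleftrightarrow> len n w = len n (w \<circ> inv u) + len n u"

definition reflections :: "nat \<Rightarrow> perm set" where
  "reflections n = {x \<circ> s \<circ> inv x | x s. x \<in> Sym n \<and> s \<in> simples n}"

definition bruhat_le :: "nat \<Rightarrow> perm \<Rightarrow> perm \<Rightarrow> bool" where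
  "bruhat_le n u w \<longleftrightarrow> u \<in> Sym n \<and> w \<in> Sym n \<and>
     (\<lambda>x y. \<exists>t \<in> reflections n. y = x \<circ> t \<and> len n x < len n y)\<^sup>*\<^sup>* u w"

definition bruhat_less :: "nat \<Rightarrow> perm \<Rightarrow> perm \<Rightarrow> bool" where
  "bruhat_less n u w \<longleftrightarrow> bruhat_le n u w \<and> u \<noteq> w"

section \<open>The Hecke algebra and Kazhdan--Lusztig polynomials\<close>

text \<open>
  The finitely supported functions \<open>int \<Rightarrow>\<^sub>0 int\<close> with convolution are the integral Laurent
  polynomials in one indeterminate \<open>v\<close>, where \<open>v\<^sup>2 = q\<close>, so \<open>v\<close> is \<open>q\<close> to the power 1/2.
\<close>

type_synonym laurent = "int \<Rightarrow>\<^sub>0 int"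

definition v_pow :: "int \<Rightarrow> laurent" where
  "v_pow k = Poly_Mapping.single k 1"

definition q_laurent :: laurent where
  "q_laurent = v_pow 2"

definition laurent_bar :: "laurent \<Rightarrow> laurent" where
  "laurent_bar f = Poly_Mapping.map_key uminus f"

definition poly_at_q :: "int poly \<Rightarrow> laurent" where
  "poly_at_q p = (\<Sum>i\<le>degree p. Poly_Mapping.single (2 * int i) (coeff p i))"

text \<open>
  An element of the Hecke algebra is given by its coefficients: \<open>h\<close> stands for the sum of
  \<open>h w \<cdot> T\<^sub>w\<close> over \<open>w\<close> in the group.
\<close>

type_synonym hecke = "perm \<Rightarrow> laurent"

definition hecke_carrier :: "nat \<Rightarrow> hecke set" where
  "hecke_carrier n = {h. \<forall>w. w \<notin> Sym n \<longrightarrow> h w = 0}"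

definition T_elt :: "perm \<Rightarrow> hecke" where
  "T_elt w = (\<lambda>x. if x = w then 1 else 0)"

text \<open>
  Left multiplication by \<open>T\<^sub>s\<close>, given by \<open>T\<^sub>s T\<^sub>w = T\<^sub>s\<^sub>w\<close> if \<open>l(sw) > l(w)\<close>, and
  \<open>T\<^sub>s T\<^sub>w = (q - 1) T\<^sub>w + q T\<^sub>s\<^sub>w\<close> otherwise. The right-hand side below is the coefficient of
  \<open>T\<^sub>w\<close> in \<open>T\<^sub>s h\<close>.
\<close>

definition simple_mult :: "nat \<Rightarrow> perm \<Rightarrow> hecke \<Rightarrow> hecke" where
  "simple_mult n s h = (\<lambda>w. if w \<notin> Sym n then 0
     else if len n (s \<circ> w) < len n w then h (s \<circ> w) + (q_laurent - 1) * h w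
     else q_laurent * h (s \<circ> w))"

text \<open>
  \<open>T\<^sub>x\<close> is the product of the \<open>T\<^sub>s\<close> along any reduced word of \<open>x\<close>; the choice of the word is
  immaterial by Matsumoto's theorem.
\<close>

definition T_mult :: "nat \<Rightarrow> perm \<Rightarrow> hecke \<Rightarrow> hecke" where
  "T_mult n x h = foldr (simple_mult n) (SOME ss. reduced_word n ss x) h"

definition hecke_mult :: "nat \<Rightarrow> hecke \<Rightarrow> hecke \<Rightarrow> hecke" where
  "hecke_mult n a b = (\<lambda>w. \<Sum>x \<in> Sym n. a x * T_mult n x b w)"

definition hecke_inv :: "nat \<Rightarrow> hecke \<Rightarrow> hecke" where
  "hecke_inv n a = (THE b. b \<in> hecke_carrier n \<and>
     hecke_mult n a b = T_elt id \<and> hecke_mult n b a = T_elt id)"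

definition hecke_bar :: "nat \<Rightarrow> hecke \<Rightarrow> hecke" where
  "hecke_bar n h = (\<lambda>w. \<Sum>x \<in> Sym n. laurent_bar (h x) * hecke_inv n (T_elt (inv x)) w)"

text \<open>
  The polynomials \<open>P\<^sub>y\<^sub>,\<^sub>w\<close>, for fixed \<open>w\<close>, form the unique family such that the element
  \<open>v\<^sup>-\<^sup>l\<^sup>(\<^sup>w\<^sup>) \<Sum>\<^sub>y P\<^sub>y\<^sub>,\<^sub>w(q) T\<^sub>y\<close> is invariant under the bar involution, subject to the usual
  normalisation and degree bound \<open>deg P\<^sub>y\<^sub>,\<^sub>w \<le> (l(w) - l(y) - 1)/2\<close> for \<open>y < w\<close>.
\<close>

definition KL_element :: "nat \<Rightarrow> perm \<Rightarrow> (perm \<Rightarrow> int poly) \<Rightarrow> hecke" where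
  "KL_element n w P = (\<lambda>y. v_pow (- int (len n w)) * poly_at_q (P y))"

definition is_KL_family :: "nat \<Rightarrow> perm \<Rightarrow> (perm \<Rightarrow> int poly) \<Rightarrow> bool" where
  "is_KL_family n w P \<longleftrightarrow>
     (\<forall>y. \<not> bruhat_le n y w \<longrightarrow> P y = 0) \<and>
     P w = 1 \<and>
     (\<forall>y. bruhat_less n y w \<longrightarrow> len n y + 2 * degree (P y) + 1 \<le> len n w) \<and>
     hecke_bar n (KL_element n w P) = KL_element n w P"

definition KL_poly :: "nat \<Rightarrow> perm \<Rightarrow> perm \<Rightarrow> int poly" where
  "KL_poly n y w = (THE P. is_KL_family n w P) y"

section \<open>Left cells\<close>

definition KL_mu_less :: "nat \<Rightarrow> perm \<Rightarrow> perm \<Rightarrow> int" where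
  "KL_mu_less n y w = (if odd (len n w - len n y)
     then coeff (KL_poly n y w) ((len n w - len n y - 1) div 2) else 0)"

definition KL_mu :: "nat \<Rightarrow> perm \<Rightarrow> perm \<Rightarrow> int" where
  "KL_mu n y w = (if bruhat_less n y w then KL_mu_less n y w
     else if bruhat_less n w y then KL_mu_less n w y else 0)"

definition left_descents :: "nat \<Rightarrow> perm \<Rightarrow> perm set" where
  "left_descents n w = {s \<in> simples n. bruhat_less n (s \<circ> w) w}"

definition KL_arrow :: "nat \<Rightarrow> perm \<Rightarrow> perm \<Rightarrow> bool" where
  "KL_arrow n u v \<longleftrightarrow> u \<in> Sym n \<and> v \<in> Sym n \<and>
     \<not> left_descents n u \<subseteq> left_descents n v \<and> KL_mu n u v \<noteq> 0"

definition KL_preorder :: "nat \<Rightarrow> perm \<Rightarrow> perm \<Rightarrow> bool" where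
  "KL_preorder n = (KL_arrow n)\<^sup>*\<^sup>*"

definition left_cell :: "nat \<Rightarrow> perm \<Rightarrow> perm set" where
  "left_cell n w = {u \<in> Sym n. KL_preorder n u w \<and> KL_preorder n w u}"

section \<open>Partitions and tableaux\<close>

definition is_partition :: "nat \<Rightarrow> nat list \<Rightarrow> bool" where
  "is_partition n lam \<longleftrightarrow> sorted_wrt (\<ge>) lam \<and> (\<forall>a \<in> set lam. 0 < a) \<and> sum_list lam = n"

text \<open>Rows and columns are numbered from 1, whereas list positions start at 0.\<close>

definition diagram :: "nat list \<Rightarrow> (nat \<times> nat) set" where
  "diagram lam = {(i, j). 1 \<le> i \<and> i \<le> length lam \<and> 1 \<le> j \<and> j \<le> lam ! (i - 1)}"

definition row_len :: "nat list \<Rightarrow> nat \<Rightarrow> nat" where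
  "row_len lam i = card {j. (i, j) \<in> diagram lam}"

definition col_len :: "nat list \<Rightarrow> nat \<Rightarrow> nat" where
  "col_len lam j = card {i. (i, j) \<in> diagram lam}"

text \<open>Tableaux are total functions of which only the values on the diagram matter.\<close>

definition row_tableau :: "nat list \<Rightarrow> nat \<times> nat \<Rightarrow> nat" where
  "row_tableau lam = (\<lambda>(i, j). (\<Sum>i' = 1..<i. row_len lam i') + j)"

definition col_tableau :: "nat list \<Rightarrow> nat \<times> nat \<Rightarrow> nat" where
  "col_tableau lam = (\<lambda>(i, j). (\<Sum>j' = 1..<j. col_len lam j') + i)"

definition col_simples :: "nat list \<Rightarrow> perm set" where
  "col_simples lam = {simple a | a. \<exists>i i' j. (i, j) \<in> diagram lam \<and> (i', j) \<in> diagram lam \<and>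
     col_tableau lam (i, j) = a \<and> col_tableau lam (i', j) = Suc a}"

definition weak_interval :: "nat \<Rightarrow> perm \<Rightarrow> perm set" where
  "weak_interval n x = {v \<in> Sym n. left_weak_le n v x}"

end

theory Submission
  imports Defs
begin

text \<open>
  The elements \<open>C\<^sub>y\<close> of the Kazhdan--Lusztig basis obey the same multiplication formula for a simple
  reflection acting from the left and from the right. Let \<open>s, t\<close> be adjacent simple reflections. Modulo the left ideal spanned by the basis elements with both \<open>s\<close>
  and \<open>t\<close> in the right descent set, right multiplication by \<open>C\<^sub>t\<close> is a homomorphism of left modules
  which sends \<open>C\<^sub>y\<close>, for \<open>y\<close> with right descent \<open>s\<close> but not \<open>t\<close>, to \<open>C\<^sub>y\<^sub>*\<close>, where \<open>y*\<close> is the image of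
  \<open>y\<close> under the right star operation. So left cells are compatible with right star operations, which are the
  Knuth moves on the word \<open>y 1, \<dots>, y n\<close>, and elements of one left cell keep equal right descents
  after any sequence of parallel Knuth moves.

  The word of \<open>v w\<^sub>J\<close> reads the tableau \<open>v t\<^sub>\<lambda>\<close> column by column, each column from bottom to
  top, and \<open>v\<close> lies below \<open>v\<^sub>\<lambda>\<close> in the left weak order exactly when \<open>v t\<^sub>\<lambda>\<close> is standard. If
  \<open>v w\<^sub>J\<close> is in the cell of \<open>w\<^sub>J\<close>, the columns increase because the right descents agree, and the
  rows increase because a violation in two adjacent columns is turned by parallel Knuth moves into
  different descents. Conversely, standard tableaux are connected by dual Knuth moves, and each of
  these relates two elements of the same left cell.
\<close>

section \<open>Length, descents and orders on the symmetric group\<close>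

text \<open>Several constants of the statement are choices: \<open>T_mult\<close> selects a reduced
  word, \<open>hecke_inv\<close> and \<open>KL_poly\<close> a unique object. Nothing can be computed
  before these choices are justified. This is done without Matsumoto's theorem: a linear map that
  commutes with all right multiplications is determined by its value at \<open>T_elt id\<close>. The
  Kazhdan-Lusztig basis is then pinned down by Lusztig's conditions on normalised coordinates,
  namely bar invariance and only negative powers of v off the diagonal. There mu is simply the
  coefficient of v^-1, and the polynomials are needed only for one comparison. The star argument
  needs multiplication from both sides. Instead of passing between the sides by an
  anti-automorphism, an abstract map \<open>\<sigma>\<close> stands for either side, so each formula
  is proved once. No Robinson-Schensted correspondence is used: cells are only compared with the
  single element \<open>w_J\<close>, whose word is explicit, and for it Knuth moves inside two
  adjacent columns suffice.\<close>

lemma Sym_comp: "u \<in> Sym n \<Longrightarrow> w \<in> Sym n \<Longrightarrow> u \<circ> w \<in> Sym n"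
  by (auto simp: Sym_def intro: permutes_compose)

lemma Sym_inv: "w \<in> Sym n \<Longrightarrow> inv w \<in> Sym n"
  by (auto simp: Sym_def intro: permutes_inv)

lemma Sym_id: "id \<in> Sym n"
  by (auto simp: Sym_def permutes_id)

lemma finite_Sym: "finite (Sym n)"
  by (auto simp: Sym_def finite_permutations)

lemma Sym_bij: "w \<in> Sym n \<Longrightarrow> bij w"
  by (auto simp: Sym_def permutes_bij)

lemma Sym_inj: "w \<in> Sym n \<Longrightarrow> w i = w j \<longleftrightarrow> i = j"
  by (meson Sym_bij bij_def inj_eq)

lemma Sym_range: "w \<in> Sym n \<Longrightarrow> 1 \<le> w i \<and> w i \<le> n \<longleftrightarrow> 1 \<le> i \<and> i \<le> n"
  using permutes_in_image[of w "{1..n}" i] by (auto simp: Sym_def)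

lemma Sym_inv_eq: "w \<in> Sym n \<Longrightarrow> w (inv w i) = i" "w \<in> Sym n \<Longrightarrow> inv w (w i) = i"
  by (auto simp: Sym_def permutes_inverses)

lemma Sym_inv_comp: "w \<in> Sym n \<Longrightarrow> w \<circ> inv w = id" "w \<in> Sym n \<Longrightarrow> inv w \<circ> w = id"
  by (auto simp: Sym_def permutes_inv_o)

lemma Sym_inv_inv: "w \<in> Sym n \<Longrightarrow> inv (inv w) = w"
  by (meson Sym_bij inv_inv_eq)

lemma Sym_inv_comp_distrib: "u \<in> Sym n \<Longrightarrow> w \<in> Sym n \<Longrightarrow> inv (u \<circ> w) = inv w \<circ> inv u"
  by (meson Sym_bij o_inv_distrib)

lemma simple_Sym: "1 \<le> i \<Longrightarrow> i < n \<Longrightarrow> simple i \<in> Sym n"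
  by (auto simp: Sym_def simple_def intro!: permutes_swap_id)

lemma simples_Sym: "s \<in> simples n \<Longrightarrow> s \<in> Sym n"
  by (auto simp: simples_def intro: simple_Sym)

lemma simple_invol: "simple i \<circ> simple i = id"
  by (auto simp: simple_def)

lemma simples_invol: "s \<in> simples n \<Longrightarrow> s \<circ> s = id"
  by (auto simp: simples_def simple_invol)

lemma simples_inv: "s \<in> simples n \<Longrightarrow> inv s = s"
  by (metis simples_invol inv_unique_comp)

lemma simples_cancel:
  assumes "s \<in> simples n"
  shows "s \<circ> (s \<circ> w) = w" "w \<circ> s \<circ> s = w"
  using simples_invol[OF assms] by (simp_all add: o_assoc[symmetric]) (simp_all add: o_assoc)

section \<open>Inversion sets of products\<close>

definition inversions :: "nat \<Rightarrow> perm \<Rightarrow> (nat \<times> nat) set" where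
  "inversions n w = {(i, j). 1 \<le> i \<and> i < j \<and> j \<le> n \<and> w j < w i}"

text \<open>This is the inversion set of \<open>x\<close> pulled back along \<open>u\<close>: a pair
  of positions belongs to it if \<open>x\<close> inverts the two letters of \<open>u\<close> found
  there, taken in increasing order.\<close>

definition inversions_along :: "nat \<Rightarrow> perm \<Rightarrow> perm \<Rightarrow> (nat \<times> nat) set" where
  "inversions_along n x u = {(i, j). 1 \<le> i \<and> i < j \<and> j \<le> n \<and>
     (if u i < u j then x (u j) < x (u i) else x (u i) < x (u j))}"

lemma finite_inversions: "finite (inversions n w)"
  by (rule finite_subset[of _ "{1..n} \<times> {1..n}"]) (auto simp: inversions_def)

lemma finite_inversions_along: "finite (inversions_along n x u)"
  by (rule finite_subset[of _ "{1..n} \<times> {1..n}"]) (auto simp: inversions_along_def)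

lemma card_inversions_along:
  assumes u: "u \<in> Sym n"
  shows "card (inversions_along n x u) = card (inversions n x)"
proof -
  let ?f = "\<lambda>(i, j). if u i < u j then (u i, u j) else (u j, u i)"
  let ?g = "\<lambda>(i, j). if inv u i < inv u j then (inv u i, inv u j) else (inv u j, inv u i)"
  have r: "1 \<le> u i \<and> u i \<le> n \<longleftrightarrow> 1 \<le> i \<and> i \<le> n" for i by (rule Sym_range[OF u])
  have r': "1 \<le> inv u i \<and> inv u i \<le> n \<longleftrightarrow> 1 \<le> i \<and> i \<le> n" for i by (rule Sym_range[OF Sym_inv[OF u]])
  note [simp] = Sym_inv_eq[OF u] Sym_inj[OF u] Sym_inj[OF Sym_inv[OF u]]
  have "bij_betw ?f (inversions_along n x u) (inversions n x)"
  proof (rule bij_betw_byWitness[where f' = ?g])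
    show "\<forall>a\<in>inversions_along n x u. ?g (?f a) = a"
      by (auto simp: inversions_along_def)
    show "\<forall>a\<in>inversions n x. ?f (?g a) = a"
      by (auto simp: inversions_def)
    show "?f ` inversions_along n x u \<subseteq> inversions n x"
    proof clarify
      fix i j a b assume *: "(i, j) \<in> inversions_along n x u" "(a, b) = (if u i < u j then (u i, u j) else (u j, u i))"
      then have "1 \<le> i" "i \<le> n" "1 \<le> j" "j \<le> n" "i \<noteq> j" by (auto simp: inversions_along_def)
      with r[of i] r[of j] have "1 \<le> u i" "u i \<le> n" "1 \<le> u j" "u j \<le> n" by auto
      moreover have "u i < u j \<or> u j < u i" using \<open>i \<noteq> j\<close> Sym_inj[OF u, of i j] by arith
      ultimately show "(a, b) \<in> inversions n x" using *
        by (auto simp: inversions_along_def inversions_def split: if_splits)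
    qed
    show "?g ` inversions n x \<subseteq> inversions_along n x u"
    proof clarify
      fix i j a b assume *: "(i, j) \<in> inversions n x" "(a, b) = (if inv u i < inv u j then (inv u i, inv u j) else (inv u j, inv u i))"
      then have "1 \<le> i" "i \<le> n" "1 \<le> j" "j \<le> n" "i \<noteq> j" by (auto simp: inversions_def)
      with r'[of i] r'[of j] have "1 \<le> inv u i" "inv u i \<le> n" "1 \<le> inv u j" "inv u j \<le> n" by auto
      moreover have "inv u i < inv u j \<or> inv u j < inv u i"
        using \<open>i \<noteq> j\<close> Sym_inj[OF Sym_inv[OF u], of i j] by arith
      ultimately show "(a, b) \<in> inversions_along n x u" using *
        by (auto simp: inversions_along_def inversions_def split: if_splits)
    qed
  qed
  then show ?thesis by (rule bij_betw_same_card)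
qed

text \<open>Applying \<open>x\<close> after \<open>u\<close> toggles exactly the pairs in
  \<open>inversions_along\<close>, so the result is a symmetric difference.\<close>

lemma inversions_comp:
  assumes u: "u \<in> Sym n" and x: "x \<in> Sym n"
  shows "inversions n (x \<circ> u) = (inversions n u - inversions_along n x u) \<union> (inversions_along n x u - inversions n u)"
proof -
  have 1: "u i = u j \<longleftrightarrow> i = j" "x i = x j \<longleftrightarrow> i = j" for i j using Sym_inj u x by auto
  have 2: "\<not> u i < u j \<longleftrightarrow> u j < u i" if "i < j" for i j using 1(1)[of i j] that by auto
  have 3: "\<not> x i < x j \<longleftrightarrow> x j < x i" if "i \<noteq> j" for i j using 1(2)[of i j] that by auto
  show ?thesis
    by (auto simp: inversions_def inversions_along_def 2 3 1 split: if_splits)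
qed

text \<open>The overlap measures the failure of lengths to add up. An empty overlap gives the weak
  order; for a simple reflection the overlap has at most one element and decides about a
  descent.\<close>

lemma card_inversions_comp:
  assumes u: "u \<in> Sym n" and x: "x \<in> Sym n"
  shows "card (inversions n (x \<circ> u)) + 2 * card (inversions n u \<inter> inversions_along n x u)
    = card (inversions n x) + card (inversions n u)"
proof -
  let ?A = "inversions n u" and ?B = "inversions_along n x u"
  have f: "finite ?A" "finite ?B" by (rule finite_inversions finite_inversions_along)+
  have "card (inversions n (x \<circ> u)) = card (?A - ?B) + card (?B - ?A)"
    unfolding inversions_comp[OF assms] using f by (intro card_Un_disjoint) auto
  moreover have "card ?A = card (?A - ?B) + card (?A \<inter> ?B)"
    using f(1) by (metis card_Int_Diff add.commute)
  moreover have "card ?B = card (?B - ?A) + card (?A \<inter> ?B)"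
    using f(2) by (metis card_Int_Diff add.commute Int_commute)
  ultimately show ?thesis using card_inversions_along[OF u, of x] by simp
qed

lemma inversions_simple: "1 \<le> i \<Longrightarrow> i < n \<Longrightarrow> inversions n (simple i) = {(i, Suc i)}"
  by (auto simp: inversions_def simple_def transpose_def split: if_splits)

lemma card_inversions_comp_simple:
  assumes w: "w \<in> Sym n" and i: "1 \<le> i" "i < n"
  shows "w i < w (Suc i) \<Longrightarrow> card (inversions n (w \<circ> simple i)) = Suc (card (inversions n w))"
    and "w (Suc i) < w i \<Longrightarrow> Suc (card (inversions n (w \<circ> simple i))) = card (inversions n w)"
proof -
  note * = card_inversions_comp[OF simple_Sym[OF i] w]
  have "(i, Suc i) \<in> inversions_along n w (simple i) \<longleftrightarrow> w (Suc i) < w i"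
    using i by (auto simp: inversions_along_def simple_def)
  then have "inversions n (simple i) \<inter> inversions_along n w (simple i) = (if w (Suc i) < w i then {(i, Suc i)} else {})"
    by (auto simp: inversions_simple[OF i])
  with * show "w i < w (Suc i) \<Longrightarrow> card (inversions n (w \<circ> simple i)) = Suc (card (inversions n w))"
    and "w (Suc i) < w i \<Longrightarrow> Suc (card (inversions n (w \<circ> simple i))) = card (inversions n w)"
    by (auto simp: inversions_simple[OF i])
qed

text \<open>The identity has no inversions, so for the product of \<open>inv w\<close> and
  \<open>w\<close> the symmetric difference is empty and its two constituents coincide.\<close>

lemma card_inversions_inv:
  assumes w: "w \<in> Sym n"
  shows "card (inversions n (inv w)) = card (inversions n w)"
proof -
  have "inversions n (inv w \<circ> w) = {}" by (simp add: Sym_inv_comp[OF w]) (auto simp: inversions_def)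
  then have "inversions n w = inversions_along n (inv w) w"
    unfolding inversions_comp[OF w Sym_inv[OF w]] by auto
  then show ?thesis using card_inversions_along[OF w] by metis
qed

lemma increasing_Sym_id:
  assumes w: "w \<in> Sym n" and inc: "\<And>i. 1 \<le> i \<Longrightarrow> i < n \<Longrightarrow> w i < w (Suc i)"
  shows "w = id"
proof -
  have ge: "i \<le> n \<Longrightarrow> i \<le> w i" for i
  proof (induction i)
    case (Suc i)
    show ?case
    proof (cases "i = 0")
      case True then show ?thesis using Suc.prems Sym_range[OF w, of 1] by simp
    next
      case False then show ?thesis using Suc inc[of i] by simp
    qed
  qed simp
  have le: "i < n \<Longrightarrow> w (n - i) \<le> n - i" for i
  proof (induction i)
    case 0 then show ?case using Sym_range[OF w, of n] by simp
  next
    case (Suc i)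
    have "w (n - Suc i) < w (Suc (n - Suc i))" using Suc.prems by (intro inc) auto
    moreover have "Suc (n - Suc i) = n - i" using Suc.prems by simp
    ultimately show ?case using Suc by simp
  qed
  have "w i = i" for i
  proof (cases "1 \<le> i \<and> i \<le> n")
    case True then show ?thesis using ge[of i] le[of "n - i"] by simp
  next
    case False then show ?thesis using w by (auto simp: Sym_def permutes_def)
  qed
  then show ?thesis by auto
qed

section \<open>Length as the number of inversions\<close>

lemma word_prod_simps [simp]: "word_prod [] = id" "word_prod (s # ss) = s \<circ> word_prod ss"
  by (auto simp: word_prod_def)

lemma word_prod_append: "word_prod (ss @ ts) = word_prod ss \<circ> word_prod ts"
  by (induction ss) (auto simp: o_assoc)

lemma word_prod_Sym: "set ss \<subseteq> simples n \<Longrightarrow> word_prod ss \<in> Sym n"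
  by (induction ss) (auto simp: Sym_id intro: Sym_comp simples_Sym)

lemma card_inversions_word_prod: "set ss \<subseteq> simples n \<Longrightarrow> card (inversions n (word_prod ss)) \<le> length ss"
proof (induction ss)
  case Nil
  have "inversions n (word_prod []) = {}" by (auto simp: inversions_def)
  then show ?case by (simp del: word_prod_simps)
next
  case (Cons s ss)
  then obtain i where i: "1 \<le> i" "i < n" "s = simple i" by (auto simp: simples_def)
  have "word_prod ss \<in> Sym n" using Cons by (auto intro: word_prod_Sym)
  from card_inversions_comp[OF this simple_Sym[OF i(1,2)]] have
    "card (inversions n (simple i \<circ> word_prod ss)) \<le> 1 + card (inversions n (word_prod ss))"
    using inversions_simple[OF i(1,2)] by simp
  also have "\<dots> \<le> length (s # ss)" using Cons by simp
  finally show ?case by (simp only: word_prod_simps i)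
qed

text \<open>Bubble sort: as long as there is a descent, the corresponding simple reflection on the
  right lowers the number of inversions by one.\<close>

lemma ex_word:
  assumes "w \<in> Sym n"
  shows "\<exists>ss. set ss \<subseteq> simples n \<and> length ss = card (inversions n w) \<and> word_prod ss = w"
  using assms
proof (induction "card (inversions n w)" arbitrary: w rule: less_induct)
  case less
  show ?case
  proof (cases "\<exists>i. 1 \<le> i \<and> i < n \<and> w (Suc i) < w i")
    case True
    then obtain i where i: "1 \<le> i" "i < n" "w (Suc i) < w i" by auto
    note c = card_inversions_comp_simple(2)[OF less.prems i]
    have "w \<circ> simple i \<in> Sym n" by (intro Sym_comp less.prems simple_Sym i)
    with less.hyps c obtain ss where ss: "set ss \<subseteq> simples n" "length ss = card (inversions n (w \<circ> simple i))"
      "word_prod ss = w \<circ> simple i" by (metis lessI)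
    have "word_prod (ss @ [simple i]) = w"
      by (simp add: word_prod_append ss o_assoc[symmetric] simple_invol)
    moreover have "simple i \<in> simples n" using i by (auto simp: simples_def)
    ultimately show ?thesis using ss c by (intro exI[of _ "ss @ [simple i]"]) auto
  next
    case False
    have "w i < w (Suc i)" if "1 \<le> i" "i < n" for i
      using False that Sym_inj[OF less.prems, of i "Suc i"] by (metis n_not_Suc_n nat_neq_iff)
    then have "w = id" using increasing_Sym_id[OF less.prems] by blast
    moreover have "inversions n id = {}" by (auto simp: inversions_def)
    ultimately show ?thesis by (intro exI[of _ "[]"]) simp
  qed
qed

lemma len_eq_card_inversions: "w \<in> Sym n \<Longrightarrow> len n w = card (inversions n w)"
  unfolding len_def using ex_word card_inversions_word_prod by (intro Least_equality) blast+

lemma ex_reduced_word: "w \<in> Sym n \<Longrightarrow> \<exists>ss. reduced_word n ss w"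
  using ex_word len_eq_card_inversions by (fastforce simp: reduced_word_def)

lemma len_id [simp]: "len n id = 0"
proof -
  have "inversions n id = {}" by (auto simp: inversions_def)
  then show ?thesis using len_eq_card_inversions[OF Sym_id, of n] by (metis card.empty)
qed

lemma len_inv: "w \<in> Sym n \<Longrightarrow> len n (inv w) = len n w"
  by (simp add: len_eq_card_inversions Sym_inv card_inversions_inv)

section \<open>Descents on both sides\<close>

lemma len_comp_simple:
  assumes "w \<in> Sym n" "1 \<le> i" "i < n"
  shows "w i < w (Suc i) \<Longrightarrow> len n (w \<circ> simple i) = Suc (len n w)"
    and "w (Suc i) < w i \<Longrightarrow> Suc (len n (w \<circ> simple i)) = len n w"
  using card_inversions_comp_simple[OF assms] Sym_comp[OF assms(1) simple_Sym[OF assms(2,3)]]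
  by (simp_all add: len_eq_card_inversions assms(1))

lemma Sym_less_cases: "w \<in> Sym n \<Longrightarrow> i \<noteq> j \<Longrightarrow> w i < w j \<or> w j < w i"
  using Sym_inj[of w n i j] by arith

lemma len_comp_simple_less:
  assumes "w \<in> Sym n" "1 \<le> i" "i < n"
  shows "len n (w \<circ> simple i) < len n w \<longleftrightarrow> w (Suc i) < w i"
  using len_comp_simple[OF assms] Sym_less_cases[OF assms(1), of i "Suc i"] by linarith

lemma len_right_cases:
  assumes "w \<in> Sym n" "s \<in> simples n"
  shows "len n (w \<circ> s) = Suc (len n w) \<or> len n w = Suc (len n (w \<circ> s))"
proof -
  obtain i where i: "1 \<le> i" "i < n" "s = simple i" using assms by (auto simp: simples_def)
  show ?thesis
    using len_comp_simple[OF assms(1) i(1,2)] Sym_less_cases[OF assms(1), of i "Suc i"] i(3) by fastforce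
qed

lemma simples_comp_inv:
  assumes "w \<in> Sym n" "s \<in> simples n"
  shows "inv (s \<circ> w) = inv w \<circ> s" "inv (w \<circ> s) = s \<circ> inv w"
  using Sym_inv_comp_distrib[OF simples_Sym[OF assms(2)] assms(1)]
    Sym_inv_comp_distrib[OF assms(1) simples_Sym[OF assms(2)]] simples_inv[OF assms(2)] by auto

lemma len_left_cases:
  assumes "w \<in> Sym n" "s \<in> simples n"
  shows "len n (s \<circ> w) = Suc (len n w) \<or> len n w = Suc (len n (s \<circ> w))"
  using len_right_cases[OF Sym_inv[OF assms(1)] assms(2)]
  by (metis assms len_inv simples_comp_inv(1) Sym_comp simples_Sym)

lemma len_simple_comp_less:
  assumes "w \<in> Sym n" "1 \<le> i" "i < n"
  shows "len n (simple i \<circ> w) < len n w \<longleftrightarrow> inv w (Suc i) < inv w i"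
proof -
  have "simple i \<in> simples n" using assms by (auto simp: simples_def)
  then have "len n (simple i \<circ> w) = len n (inv w \<circ> simple i)"
    by (metis assms(1) len_inv simples_comp_inv(1) Sym_comp simples_Sym)
  then show ?thesis using len_comp_simple_less[OF Sym_inv[OF assms(1)] assms(2,3)]
    by (simp add: len_inv assms)
qed

lemma ex_left_descent:
  assumes "w \<in> Sym n" "w \<noteq> id"
  shows "\<exists>s \<in> simples n. len n (s \<circ> w) < len n w"
proof (rule ccontr)
  assume "\<not> ?thesis"
  then have *: "\<not> inv w (Suc i) < inv w i" if "1 \<le> i" "i < n" for i
    using that len_simple_comp_less[OF assms(1)] by (auto simp: simples_def)
  have "inv w = id"
    using * Sym_inj[OF Sym_inv[OF assms(1)]]
    by (intro increasing_Sym_id[OF Sym_inv[OF assms(1)]]) (metis n_not_Suc_n nat_neq_iff)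
  then show False using assms Sym_inv_inv by (metis inv_id)
qed

lemma ex_right_descent:
  assumes "w \<in> Sym n" "w \<noteq> id"
  shows "\<exists>s \<in> simples n. len n (w \<circ> s) < len n w"
proof -
  have "inv w \<noteq> id" using assms Sym_inv_inv by (metis inv_id)
  with ex_left_descent[OF Sym_inv[OF assms(1)]] obtain s where
    s: "s \<in> simples n" "len n (s \<circ> inv w) < len n (inv w)" by blast
  have "len n (s \<circ> inv w) = len n (w \<circ> s)"
    by (metis assms(1) s(1) len_inv simples_comp_inv(2) Sym_comp simples_Sym)
  with s show ?thesis by (auto simp: len_inv assms)
qed

text \<open>Lengths add up in w = x u iff \<open>x\<close> undoes no inversion of \<open>u\<close>,
  that is, iff the overlap in \<open>card_inversions_comp\<close> is empty.\<close>

lemma left_weak_le_iff_inversions: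
  assumes u: "u \<in> Sym n" and w: "w \<in> Sym n"
  shows "left_weak_le n u w \<longleftrightarrow> inversions n u \<subseteq> inversions n w"
proof -
  let ?x = "w \<circ> inv u"
  have x: "?x \<in> Sym n" and xu: "?x \<circ> u = w"
    by (auto intro: Sym_comp Sym_inv u w) (simp add: o_assoc[symmetric] Sym_inv_comp[OF u])
  have "left_weak_le n u w \<longleftrightarrow> card (inversions n u \<inter> inversions_along n ?x u) = 0"
    using card_inversions_comp[OF u x] unfolding xu left_weak_le_def
    by (simp add: len_eq_card_inversions u w x del: card_eq_0_iff) linarith
  also have "\<dots> \<longleftrightarrow> inversions n u \<inter> inversions_along n ?x u = {}"
    using finite_inversions by simp
  also have "\<dots> \<longleftrightarrow> inversions n u \<subseteq> inversions n w"
    using inversions_comp[OF u x] unfolding xu by blast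
  finally show ?thesis .
qed

text \<open>A left descent compares the positions of the values \<open>i\<close> and
  \<open>i + 1\<close>. Exchanging the positions \<open>j\<close> and \<open>j + 1\<close> affects
  this comparison only if the two values stand exactly there, and this is the case s w = w
  t.\<close>

lemma left_descent_comp_simple:
  assumes w: "w \<in> Sym n" and s: "s \<in> simples n" and t: "t \<in> simples n"
    and ne: "s \<circ> w \<noteq> w \<circ> t"
  shows "len n (s \<circ> (w \<circ> t)) < len n (w \<circ> t) \<longleftrightarrow> len n (s \<circ> w) < len n w"
proof -
  obtain i where i: "1 \<le> i" "i < n" "s = simple i" using s by (auto simp: simples_def)
  obtain j where j: "1 \<le> j" "j < n" "t = simple j" using t by (auto simp: simples_def)
  let ?a = "inv w i" and ?b = "inv w (Suc i)"
  have ab: "?a \<noteq> ?b" using Sym_inj[OF Sym_inv[OF w], of i "Suc i"] by simp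
  have *: "\<not> (?a = j \<and> ?b = Suc j)" "\<not> (?a = Suc j \<and> ?b = j)"
  proof -
    have "s \<circ> w = w \<circ> t" if "(?a = j \<and> ?b = Suc j) \<or> (?a = Suc j \<and> ?b = j)"
    proof
      fix k
      have wi: "w ?a = i" "w ?b = Suc i" using Sym_inv_eq[OF w] by auto
      show "(s \<circ> w) k = (w \<circ> t) k"
      proof (cases "k = ?a \<or> k = ?b")
        case True then show ?thesis using that wi ab by (auto simp: i j simple_def)
      next
        case False
        then have "w k \<noteq> i" "w k \<noteq> Suc i" using Sym_inv_eq[OF w] by metis+
        then show ?thesis using False that by (auto simp: i j simple_def)
      qed
    qed
    then show "\<not> (?a = j \<and> ?b = Suc j)" "\<not> (?a = Suc j \<and> ?b = j)" using ne by auto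
  qed
  have "inv (w \<circ> t) = t \<circ> inv w" by (rule simples_comp_inv[OF w t])
  then have "len n (s \<circ> (w \<circ> t)) < len n (w \<circ> t) \<longleftrightarrow> simple j ?b < simple j ?a"
    using len_simple_comp_less[OF Sym_comp[OF w simples_Sym[OF t]] i(1,2)] i j by simp
  also have "\<dots> \<longleftrightarrow> ?b < ?a"
    using * ab by (auto simp: simple_def transpose_def split: if_splits)
  finally show ?thesis using len_simple_comp_less[OF w i(1,2)] i by simp
qed

lemma right_descent_comp_simple:
  assumes w: "w \<in> Sym n" and s: "s \<in> simples n" and t: "t \<in> simples n"
    and ne: "s \<circ> w \<noteq> w \<circ> t"
  shows "len n (s \<circ> w \<circ> t) < len n (s \<circ> w) \<longleftrightarrow> len n (w \<circ> t) < len n w"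
proof -
  have S: "s \<circ> w \<in> Sym n" "w \<circ> t \<in> Sym n" "s \<circ> w \<circ> t \<in> Sym n"
    by (intro Sym_comp simples_Sym w s t)+
  have "t \<circ> inv w \<noteq> inv w \<circ> s"
    using ne by (metis simples_comp_inv[OF w t] simples_comp_inv[OF w s] S(1,2) Sym_inv_inv)
  from left_descent_comp_simple[OF Sym_inv[OF w] t s this]
  have "len n (inv (s \<circ> w \<circ> t)) < len n (inv (s \<circ> w)) \<longleftrightarrow> len n (inv (w \<circ> t)) < len n (inv w)"
    by (simp only: simples_comp_inv(2)[OF w t] simples_comp_inv(1)[OF w s] simples_comp_inv(2)[OF S(1) t])
  then show ?thesis by (simp only: len_inv S w)
qed

subsection \<open>Bruhat order\<close>

lemma bruhat_le_len:
  assumes "bruhat_le n u w"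
  shows "u = w \<or> len n u < len n w"
proof -
  have "(\<lambda>x y. \<exists>t \<in> reflections n. y = x \<circ> t \<and> len n x < len n y)\<^sup>*\<^sup>* u w"
    using assms by (simp add: bruhat_le_def)
  then show ?thesis by (induction) (auto intro: less_trans)
qed

lemma bruhat_less_len: "bruhat_less n u w \<Longrightarrow> len n u < len n w"
  using bruhat_le_len by (auto simp: bruhat_less_def)

lemma bruhat_le_refl: "w \<in> Sym n \<Longrightarrow> bruhat_le n w w"
  by (simp add: bruhat_le_def)

lemma bruhat_le_trans: "bruhat_le n u v \<Longrightarrow> bruhat_le n v w \<Longrightarrow> bruhat_le n u w"
  by (auto simp: bruhat_le_def)

lemma bruhat_le_Sym: "bruhat_le n u w \<Longrightarrow> u \<in> Sym n" "bruhat_le n u w \<Longrightarrow> w \<in> Sym n"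
  by (auto simp: bruhat_le_def)

lemma reflections_Sym: "t \<in> reflections n \<Longrightarrow> t \<in> Sym n"
  by (auto simp: reflections_def intro!: Sym_comp Sym_inv intro: simples_Sym)

lemma bruhat_le_reflection:
  assumes "x \<in> Sym n" "t \<in> reflections n" "len n x < len n (x \<circ> t)"
  shows "bruhat_le n x (x \<circ> t)"
  using assms Sym_comp[OF assms(1) reflections_Sym[OF assms(2)]] by (auto simp: bruhat_le_def)

lemma reflections_transpose:
  assumes "t \<in> reflections n"
  obtains a b where "1 \<le> a" "a < b" "b \<le> n" "t = transpose a b"
proof -
  obtain x i where x: "x \<in> Sym n" and i: "1 \<le> i" "i < n" and t: "t = x \<circ> simple i \<circ> inv x"
    using assms by (auto simp: reflections_def simples_def)
  have tt: "t = transpose (x i) (x (Suc i))"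
  proof
    fix k
    have "inv x k = i \<longleftrightarrow> k = x i" "inv x k = Suc i \<longleftrightarrow> k = x (Suc i)" "x (inv x k) = k"
      using Sym_inv_eq[OF x] by metis+
    then show "t k = transpose (x i) (x (Suc i)) k" by (auto simp: t simple_def transpose_def)
  qed
  have *: "x i \<noteq> x (Suc i)" "1 \<le> x i" "x i \<le> n" "1 \<le> x (Suc i)" "x (Suc i) \<le> n"
    using Sym_range[OF x, of i] Sym_range[OF x, of "Suc i"] Sym_inj[OF x, of i "Suc i"] i by auto
  show ?thesis
  proof (cases "x i < x (Suc i)")
    case True then show ?thesis using that tt * by blast
  next
    case False then show ?thesis using that[of "x (Suc i)" "x i"] tt * by (simp add: transpose_commute)
  qed
qed

lemma len_comp_transpose_less:
  assumes x: "x \<in> Sym n" and ab: "1 \<le> a" "a < b" "b \<le> n" and lt: "x a < x b"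
  shows "len n x < len n (x \<circ> transpose a b)"
proof -
  let ?t = "transpose a b"
  have t: "?t \<in> Sym n" using ab by (auto simp: Sym_def intro!: permutes_swap_id)
  have y: "x \<circ> ?t \<in> Sym n" by (rule Sym_comp[OF x t])
  let ?A = "inversions n ?t" and ?B = "inversions_along n x ?t"
  \<comment> \<open>An inversion of the transposition that \<open>x\<close> inverts along it involves one of \<open>a, b\<close> and some
    \<open>k\<close> strictly between; its mirror pair is then not inverted, and \<open>(a, b)\<close> never is.\<close>
  define m where "m = (\<lambda>(i, j). if i = a then (j, b) else (a, i :: nat))"
  have A: "(i, j) \<in> ?A \<longleftrightarrow> i < j \<and> (i = a \<and> j \<le> b \<or> j = b \<and> a \<le> i)" for i j
    using ab unfolding inversions_def transpose_def by (cases "i = a"; cases "j = b"; cases "i = b"; cases "j = a") auto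
  have B1: "(a, j) \<in> ?B \<longleftrightarrow> x b < x j" if "a < j" "j < b" for j
    using ab that by (auto simp: inversions_along_def)
  have B2: "(i, b) \<in> ?B \<longleftrightarrow> x i < x a" if "a < i" "i < b" for i
    using ab that by (auto simp: inversions_along_def)
  have B3: "(a, b) \<notin> ?B" using ab lt by (auto simp: inversions_along_def)
  have AB: "(\<exists>j. p = (a, j) \<and> a < j \<and> j < b \<and> x b < x j) \<or> (\<exists>i. p = (i, b) \<and> a < i \<and> i < b \<and> x i < x a)"
    if "p \<in> ?A \<inter> ?B" for p
  proof -
    obtain i j where p: "p = (i, j)" by (cases p)
    then have ij: "i < j" "i = a \<and> j \<le> b \<or> j = b \<and> a \<le> i" "(i, j) \<in> ?B" using that A by auto
    then have "(i, j) \<noteq> (a, b)" using B3 by auto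
    with ij(1,2) consider "i = a" "a < j" "j < b" | "j = b" "a < i" "i < b" using ab by force
    then show ?thesis using ij(3) B1 B2 p by cases auto
  qed
  have inj: "inj_on m (?A \<inter> ?B)"
  proof (rule inj_onI)
    fix p q assume "p \<in> ?A \<inter> ?B" "q \<in> ?A \<inter> ?B" "m p = m q"
    with AB[of p] AB[of q] show "p = q" by (auto simp: m_def split: if_splits)
  qed
  have sub: "m ` (?A \<inter> ?B) \<subseteq> (?A - ?B) - {(a, b)}"
  proof (rule image_subsetI)
    fix p assume "p \<in> ?A \<inter> ?B"
    with AB[of p] show "m p \<in> (?A - ?B) - {(a, b)}"
      using lt by (auto simp: m_def A B1 B2)
  qed
  have mem: "(a, b) \<in> ?A - ?B"
    using ab lt by (auto simp: inversions_def inversions_along_def)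
  have fin: "finite (?A - ?B)" using finite_inversions by auto
  have "card (?A \<inter> ?B) = card (m ` (?A \<inter> ?B))" using card_image[OF inj] by simp
  also have "\<dots> \<le> card ((?A - ?B) - {(a, b)})" using fin sub by (intro card_mono) auto
  also have "\<dots> < card (?A - ?B)" using fin mem by (intro psubset_card_mono) auto
  finally have "2 * card (?A \<inter> ?B) < card ?A"
    using card_Int_Diff[OF finite_inversions[of n ?t], of ?B] by linarith
  then show ?thesis
    using card_inversions_comp[OF t x] by (simp add: len_eq_card_inversions x y)
qed

lemma len_comp_transpose_less_iff:
  assumes x: "x \<in> Sym n" and ab: "1 \<le> a" "a < b" "b \<le> n"
  shows "len n x < len n (x \<circ> transpose a b) \<longleftrightarrow> x a < x b"
proof
  assume l: "len n x < len n (x \<circ> transpose a b)"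
  show "x a < x b"
  proof (rule ccontr)
    assume "\<not> x a < x b"
    then have "(x \<circ> transpose a b) a < (x \<circ> transpose a b) b" using Sym_inj[OF x, of a b] ab by auto
    moreover have "x \<circ> transpose a b \<in> Sym n"
      using ab by (intro Sym_comp x) (auto simp: Sym_def intro!: permutes_swap_id)
    ultimately have "len n (x \<circ> transpose a b) < len n (x \<circ> transpose a b \<circ> transpose a b)"
      by (intro len_comp_transpose_less ab)
    then show False using l by (simp add: o_assoc[symmetric])
  qed
qed (rule len_comp_transpose_less[OF assms])

text \<open>The reflection lengthens iff the letters at \<open>a\<close> and \<open>b\<close> are in
  increasing order. Left multiplication by \<open>s\<close> preserves that order unless these
  letters are the two that \<open>s\<close> exchanges.\<close>

lemma simple_comp_reflection:
  assumes x: "x \<in> Sym n" and t: "t \<in> reflections n" and lt: "len n x < len n (x \<circ> t)" and s: "s \<in> simples n"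
  shows "s \<circ> x = x \<circ> t \<or> len n (s \<circ> x) < len n (s \<circ> x \<circ> t)"
proof -
  obtain a b where ab: "1 \<le> a" "a < b" "b \<le> n" "t = transpose a b"
    using reflections_transpose[OF t] by blast
  obtain i where i: "s = simple i" using s by (auto simp: simples_def)
  have xl: "x a < x b" using len_comp_transpose_less_iff[OF x ab(1-3)] lt ab by simp
  show ?thesis
  proof (cases "x a = i \<and> x b = Suc i")
    case True
    have "s \<circ> x = x \<circ> t"
    proof
      fix k
      have "x k = i \<longleftrightarrow> k = a" "x k = Suc i \<longleftrightarrow> k = b" using True Sym_inj[OF x] by metis+
      then show "(s \<circ> x) k = (x \<circ> t) k" using True by (auto simp: i ab simple_def transpose_def)
    qed
    then show ?thesis ..
  next
    case False
    then have "(s \<circ> x) a < (s \<circ> x) b" using xl by (auto simp: i simple_def transpose_def)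
    then show ?thesis
      using len_comp_transpose_less[of "s \<circ> x" n a b] ab Sym_comp simples_Sym s x by auto
  qed
qed

text \<open>Multiply a chain from \<open>y\<close> to \<open>w\<close> by \<open>s\<close> on the
  left. Either every link survives and the chain ends at s w, or at some link \<open>s\<close> acts
  as the reflection, and from there the old chain leads on to \<open>w\<close>.\<close>

lemma bruhat_lifting:
  assumes "bruhat_le n y w" and s: "s \<in> simples n"
  shows "bruhat_le n (s \<circ> y) w \<or> bruhat_le n (s \<circ> y) (s \<circ> w)"
proof -
  have w: "w \<in> Sym n" using assms by (simp add: bruhat_le_def)
  have "(\<lambda>x y. \<exists>t \<in> reflections n. y = x \<circ> t \<and> len n x < len n y)\<^sup>*\<^sup>* y w"
    using assms by (simp add: bruhat_le_def)
  then have "y \<in> Sym n \<longrightarrow> bruhat_le n (s \<circ> y) w \<or> bruhat_le n (s \<circ> y) (s \<circ> w)"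
  proof (induction rule: converse_rtranclp_induct)
    case base
    show ?case using bruhat_le_refl[OF Sym_comp[OF simples_Sym[OF s] w]] by blast
  next
    case (step x y)
    then obtain t where t: "t \<in> reflections n" "y = x \<circ> t" "len n x < len n y" by blast
    show ?case
    proof
      assume x: "x \<in> Sym n"
      then have y: "y \<in> Sym n" using t Sym_comp reflections_Sym by blast
      have yw: "bruhat_le n y w" using step(2) y w by (simp add: bruhat_le_def)
      from simple_comp_reflection[OF x t(1) _ s] t
      have "s \<circ> x = y \<or> len n (s \<circ> x) < len n (s \<circ> x \<circ> t)" by blast
      then show "bruhat_le n (s \<circ> x) w \<or> bruhat_le n (s \<circ> x) (s \<circ> w)"
      proof
        assume "s \<circ> x = y" then show ?thesis using yw by simp
      next
        assume "len n (s \<circ> x) < len n (s \<circ> x \<circ> t)"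
        then have "bruhat_le n (s \<circ> x) (s \<circ> x \<circ> t)"
          using bruhat_le_reflection x s t simples_Sym Sym_comp by blast
        moreover have "s \<circ> x \<circ> t = s \<circ> y" using t by (simp add: o_assoc)
        ultimately show ?thesis using step.IH y bruhat_le_trans by metis
      qed
    qed
  qed
  then show ?thesis using assms by (simp add: bruhat_le_def)
qed

lemma bruhat_le_left_simple:
  assumes w: "w \<in> Sym n" and s: "s \<in> simples n" and l: "len n w < len n (s \<circ> w)"
  shows "bruhat_le n w (s \<circ> w)"
proof -
  \<comment> \<open>The Bruhat order is defined by reflections on the right; \<open>s\<close> on the
    left equals its conjugate by \<open>w\<close> on the right.\<close>
  have "inv w \<circ> s \<circ> inv (inv w) \<in> reflections n"
    using w s Sym_inv by (auto simp: reflections_def)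
  moreover have "w \<circ> (inv w \<circ> s \<circ> inv (inv w)) = s \<circ> w"
    by (simp add: Sym_inv_inv[OF w] o_assoc Sym_inv_comp[OF w])
  ultimately show ?thesis using bruhat_le_reflection w l by metis
qed

lemma bruhat_le_simple_mono:
  assumes "bruhat_le n y w" and s: "s \<in> simples n" and l: "len n w < len n (s \<circ> w)"
  shows "bruhat_le n y (s \<circ> w)" "bruhat_le n (s \<circ> y) (s \<circ> w)"
proof -
  have w: "w \<in> Sym n" using assms by (simp add: bruhat_le_def)
  from bruhat_le_left_simple[OF w s l] have 1: "bruhat_le n w (s \<circ> w)" .
  show "bruhat_le n y (s \<circ> w)" using assms(1) 1 by (rule bruhat_le_trans)
  show "bruhat_le n (s \<circ> y) (s \<circ> w)" using bruhat_lifting[OF assms(1) s] bruhat_le_trans 1 by blast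
qed

section \<open>Laurent polynomials\<close>

abbreviation (input) coef :: "laurent \<Rightarrow> int \<Rightarrow> int" where
  "coef \<equiv> Poly_Mapping.lookup"

lemma coef_single_mult: "coef (Poly_Mapping.single k c * f) j = c * coef f (j - k)"
proof -
  have *: "(j = k + q) = (q = j - k)" for q by auto
  have "coef (Poly_Mapping.single k c * f) j
      = Sum_any (\<lambda>l. (c * Sum_any (\<lambda>q. coef f q when j = l + q)) when l = k)"
    unfolding lookup_mult by (intro Sum_any.cong) (auto simp: lookup_single when_def)
  also have "\<dots> = c * Sum_any (\<lambda>q. coef f q when q = j - k)"
    by (simp add: *)
  finally show ?thesis by simp
qed

lemma coef_v_pow_mult: "coef (v_pow k * f) j = coef f (j - k)"
  by (simp add: v_pow_def coef_single_mult)

lemma coef_of_int_mult: "coef (of_int c * f) j = c * coef f j"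
proof -
  have "of_int c = (Poly_Mapping.single 0 c :: laurent)" by (metis of_int_eq_id id_apply single_of_int)
  then show ?thesis using coef_single_mult[of 0 c f j] by simp
qed

lemma coef_v_pow: "coef (v_pow k) j = (if j = k then 1 else 0)"
  by (simp add: v_pow_def lookup_single when_def)

lemma coef_laurent_one: "coef 1 j = (if j = 0 then 1 else 0)"
  by (simp add: lookup_one when_def)

lemma v_pow_0 [simp]: "v_pow 0 = 1"
  by (rule poly_mapping_eqI) (simp add: coef_v_pow coef_laurent_one)

lemma v_pow_mult: "v_pow a * v_pow b = v_pow (a + b)"
  by (simp add: v_pow_def mult_single)

lemma v_pow_mult_assoc: "v_pow a * (v_pow b * f) = v_pow (a + b) * f"
  by (simp add: v_pow_mult mult.assoc[symmetric])

lemma v_pow_neq_0 [simp]: "v_pow k \<noteq> 0"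
  by (metis v_pow_0 v_pow_mult add.right_inverse mult_zero_left zero_neq_one)

lemmas v_pow_simps = distrib_left distrib_right left_diff_distrib right_diff_distrib
  v_pow_mult v_pow_mult_assoc mult.assoc

lemma coef_laurent_bar: "coef (laurent_bar f) k = coef f (- k)"
  unfolding laurent_bar_def by (subst map_key.rep_eq) (auto simp: inj_def)

lemma laurent_bar_add: "laurent_bar (f + g) = laurent_bar f + laurent_bar g"
  by (rule poly_mapping_eqI) (simp add: coef_laurent_bar lookup_add)

lemma laurent_bar_diff: "laurent_bar (f - g) = laurent_bar f - laurent_bar g"
  by (rule poly_mapping_eqI) (simp add: coef_laurent_bar lookup_minus)

lemma laurent_bar_0 [simp]: "laurent_bar 0 = 0"
  by (rule poly_mapping_eqI) (simp add: coef_laurent_bar)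

lemma laurent_bar_1 [simp]: "laurent_bar 1 = 1"
  by (rule poly_mapping_eqI) (simp add: coef_laurent_bar coef_laurent_one)

lemma laurent_bar_v_pow_mult: "laurent_bar (v_pow k * f) = v_pow (- k) * laurent_bar f"
  by (rule poly_mapping_eqI) (simp add: coef_laurent_bar coef_v_pow_mult)

lemma laurent_bar_of_int_mult: "laurent_bar (of_int c * f) = of_int c * laurent_bar f"
  by (rule poly_mapping_eqI) (simp add: coef_laurent_bar coef_of_int_mult)

section \<open>Multiplication by a simple reflection\<close>

text \<open>
  The action of the Hecke algebra generators is studied in normalised coordinates: the
  coefficient function \<open>p\<close> stands for the sum of \<open>p w \<cdot> v\<^sup>-\<^sup>l\<^sup>(\<^sup>w\<^sup>) T\<^sub>w\<close>. The operator below is then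
  multiplication by \<open>C\<^sub>s = v\<^sup>-\<^sup>1 (T\<^sub>s + 1)\<close>, from the left if \<open>\<sigma> w = s w\<close> and from the right if
  \<open>\<sigma> w = w s\<close>.
\<close>

definition C_op :: "nat \<Rightarrow> (perm \<Rightarrow> perm) \<Rightarrow> hecke \<Rightarrow> hecke" where
  "C_op n \<sigma> p = (\<lambda>w. if w \<in> Sym n
     then p (\<sigma> w) + v_pow (if len n (\<sigma> w) < len n w then 1 else - 1) * p w else 0)"

text \<open>All that the computations with \<open>C_op\<close> need to know about multiplication by
  a simple reflection, so that they apply to both sides.\<close>

definition simple_action :: "nat \<Rightarrow> (perm \<Rightarrow> perm) \<Rightarrow> bool" where
  "simple_action n \<sigma> \<longleftrightarrow> (\<forall>w \<in> Sym n. \<sigma> w \<in> Sym n \<and> \<sigma> (\<sigma> w) = w \<and>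
     (len n (\<sigma> w) = Suc (len n w) \<or> len n w = Suc (len n (\<sigma> w))))"

lemma simple_actionD:
  assumes "simple_action n \<sigma>" "w \<in> Sym n"
  shows "\<sigma> w \<in> Sym n" "\<sigma> (\<sigma> w) = w"
    "len n (\<sigma> w) = Suc (len n w) \<or> len n w = Suc (len n (\<sigma> w))"
  using assms by (auto simp: simple_action_def)

lemma simple_action_left: "s \<in> simples n \<Longrightarrow> simple_action n (\<lambda>w. s \<circ> w)"
  using len_left_cases by (auto simp: simple_action_def Sym_comp simples_Sym simples_cancel simp del: o_apply)

lemma simple_action_right: "s \<in> simples n \<Longrightarrow> simple_action n (\<lambda>w. w \<circ> s)"
  using len_right_cases by (auto simp: simple_action_def Sym_comp simples_Sym simples_cancel simp del: o_apply)

lemma C_op_carrier: "C_op n \<sigma> p \<in> hecke_carrier n"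
  by (simp add: C_op_def hecke_carrier_def)

lemma C_op_add: "C_op n \<sigma> (\<lambda>w. a w + b w) = (\<lambda>w. C_op n \<sigma> a w + C_op n \<sigma> b w)"
  by (auto simp: C_op_def algebra_simps)

lemma C_op_diff: "C_op n \<sigma> (\<lambda>w. a w - b w) = (\<lambda>w. C_op n \<sigma> a w - C_op n \<sigma> b w)"
  by (auto simp: C_op_def algebra_simps)

lemma C_op_scale: "C_op n \<sigma> (\<lambda>w. c * a w) = (\<lambda>w. c * C_op n \<sigma> a w)"
  by (auto simp: C_op_def algebra_simps)

lemma C_op_sum: "C_op n \<sigma> (\<lambda>w. \<Sum>x\<in>A. f x w) = (\<lambda>w. \<Sum>x\<in>A. C_op n \<sigma> (f x) w)"
  by (auto simp: C_op_def sum.distrib sum_distrib_left)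

text \<open>The operator acts separately on each pair \<open>w\<close>, \<open>\<sigma> w\<close>,
  where it is a matrix of rank one and trace v + v^-1.\<close>

lemma C_op_square:
  assumes "simple_action n \<sigma>"
  shows "C_op n \<sigma> (C_op n \<sigma> p) = (\<lambda>w. (v_pow 1 + v_pow (- 1)) * C_op n \<sigma> p w)"
proof
  fix w
  show "C_op n \<sigma> (C_op n \<sigma> p) w = (v_pow 1 + v_pow (- 1)) * C_op n \<sigma> p w"
  proof (cases "w \<in> Sym n")
    case True
    note * = simple_actionD[OF assms True]
    define b where "b = (len n (\<sigma> w) < len n w)"
    have "(len n w < len n (\<sigma> w)) = (\<not> b)" using *(3) by (auto simp: b_def)
    then have C: "C_op n \<sigma> q w = q (\<sigma> w) + v_pow (if b then 1 else - 1) * q w"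
      "C_op n \<sigma> q (\<sigma> w) = q w + v_pow (if b then - 1 else 1) * q (\<sigma> w)" for q
      using *(1,2) True by (simp_all add: C_op_def b_def)
    show ?thesis
      unfolding C by (simp add: v_pow_simps)
  qed (simp add: C_op_def)
qed

text \<open>If s w differs from w t, neither multiplication changes the descent that governs the
  other. If they coincide, both operators act on the same pair of coordinates and by the same
  matrix.\<close>

lemma C_op_commute:
  assumes s: "s \<in> simples n" and t: "t \<in> simples n"
  shows "C_op n (\<lambda>w. s \<circ> w) (C_op n (\<lambda>w. w \<circ> t) p) = C_op n (\<lambda>w. w \<circ> t) (C_op n (\<lambda>w. s \<circ> w) p)"
proof
  fix w
  let ?L = "\<lambda>w. len n (s \<circ> w) < len n w" and ?R = "\<lambda>w. len n (w \<circ> t) < len n w"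
  let ?e = "\<lambda>b. v_pow (if b then 1 else - 1)"
  show "C_op n (\<lambda>w. s \<circ> w) (C_op n (\<lambda>w. w \<circ> t) p) w = C_op n (\<lambda>w. w \<circ> t) (C_op n (\<lambda>w. s \<circ> w) p) w"
  proof (cases "w \<in> Sym n")
    case w: True
    have S: "s \<circ> w \<in> Sym n" "w \<circ> t \<in> Sym n" using Sym_comp simples_Sym w s t by blast+
    have lhs: "C_op n (\<lambda>w. s \<circ> w) (C_op n (\<lambda>w. w \<circ> t) p) w = p (s \<circ> w \<circ> t) + ?e (?R (s \<circ> w)) * p (s \<circ> w)
        + ?e (?L w) * (p (w \<circ> t) + ?e (?R w) * p w)"
      using w S by (simp only: C_op_def if_True)
    have rhs: "C_op n (\<lambda>w. w \<circ> t) (C_op n (\<lambda>w. s \<circ> w) p) w = p (s \<circ> w \<circ> t) + ?e (?L (w \<circ> t)) * p (w \<circ> t)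
        + ?e (?R w) * (p (s \<circ> w) + ?e (?L w) * p w)"
      using w S by (simp only: C_op_def if_True o_assoc)
    show ?thesis
    proof (cases "s \<circ> w = w \<circ> t")
      case False
      have 1: "?L (w \<circ> t) = ?L w" using left_descent_comp_simple[OF w s t False] .
      have 2: "?R (s \<circ> w) = ?R w" using right_descent_comp_simple[OF w s t False] .
      show ?thesis unfolding lhs rhs 1 2 by (simp only: algebra_simps)
    next
      case True
      have e: "s \<circ> (w \<circ> t) = w" "s \<circ> w \<circ> t = w"
        using simples_cancel(1)[OF s, of w] simples_cancel(2)[OF t, of w] True by simp_all
      have l: "len n w < len n (s \<circ> w) \<longleftrightarrow> \<not> ?L w"
        using len_left_cases[OF w s] by arith
      have 1: "?L (w \<circ> t) = (\<not> ?L w)" by (simp only: True[symmetric] simples_cancel(1)[OF s] l)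
      have 2: "?R (s \<circ> w) = (\<not> ?L w)" "?R w = ?L w"
        by (simp_all only: e(2) True[symmetric] l)
      show ?thesis unfolding lhs rhs 1 2 unfolding True by (cases "?R w") (simp_all only: simp_thms if_True if_False algebra_simps)
    qed
  qed (simp add: C_op_def)
qed

section \<open>The Hecke algebra\<close>

definition T_op :: "nat \<Rightarrow> (perm \<Rightarrow> perm) \<Rightarrow> hecke \<Rightarrow> hecke" where
  "T_op n \<sigma> h = (\<lambda>w. if w \<notin> Sym n then 0
     else if len n (\<sigma> w) < len n w then h (\<sigma> w) + (q_laurent - 1) * h w
     else q_laurent * h (\<sigma> w))"

lemma simple_mult_eq_T_op: "simple_mult n s = T_op n (\<lambda>w. s \<circ> w)"
  by (auto simp: simple_mult_def T_op_def)

abbreviation (input) right_mult :: "nat \<Rightarrow> perm \<Rightarrow> hecke \<Rightarrow> hecke" where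
  "right_mult n s \<equiv> T_op n (\<lambda>w. w \<circ> s)"

definition normalise :: "nat \<Rightarrow> hecke \<Rightarrow> hecke" where
  "normalise n h = (\<lambda>w. v_pow (int (len n w)) * h w)"

lemma normalise_inj: "normalise n h = normalise n g \<longleftrightarrow> h = g"
  by (auto simp: normalise_def fun_eq_iff)

text \<open>This is C_s = v^-1 (T_s + 1) solved for T_s; through it statements about
  \<open>C_op\<close> pass to the given Hecke algebra.\<close>

lemma normalise_T_op:
  assumes "simple_action n \<sigma>" "h \<in> hecke_carrier n"
  shows "normalise n (T_op n \<sigma> h) = (\<lambda>w. v_pow 1 * C_op n \<sigma> (normalise n h) w - normalise n h w)"
proof
  fix w
  show "normalise n (T_op n \<sigma> h) w = v_pow 1 * C_op n \<sigma> (normalise n h) w - normalise n h w"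
  proof (cases "w \<in> Sym n")
    case True
    from simple_actionD(3)[OF assms(1) True] show ?thesis
      using True by (auto simp: normalise_def T_op_def C_op_def q_laurent_def v_pow_simps add.commute)
  next
    case False
    then show ?thesis using assms(2) by (simp add: normalise_def T_op_def C_op_def hecke_carrier_def)
  qed
qed

lemma T_op_carrier: "T_op n \<sigma> h \<in> hecke_carrier n"
  by (simp add: T_op_def hecke_carrier_def)

lemma T_op_commute:
  assumes "s \<in> simples n" "t \<in> simples n" "h \<in> hecke_carrier n"
  shows "simple_mult n s (right_mult n t h) = right_mult n t (simple_mult n s h)"
proof -
  have "normalise n (simple_mult n s (right_mult n t h)) = normalise n (right_mult n t (simple_mult n s h))"
    unfolding simple_mult_eq_T_op
    using assms by (simp add: normalise_T_op simple_action_left simple_action_right T_op_carrier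
        C_op_diff C_op_scale C_op_commute algebra_simps)
  then show ?thesis by (simp only: normalise_inj)
qed

lemma T_op_add: "T_op n \<sigma> (\<lambda>w. a w + b w) = (\<lambda>w. T_op n \<sigma> a w + T_op n \<sigma> b w)"
  by (auto simp: T_op_def algebra_simps)

lemma T_op_scale: "T_op n \<sigma> (\<lambda>w. c * a w) = (\<lambda>w. c * T_op n \<sigma> a w)"
  by (auto simp: T_op_def algebra_simps)

lemma T_op_square:
  assumes "simple_action n \<sigma>" "h \<in> hecke_carrier n"
  shows "T_op n \<sigma> (T_op n \<sigma> h) = (\<lambda>w. (q_laurent - 1) * T_op n \<sigma> h w + q_laurent * h w)"
proof
  fix w
  show "T_op n \<sigma> (T_op n \<sigma> h) w = (q_laurent - 1) * T_op n \<sigma> h w + q_laurent * h w"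
  proof (cases "w \<in> Sym n")
    case True
    note * = simple_actionD[OF assms(1) True]
    define b where "b = (len n (\<sigma> w) < len n w)"
    have "(len n w < len n (\<sigma> w)) = (\<not> b)" using *(3) by (auto simp: b_def)
    then have T: "T_op n \<sigma> q w = (if b then q (\<sigma> w) + (q_laurent - 1) * q w else q_laurent * q (\<sigma> w))"
      "T_op n \<sigma> q (\<sigma> w) = (if b then q_laurent * q w else q w + (q_laurent - 1) * q (\<sigma> w))" for q
      using *(1,2) True by (simp_all add: T_op_def b_def)
    show ?thesis
      unfolding T by (cases b) (simp_all add: algebra_simps)
  next
    case False
    then show ?thesis using assms(2) by (simp add: T_op_def hecke_carrier_def)
  qed
qed

lemma T_op_bij:
  assumes "simple_action n \<sigma>"
  shows "bij_betw (T_op n \<sigma>) (hecke_carrier n) (hecke_carrier n)"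
proof -
  \<comment> \<open>By the quadratic relation the inverse of T_s is q^-1 (T_s + 1 - q), and q^-1 is
    \<open>v_pow (- 2)\<close>.\<close>
  let ?g = "\<lambda>h w. v_pow (- 2) * (T_op n \<sigma> h w + (1 - q_laurent) * h w)"
  have q: "v_pow (- 2) * (q_laurent * f) = f" for f
    by (simp add: q_laurent_def v_pow_mult_assoc)
  then have q': "q_laurent * (f * v_pow (- 2)) = f" for f by (metis mult.commute mult.left_commute)
  have 1: "T_op n \<sigma> (?g h) = h" if h: "h \<in> hecke_carrier n" for h
    unfolding T_op_scale T_op_add T_op_square[OF assms h] by (simp add: algebra_simps q')
  have 2: "?g (T_op n \<sigma> h) = h" if h: "h \<in> hecke_carrier n" for h
    unfolding T_op_square[OF assms h] by (simp add: algebra_simps q')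
  show ?thesis
    by (rule bij_betw_byWitness[where f' = ?g])
      (use 1 2 in \<open>auto simp: T_op_carrier simp: hecke_carrier_def T_op_def\<close>)
qed

lemma T_elt_carrier: "w \<in> Sym n \<Longrightarrow> T_elt w \<in> hecke_carrier n"
  by (auto simp: T_elt_def hecke_carrier_def)

lemma T_op_T_elt:
  assumes "simple_action n \<sigma>" "x \<in> Sym n" "len n x < len n (\<sigma> x)"
  shows "T_op n \<sigma> (T_elt x) = T_elt (\<sigma> x)"
proof
  fix w
  show "T_op n \<sigma> (T_elt x) w = T_elt (\<sigma> x) w"
  proof (cases "w \<in> Sym n")
    case True
    have "\<sigma> w = x \<longleftrightarrow> w = \<sigma> x" using simple_actionD(2) assms True by metis
    then show ?thesis using assms True simple_actionD(2)[OF assms(1) True] by (auto simp: T_op_def T_elt_def)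
  next
    case False
    then show ?thesis using simple_actionD(1)[OF assms(1,2)] by (auto simp: T_op_def T_elt_def)
  qed
qed

lemma T_op_T_id:
  assumes "s \<in> simples n"
  shows "simple_mult n s (T_elt id) = T_elt s" "right_mult n s (T_elt id) = T_elt s"
proof -
  have l: "len n id < len n (id \<circ> s)" "len n id < len n (s \<circ> id)"
    using len_left_cases[OF Sym_id assms] by auto
  show "simple_mult n s (T_elt id) = T_elt s" "right_mult n s (T_elt id) = T_elt s"
    using T_op_T_elt[OF simple_action_left[OF assms] Sym_id l(2)]
      T_op_T_elt[OF simple_action_right[OF assms] Sym_id l(1)]
    by (simp_all only: simple_mult_eq_T_op comp_id id_comp)
qed

text \<open>Endomorphisms of the right regular module. They replace an explicit associative product:
  equality of two of them need only be checked at \<open>T_elt id\<close>.\<close>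

definition right_linear :: "nat \<Rightarrow> (hecke \<Rightarrow> hecke) \<Rightarrow> bool" where
  "right_linear n F \<longleftrightarrow> (\<forall>a b. F (\<lambda>w. a w + b w) = (\<lambda>w. F a w + F b w)) \<and>
     (\<forall>c a. F (\<lambda>w. c * a w) = (\<lambda>w. c * F a w)) \<and>
     (\<forall>h \<in> hecke_carrier n. F h \<in> hecke_carrier n) \<and>
     (\<forall>s \<in> simples n. \<forall>h \<in> hecke_carrier n. F (right_mult n s h) = right_mult n s (F h))"

lemma right_linear_simple_mult: "s \<in> simples n \<Longrightarrow> right_linear n (simple_mult n s)"
  using T_op_commute unfolding right_linear_def
  by (auto simp: simple_mult_eq_T_op T_op_add T_op_scale T_op_carrier)

lemma right_linear_comp: "right_linear n F \<Longrightarrow> right_linear n G \<Longrightarrow> right_linear n (\<lambda>h. F (G h))"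
  by (auto simp: right_linear_def)

lemma right_linear_id: "right_linear n (\<lambda>h. h)"
  by (auto simp: right_linear_def)

lemma right_linear_sum_apply:
  assumes "right_linear n F" "finite A"
  shows "F (\<lambda>w. \<Sum>x\<in>A. c x * f x w) = (\<lambda>w. \<Sum>x\<in>A. c x * F (f x) w)"
  using assms(2)
proof (induction A)
  case empty
  have "F (\<lambda>w. 0 * 0) = (\<lambda>w. 0 * F (\<lambda>w. 0) w)" using assms(1)[unfolded right_linear_def] by (elim conjE allE)
  then show ?case by simp
next
  case (insert a A)
  have "F (\<lambda>w. c a * f a w + (\<Sum>x\<in>A. c x * f x w)) = (\<lambda>w. F (\<lambda>w. c a * f a w) w + F (\<lambda>w. \<Sum>x\<in>A. c x * f x w) w)"
    using assms(1)[unfolded right_linear_def] by (elim conjE allE)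
  also have "F (\<lambda>w. c a * f a w) = (\<lambda>w. c a * F (f a) w)"
    using assms(1)[unfolded right_linear_def] by (elim conjE allE)
  finally show ?case using insert by simp
qed

lemma hecke_expand:
  assumes "h \<in> hecke_carrier n"
  shows "h = (\<lambda>w. \<Sum>x\<in>Sym n. h x * T_elt x w)"
proof
  fix w
  have "(\<Sum>x\<in>Sym n. h x * T_elt x w) = (\<Sum>x\<in>Sym n. if w = x then h x else 0)"
    by (intro sum.cong) (auto simp: T_elt_def)
  then show "h w = (\<Sum>x\<in>Sym n. h x * T_elt x w)"
    using assms finite_Sym[of n] by (auto simp: hecke_carrier_def)
qed

text \<open>As a right module the algebra is generated by \<open>T_elt id\<close>: each
  \<open>T_elt x\<close> arises from a shorter one by right multiplication with a right descent of
  \<open>x\<close>.\<close>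

lemma right_linear_eqI:
  assumes F: "right_linear n F" and G: "right_linear n G" and "F (T_elt id) = G (T_elt id)"
    and h: "h \<in> hecke_carrier n"
  shows "F h = G h"
proof -
  have T: "F (T_elt x) = G (T_elt x)" if "x \<in> Sym n" for x
    using that
  proof (induction "len n x" arbitrary: x rule: less_induct)
    case less
    show ?case
    proof (cases "x = id")
      case True then show ?thesis using assms by simp
    next
      case False
      then obtain s where s: "s \<in> simples n" "len n (x \<circ> s) < len n x"
        using ex_right_descent less.prems by blast
      let ?y = "x \<circ> s"
      have y: "?y \<in> Sym n" "?y \<circ> s = x" using Sym_comp simples_Sym s less.prems simples_cancel by auto
      then have "T_elt x = right_mult n s (T_elt ?y)"
        using T_op_T_elt[OF simple_action_right[OF s(1)] y(1)] s(2) by simp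
      then show ?thesis
        using F G s(1) T_elt_carrier[OF y(1)] less.hyps[OF s(2) y(1)] by (simp add: right_linear_def)
    qed
  qed
  have "F h = F (\<lambda>w. \<Sum>x\<in>Sym n. h x * T_elt x w)" using hecke_expand[OF h] by simp
  also have "\<dots> = (\<lambda>w. \<Sum>x\<in>Sym n. h x * F (T_elt x) w)" by (rule right_linear_sum_apply[OF F finite_Sym])
  also have "\<dots> = (\<lambda>w. \<Sum>x\<in>Sym n. h x * G (T_elt x) w)" using T by simp
  also have "\<dots> = G (\<lambda>w. \<Sum>x\<in>Sym n. h x * T_elt x w)" by (rule right_linear_sum_apply[OF G finite_Sym, symmetric])
  also have "\<dots> = G h" using hecke_expand[OF h] by simp
  finally show ?thesis .
qed

lemma right_linear_foldr: "set ss \<subseteq> simples n \<Longrightarrow> right_linear n (foldr (simple_mult n) ss)"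
proof (induction ss)
  case Nil then show ?case using right_linear_id by (simp add: id_def)
next
  case (Cons s ss)
  then show ?case using right_linear_comp[OF right_linear_simple_mult, of s n "foldr (simple_mult n) ss"]
    by (simp add: o_def)
qed

lemma foldr_simple_mult_bij:
  "set ss \<subseteq> simples n \<Longrightarrow> bij_betw (foldr (simple_mult n) ss) (hecke_carrier n) (hecke_carrier n)"
proof (induction ss)
  case Nil
  have "foldr (simple_mult n) [] = id" by auto
  then show ?case using bij_betw_id by metis
next
  case (Cons s ss)
  then have "bij_betw (simple_mult n s \<circ> foldr (simple_mult n) ss) (hecke_carrier n) (hecke_carrier n)"
    by (intro bij_betw_trans[OF Cons.IH]) (auto simp: simple_mult_eq_T_op intro!: T_op_bij simple_action_left)
  then show ?case by (simp add: o_def)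
qed

lemma len_word_prod_le: "set ss \<subseteq> simples n \<Longrightarrow> len n (word_prod ss) \<le> length ss"
  by (simp add: len_eq_card_inversions word_prod_Sym card_inversions_word_prod)

lemma foldr_simple_mult_T_id:
  "set ss \<subseteq> simples n \<Longrightarrow> len n (word_prod ss) = length ss \<Longrightarrow>
    foldr (simple_mult n) ss (T_elt id) = T_elt (word_prod ss)"
proof (induction ss)
  case (Cons s ss)
  have s: "s \<in> simples n" "set ss \<subseteq> simples n" using Cons by auto
  have w: "word_prod ss \<in> Sym n" by (rule word_prod_Sym[OF s(2)])
  have "len n (s \<circ> word_prod ss) = Suc (length ss)"
    using Cons.prems(2) by (simp only: word_prod_simps list.size add_Suc_right add_0_right)
  then have l: "len n (word_prod ss) = length ss" "len n (word_prod ss) < len n (s \<circ> word_prod ss)"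
    using len_left_cases[OF w s(1)] len_word_prod_le[OF s(2)] by linarith+
  show ?case
    using Cons.IH[OF s(2) l(1)] T_op_T_elt[OF simple_action_left[OF s(1)] w l(2)]
    by (simp add: simple_mult_eq_T_op o_def)
qed simp

context
  fixes n x
  assumes x: "x \<in> Sym n"
begin

lemma T_mult_word: "\<exists>ss. set ss \<subseteq> simples n \<and> word_prod ss = x \<and> length ss = len n x \<and>
  T_mult n x = foldr (simple_mult n) ss"
  using someI_ex[OF ex_reduced_word[OF x]] by (auto simp: T_mult_def fun_eq_iff reduced_word_def)

lemma right_linear_T_mult: "right_linear n (T_mult n x)"
  using T_mult_word right_linear_foldr by metis

lemma T_mult_bij: "bij_betw (T_mult n x) (hecke_carrier n) (hecke_carrier n)"
  using T_mult_word foldr_simple_mult_bij by metis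

lemma T_mult_T_id: "T_mult n x (T_elt id) = T_elt x"
  using T_mult_word foldr_simple_mult_T_id by metis

end

lemma T_mult_id: "h \<in> hecke_carrier n \<Longrightarrow> T_mult n id h = h"
  by (rule right_linear_eqI[OF right_linear_T_mult[OF Sym_id] right_linear_id T_mult_T_id[OF Sym_id]])

text \<open>The words chosen for \<open>y\<close> and for \<open>y \<circ> s\<close> are unrelated,
  but both sides are right linear and agree at \<open>T_elt id\<close>, which makes the choice
  immaterial.\<close>

lemma T_mult_comp_right:
  assumes y: "y \<in> Sym n" and s: "s \<in> simples n" and l: "len n y < len n (y \<circ> s)" and h: "h \<in> hecke_carrier n"
  shows "T_mult n (y \<circ> s) h = T_mult n y (simple_mult n s h)"
proof (rule right_linear_eqI[OF _ _ _ h])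
  have ys: "y \<circ> s \<in> Sym n" using Sym_comp simples_Sym y s by blast
  show "right_linear n (T_mult n (y \<circ> s))" by (rule right_linear_T_mult[OF ys])
  show "right_linear n (\<lambda>h. T_mult n y (simple_mult n s h))"
    by (intro right_linear_comp[OF right_linear_T_mult[OF y]] right_linear_simple_mult s)
  \<comment> \<open>At the unit, left and right multiplication by T_s agree, so the factor can be
    moved out to the right of \<open>T_mult n y\<close>.\<close>
  have "simple_mult n s (T_elt id) = right_mult n s (T_elt id)"
    by (simp only: T_op_T_id[OF s])
  then have "T_mult n y (simple_mult n s (T_elt id)) = right_mult n s (T_mult n y (T_elt id))"
    using right_linear_T_mult[OF y] s T_elt_carrier[OF Sym_id] by (simp add: right_linear_def)
  also have "\<dots> = T_elt (y \<circ> s)"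
    unfolding T_mult_T_id[OF y] by (rule T_op_T_elt[OF simple_action_right[OF s] y l])
  finally show "T_mult n (y \<circ> s) (T_elt id) = T_mult n y (simple_mult n s (T_elt id))"
    by (simp only: T_mult_T_id[OF ys])
qed

lemma T_mult_comp_left:
  assumes y: "y \<in> Sym n" and s: "s \<in> simples n" and l: "len n y < len n (s \<circ> y)" and h: "h \<in> hecke_carrier n"
  shows "T_mult n (s \<circ> y) h = simple_mult n s (T_mult n y h)"
proof (rule right_linear_eqI[OF _ _ _ h])
  have sy: "s \<circ> y \<in> Sym n" using Sym_comp simples_Sym y s by blast
  show "right_linear n (T_mult n (s \<circ> y))" by (rule right_linear_T_mult[OF sy])
  show "right_linear n (\<lambda>h. simple_mult n s (T_mult n y h))"
    by (intro right_linear_comp[OF right_linear_simple_mult] right_linear_T_mult y s)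
  show "T_mult n (s \<circ> y) (T_elt id) = simple_mult n s (T_mult n y (T_elt id))"
    unfolding T_mult_T_id[OF y] T_mult_T_id[OF sy] simple_mult_eq_T_op
    by (rule T_op_T_elt[OF simple_action_left[OF s] y l, symmetric])
qed

lemma hecke_mult_T_elt:
  assumes "y \<in> Sym n"
  shows "hecke_mult n (T_elt y) b = T_mult n y b"
proof
  fix w
  have "hecke_mult n (T_elt y) b w = (\<Sum>x\<in>Sym n. if y = x then T_mult n x b w else 0)"
    unfolding hecke_mult_def by (intro sum.cong) (auto simp: T_elt_def)
  then show "hecke_mult n (T_elt y) b w = T_mult n y b w" using assms finite_Sym[of n] by simp
qed

lemma right_linear_hecke_mult:
  assumes "b \<in> hecke_carrier n"
  shows "right_linear n (hecke_mult n b)"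
proof -
  have a: "T_mult n x (\<lambda>w. a w + c w) w = T_mult n x a w + T_mult n x c w" if "x \<in> Sym n" for x a c w
    using right_linear_T_mult[OF that] by (auto simp: right_linear_def)
  have m: "T_mult n x (\<lambda>w. c * a w) w = c * T_mult n x a w" if "x \<in> Sym n" for x a c w
    using right_linear_T_mult[OF that] by (auto simp: right_linear_def)
  have k: "T_mult n x h w = 0" if "x \<in> Sym n" "h \<in> hecke_carrier n" "w \<notin> Sym n" for x h w
    using right_linear_T_mult[OF that(1)] that by (auto simp: right_linear_def hecke_carrier_def)
  have r: "T_mult n x (right_mult n s h) = right_mult n s (T_mult n x h)"
    if "x \<in> Sym n" "h \<in> hecke_carrier n" "s \<in> simples n" for x h s
    using right_linear_T_mult[OF that(1)] that by (auto simp: right_linear_def)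
  have "hecke_mult n b (right_mult n s h) = right_mult n s (hecke_mult n b h)"
    if "s \<in> simples n" "h \<in> hecke_carrier n" for s h
  proof -
    have *: "(\<Sum>x\<in>A. b x * (if P then 0 else if Q then f x + c * g x else d * f x))
       = (if P then 0 else if Q then (\<Sum>x\<in>A. b x * f x) + c * (\<Sum>x\<in>A. b x * g x) else d * (\<Sum>x\<in>A. b x * f x))"
      for A P Q f g and c d :: laurent
      by (simp add: sum_distrib_left sum.distrib algebra_simps)
    have "right_mult n s (\<lambda>w. \<Sum>x\<in>Sym n. b x * T_mult n x h w) = (\<lambda>w. \<Sum>x\<in>Sym n. b x * right_mult n s (T_mult n x h) w)"
      unfolding T_op_def * ..
    then show ?thesis unfolding hecke_mult_def by (simp add: r[OF _ that(2,1)])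
  qed
  then show ?thesis unfolding right_linear_def
    by (auto simp: hecke_mult_def a m sum.distrib sum_distrib_left algebra_simps hecke_carrier_def
        intro!: sum.cong sum.neutral k)
qed

lemma hecke_mult_T_id:
  assumes "b \<in> hecke_carrier n"
  shows "hecke_mult n b (T_elt id) = b"
proof -
  have "hecke_mult n b (T_elt id) = (\<lambda>w. \<Sum>x\<in>Sym n. b x * T_elt x w)"
    unfolding hecke_mult_def by (intro ext sum.cong refl) (simp only: T_mult_T_id)
  then show ?thesis using hecke_expand[OF assms] by simp
qed

text \<open>Left multiplication by T_y is bijective, so some b satisfies T_y b = 1. Then T_y (b h) =
  h for all h; taking h = T_y and cancelling T_y on the left gives b T_y = 1.\<close>

lemma hecke_inv_T_elt:
  assumes y: "y \<in> Sym n"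
  shows "hecke_inv n (T_elt y) \<in> hecke_carrier n"
    and "T_mult n y (hecke_inv n (T_elt y)) = T_elt id"
    and "b \<in> hecke_carrier n \<Longrightarrow> T_mult n y b = T_elt id \<Longrightarrow> hecke_inv n (T_elt y) = b"
proof -
  let ?P = "\<lambda>b. b \<in> hecke_carrier n \<and> hecke_mult n (T_elt y) b = T_elt id \<and> hecke_mult n b (T_elt y) = T_elt id"
  note bij = T_mult_bij[OF y]
  have inj: "a = b" if "T_mult n y a = T_mult n y b" "a \<in> hecke_carrier n" "b \<in> hecke_carrier n" for a b
    using bij that by (auto simp: bij_betw_def inj_on_def)
  have P: "?P b" if b: "b \<in> hecke_carrier n" "T_mult n y b = T_elt id" for b
  proof -
    have M: "right_linear n (hecke_mult n b)" by (rule right_linear_hecke_mult[OF b(1)])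
    have "T_mult n y (hecke_mult n b h) = h" if "h \<in> hecke_carrier n" for h
      by (rule right_linear_eqI[OF right_linear_comp[OF right_linear_T_mult[OF y] M] right_linear_id _ that])
        (simp add: hecke_mult_T_id[OF b(1)] b(2))
    then have "T_mult n y (hecke_mult n b (T_elt y)) = T_mult n y (T_elt id)"
      using T_elt_carrier[OF y] T_mult_T_id[OF y] by simp
    then have "hecke_mult n b (T_elt y) = T_elt id"
      by (rule inj) (use M T_elt_carrier y Sym_id in \<open>auto simp: right_linear_def\<close>)
    then show ?thesis using b hecke_mult_T_elt[OF y] by simp
  qed
  obtain b where b: "b \<in> hecke_carrier n" "T_mult n y b = T_elt id"
    using bij T_elt_carrier[OF Sym_id] unfolding bij_betw_def by (metis imageE)
  have "\<exists>!b. ?P b"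
  proof (rule ex1I[of _ b])
    show "?P b" by (rule P[OF b])
    fix c assume "?P c"
    then show "c = b" using inj b hecke_mult_T_elt[OF y] by metis
  qed
  from theI'[OF this] have i: "?P (hecke_inv n (T_elt y))" unfolding hecke_inv_def .
  then show "hecke_inv n (T_elt y) \<in> hecke_carrier n" and "T_mult n y (hecke_inv n (T_elt y)) = T_elt id"
    using hecke_mult_T_elt[OF y] by auto
  show "hecke_inv n (T_elt y) = b'" if "b' \<in> hecke_carrier n" "T_mult n y b' = T_elt id" for b'
    using inj i that hecke_mult_T_elt[OF y] by metis
qed

section \<open>The bar involution in normalised coordinates\<close>

text \<open>The image of T_x under the bar involution.\<close>

definition bar_T :: "nat \<Rightarrow> perm \<Rightarrow> hecke" where
  "bar_T n x = hecke_inv n (T_elt (inv x))"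

lemma bar_T_carrier: "x \<in> Sym n \<Longrightarrow> bar_T n x \<in> hecke_carrier n"
  by (simp add: bar_T_def hecke_inv_T_elt Sym_inv)

lemma bar_T_id: "bar_T n id = T_elt id"
  unfolding bar_T_def inv_id
  by (rule hecke_inv_T_elt(3)[OF Sym_id]) (simp_all add: T_mult_id T_elt_carrier Sym_id)

text \<open>The inverse of s y is inv y times \<open>s\<close>, so the element to be inverted is
  T_(inv y) T_s, and its inverse begins with the inverse of T_s.\<close>

lemma simple_mult_bar_T:
  assumes y: "y \<in> Sym n" and s: "s \<in> simples n" and l: "len n y < len n (s \<circ> y)"
  shows "simple_mult n s (bar_T n (s \<circ> y)) = bar_T n y"
proof -
  have sy: "s \<circ> y \<in> Sym n" using Sym_comp simples_Sym y s by blast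
  have i: "inv (s \<circ> y) = inv y \<circ> s" by (rule simples_comp_inv[OF y s])
  have "len n (inv y) < len n (inv y \<circ> s)" using l len_inv[OF sy] len_inv[OF y] i by simp
  from T_mult_comp_right[OF Sym_inv[OF y] s this bar_T_carrier[OF sy]]
  have "T_mult n (inv y) (simple_mult n s (bar_T n (s \<circ> y))) = T_elt id"
    using hecke_inv_T_elt(2)[OF Sym_inv[OF sy]] by (simp add: bar_T_def i)
  then show ?thesis
    using hecke_inv_T_elt(3)[OF Sym_inv[OF y]] T_op_carrier unfolding bar_T_def simple_mult_eq_T_op by metis
qed

lemma right_mult_bar_T:
  assumes y: "y \<in> Sym n" and s: "s \<in> simples n" and l: "len n y < len n (y \<circ> s)"
  shows "right_mult n s (bar_T n (y \<circ> s)) = bar_T n y"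
proof -
  have ys: "y \<circ> s \<in> Sym n" using Sym_comp simples_Sym y s by blast
  have i: "inv (y \<circ> s) = s \<circ> inv y" by (rule simples_comp_inv[OF y s])
  let ?X = "T_mult n (inv y) (bar_T n (y \<circ> s))"
  have X: "?X \<in> hecke_carrier n"
    using right_linear_T_mult[OF Sym_inv[OF y]] bar_T_carrier[OF ys] by (simp add: right_linear_def)
  have "len n (inv y) < len n (s \<circ> inv y)" using l len_inv[OF ys] len_inv[OF y] i by simp
  from T_mult_comp_left[OF Sym_inv[OF y] s this bar_T_carrier[OF ys]]
  have *: "simple_mult n s ?X = T_elt id"
    using hecke_inv_T_elt(2)[OF Sym_inv[OF ys]] by (simp add: bar_T_def i)
  \<comment> \<open>\<open>?X\<close> is a right inverse of T_s. It is also a left inverse, since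
    T_s (X T_s) = (T_s X) T_s = T_s and T_s can be cancelled.\<close>
  have "simple_mult n s (right_mult n s ?X) = right_mult n s (T_elt id)"
    using T_op_commute[OF s s X] * by simp
  also have "\<dots> = simple_mult n s (T_elt id)" by (simp only: T_op_T_id[OF s])
  finally have "right_mult n s ?X = T_elt id"
    using T_op_bij[OF simple_action_left[OF s]] T_op_carrier T_elt_carrier[OF Sym_id]
    unfolding bij_betw_def inj_on_def simple_mult_eq_T_op by blast
  then have "T_mult n (inv y) (right_mult n s (bar_T n (y \<circ> s))) = T_elt id"
    using right_linear_T_mult[OF Sym_inv[OF y]] bar_T_carrier[OF ys] s by (simp add: right_linear_def)
  then show ?thesis
    using hecke_inv_T_elt(3)[OF Sym_inv[OF y]] T_op_carrier unfolding bar_T_def by metis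
qed

text \<open>The bar image of the normalised basis element v^(-l(x)) T_x, again in normalised
  coordinates; this explains the positive exponent.\<close>

definition bar_basis :: "nat \<Rightarrow> perm \<Rightarrow> hecke" where
  "bar_basis n x = (\<lambda>w. v_pow (int (len n x)) * normalise n (bar_T n x) w)"

definition norm_bar :: "nat \<Rightarrow> hecke \<Rightarrow> hecke" where
  "norm_bar n p = (\<lambda>w. \<Sum>x\<in>Sym n. laurent_bar (p x) * bar_basis n x w)"

lemma bar_basis_carrier: "x \<in> Sym n \<Longrightarrow> bar_basis n x \<in> hecke_carrier n"
  using bar_T_carrier[of x n] by (simp add: bar_basis_def normalise_def hecke_carrier_def)

lemma norm_bar_normalise: "norm_bar n (normalise n h) = normalise n (hecke_bar n h)"
proof
  fix w
  have *: "(v_pow (- a) * b) * (v_pow a * (c * d)) = c * (b * d)" for a b c d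
  proof -
    have "(v_pow (- a) * b) * (v_pow a * (c * d)) = (v_pow (- a) * v_pow a) * (c * (b * d))"
      by (simp only: mult_ac)
    then show ?thesis by (simp add: v_pow_mult)
  qed
  show "norm_bar n (normalise n h) w = normalise n (hecke_bar n h) w"
    unfolding norm_bar_def normalise_def hecke_bar_def bar_basis_def bar_T_def laurent_bar_v_pow_mult sum_distrib_left *
    by (rule refl)
qed

definition bar_action :: "nat \<Rightarrow> (perm \<Rightarrow> perm) \<Rightarrow> bool" where
  "bar_action n \<sigma> \<longleftrightarrow> simple_action n \<sigma> \<and>
     (\<forall>y \<in> Sym n. len n y < len n (\<sigma> y) \<longrightarrow> T_op n \<sigma> (bar_T n (\<sigma> y)) = bar_T n y)"

lemma bar_action_left: "s \<in> simples n \<Longrightarrow> bar_action n (\<lambda>w. s \<circ> w)"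
  using simple_mult_bar_T simple_action_left by (auto simp: bar_action_def simple_mult_eq_T_op simp del: o_apply)

lemma bar_action_right: "s \<in> simples n \<Longrightarrow> bar_action n (\<lambda>w. w \<circ> s)"
  using right_mult_bar_T simple_action_right by (auto simp: bar_action_def simp del: o_apply)

text \<open>The bar images multiply like the normalised basis itself, with v and v^-1 exchanged. The
  first formula restates \<open>bar_action\<close>; applying the operator to it once more and using
  \<open>C_op_square\<close> yields the second.\<close>

lemma C_op_bar_basis_up:
  assumes "bar_action n \<sigma>" "y \<in> Sym n" "len n y < len n (\<sigma> y)"
  shows "C_op n \<sigma> (bar_basis n (\<sigma> y)) = (\<lambda>w. bar_basis n y w + v_pow (- 1) * bar_basis n (\<sigma> y) w)"
    and "C_op n \<sigma> (bar_basis n y) = (\<lambda>w. bar_basis n (\<sigma> y) w + v_pow 1 * bar_basis n y w)"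
proof -
  have sa: "simple_action n \<sigma>" using assms by (simp add: bar_action_def)
  note sy = simple_actionD[OF sa assms(2)]
  have l: "int (len n (\<sigma> y)) = int (len n y) + 1" using sy(3) assms(3) by auto
  have "normalise n (bar_T n y) = (\<lambda>w. v_pow 1 * C_op n \<sigma> (normalise n (bar_T n (\<sigma> y))) w - normalise n (bar_T n (\<sigma> y)) w)"
    using normalise_T_op[OF sa bar_T_carrier[OF sy(1)]] assms by (simp add: bar_action_def)
  then have "bar_basis n y w = C_op n \<sigma> (bar_basis n (\<sigma> y)) w - v_pow (- 1) * bar_basis n (\<sigma> y) w" for w
    by (simp add: bar_basis_def C_op_scale l algebra_simps v_pow_mult_assoc)
  then show 1: "C_op n \<sigma> (bar_basis n (\<sigma> y)) = (\<lambda>w. bar_basis n y w + v_pow (- 1) * bar_basis n (\<sigma> y) w)"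
    by (auto simp: fun_eq_iff)
  have "C_op n \<sigma> (C_op n \<sigma> (bar_basis n (\<sigma> y))) w = C_op n \<sigma> (bar_basis n y) w + v_pow (- 1) * C_op n \<sigma> (bar_basis n (\<sigma> y)) w" for w
    using fun_cong[OF arg_cong[OF 1, of "C_op n \<sigma>"], of w] by (simp only: C_op_add C_op_scale)
  then have "C_op n \<sigma> (bar_basis n y) w = v_pow 1 * C_op n \<sigma> (bar_basis n (\<sigma> y)) w" for w
    unfolding C_op_square[OF sa] by (simp add: algebra_simps)
  then show "C_op n \<sigma> (bar_basis n y) = (\<lambda>w. bar_basis n (\<sigma> y) w + v_pow 1 * bar_basis n y w)"
    unfolding 1 by (simp add: fun_eq_iff algebra_simps v_pow_mult_assoc)
qed

lemma C_op_bar_basis: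
  assumes "bar_action n \<sigma>" "x \<in> Sym n"
  shows "C_op n \<sigma> (bar_basis n x) w =
    bar_basis n (\<sigma> x) w + v_pow (if len n (\<sigma> x) < len n x then - 1 else 1) * bar_basis n x w"
proof -
  have sa: "simple_action n \<sigma>" using assms by (simp add: bar_action_def)
  note sx = simple_actionD[OF sa assms(2)]
  show ?thesis
  proof (cases "len n (\<sigma> x) < len n x")
    case True
    then show ?thesis using C_op_bar_basis_up(1)[OF assms(1) sx(1)] by (simp add: sx(2))
  next
    case False
    then show ?thesis using C_op_bar_basis_up(2)[OF assms] sx(3) by simp
  qed
qed

lemma simple_action_reindex:
  assumes "simple_action n \<sigma>"
  shows "(\<Sum>x\<in>Sym n. f (\<sigma> x)) = (\<Sum>x\<in>Sym n. f x)"
  by (rule sum.reindex_bij_witness[of _ \<sigma> \<sigma>]) (use simple_actionD[OF assms] in auto)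

text \<open>This expresses that C_s is bar invariant. Conjugating the scalars exchanges v and v^-1,
  which is exactly how the multiplication rules of the basis and of its bar image differ.\<close>

lemma norm_bar_C_op:
  assumes "bar_action n \<sigma>"
  shows "norm_bar n (C_op n \<sigma> p) = C_op n \<sigma> (norm_bar n p)"
proof
  fix w
  let ?D = "bar_basis n"
  have sa: "simple_action n \<sigma>" using assms by (simp add: bar_action_def)
  have "norm_bar n (C_op n \<sigma> p) w = (\<Sum>x\<in>Sym n. laurent_bar (p (\<sigma> x)) * ?D x w)
      + (\<Sum>x\<in>Sym n. laurent_bar (p x) * (v_pow (if len n (\<sigma> x) < len n x then - 1 else 1) * ?D x w))"
    unfolding norm_bar_def sum.distrib[symmetric]
    by (intro sum.cong refl) (simp_all add: C_op_def laurent_bar_add laurent_bar_v_pow_mult distrib_right mult.assoc mult.left_commute)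
  also have "(\<Sum>x\<in>Sym n. laurent_bar (p (\<sigma> x)) * ?D x w) = (\<Sum>x\<in>Sym n. laurent_bar (p x) * ?D (\<sigma> x) w)"
    using simple_action_reindex[OF sa, of "\<lambda>x. laurent_bar (p x) * ?D (\<sigma> x) w"] simple_actionD(2)[OF sa] by simp
  also have "\<dots> + (\<Sum>x\<in>Sym n. laurent_bar (p x) * (v_pow (if len n (\<sigma> x) < len n x then - 1 else 1) * ?D x w))
     = (\<Sum>x\<in>Sym n. laurent_bar (p x) * C_op n \<sigma> (?D x) w)"
    by (simp add: sum.distrib[symmetric] C_op_bar_basis[OF assms] distrib_left)
  also have "\<dots> = C_op n \<sigma> (norm_bar n p) w"
    unfolding norm_bar_def by (simp add: C_op_sum C_op_scale)
  finally show "norm_bar n (C_op n \<sigma> p) w = C_op n \<sigma> (norm_bar n p) w" .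
qed

lemma norm_bar_add: "norm_bar n (\<lambda>w. a w + b w) = (\<lambda>w. norm_bar n a w + norm_bar n b w)"
  by (simp add: norm_bar_def laurent_bar_add sum.distrib algebra_simps)

lemma norm_bar_diff: "norm_bar n (\<lambda>w. a w - b w) = (\<lambda>w. norm_bar n a w - norm_bar n b w)"
  by (simp add: norm_bar_def laurent_bar_diff sum_subtractf algebra_simps)

lemma norm_bar_scale: "norm_bar n (\<lambda>w. of_int c * a w) = (\<lambda>w. of_int c * norm_bar n a w)"
  by (simp add: norm_bar_def laurent_bar_of_int_mult sum_distrib_left algebra_simps)

lemma norm_bar_sum: "norm_bar n (\<lambda>w. \<Sum>z\<in>A. f z w) = (\<lambda>w. \<Sum>z\<in>A. norm_bar n (f z) w)"
proof (induction A rule: infinite_finite_induct)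
  case (insert a A) then show ?case by (simp add: norm_bar_add)
qed (simp_all add: norm_bar_def)

text \<open>Induction along left descents: the bar image for x = s y arises from that for
  \<open>y\<close> by applying C_s - v. Triangularity with respect to length is all that the
  uniqueness argument asks for.\<close>

lemma bar_basis_triangular:
  assumes "x \<in> Sym n"
  shows "bar_basis n x x = 1" "bar_basis n x w \<noteq> 0 \<Longrightarrow> w = x \<or> len n w < len n x"
proof -
  have "bar_basis n x x = 1 \<and> (\<forall>w. bar_basis n x w \<noteq> 0 \<longrightarrow> w = x \<or> len n w < len n x)"
    using assms
  proof (induction "len n x" arbitrary: x rule: less_induct)
    case less
    show ?case
    proof (cases "x = id")
      case True
      then show ?thesis by (auto simp: bar_basis_def normalise_def bar_T_id T_elt_def)
    next
      case False
      then obtain s where s: "s \<in> simples n" "len n (s \<circ> x) < len n x"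
        using ex_left_descent less.prems by blast
      define \<sigma> where "\<sigma> = (\<lambda>w. s \<circ> w :: perm)"
      have ba: "bar_action n \<sigma>" and sa: "simple_action n \<sigma>"
        unfolding \<sigma>_def using s bar_action_left simple_action_left by blast+
      define y where "y = \<sigma> x"
      note sx = simple_actionD[OF sa less.prems]
      have y: "y \<in> Sym n" "\<sigma> y = x" "len n x = Suc (len n y)"
        using sx s(2) unfolding y_def \<sigma>_def by auto
      note IH = less.hyps[of y, OF _ y(1)]
      have eq: "bar_basis n x w = C_op n \<sigma> (bar_basis n y) w - v_pow 1 * bar_basis n y w" for w
        using C_op_bar_basis_up(2)[OF ba y(1)] y by simp
      have 0: "bar_basis n y w = 0" if "len n y < len n w" for w using IH y(3) that by fastforce
      have c: "C_op n \<sigma> (bar_basis n y) w = bar_basis n y (\<sigma> w)" if "len n y < len n w" "w \<in> Sym n" for w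
        using that 0[OF that(1)] by (simp add: C_op_def)
      show ?thesis
      proof (intro conjI allI impI)
        show "bar_basis n x x = 1"
          using eq[of x] c[of x] 0[of x] y less.prems IH by (simp add: y_def[symmetric])
        fix w assume nz: "bar_basis n x w \<noteq> 0"
        then have w: "w \<in> Sym n" using bar_basis_carrier[OF less.prems] by (auto simp: hecke_carrier_def)
        show "w = x \<or> len n w < len n x"
        proof (rule ccontr)
          assume *: "\<not> ?thesis"
          then have l: "len n y < len n w" using y(3) by simp
          then have "bar_basis n y (\<sigma> w) \<noteq> 0" using nz eq[of w] c[OF l w] 0[OF l] by simp
          then have "\<sigma> w = y \<or> len n (\<sigma> w) < len n y" using IH y(3) by auto
          then have "\<sigma> w = y" using simple_actionD(3)[OF sa w] * y(3) by auto
          then have "w = x" using simple_actionD(2)[OF sa w] y(2) by simp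
          then show False using * by simp
        qed
      qed
    qed
  qed
  then show "bar_basis n x x = 1" "bar_basis n x w \<noteq> 0 \<Longrightarrow> w = x \<or> len n w < len n x" by auto
qed

lemma norm_bar_T_id: "norm_bar n (T_elt id) = T_elt id"
proof
  fix w
  have "norm_bar n (T_elt id) w = (\<Sum>x\<in>Sym n. if id = x then bar_basis n x w else 0)"
    unfolding norm_bar_def by (intro sum.cong) (auto simp: T_elt_def)
  also have "\<dots> = bar_basis n id w" using finite_Sym[of n] Sym_id by simp
  finally show "norm_bar n (T_elt id) w = T_elt id w"
    by (auto simp: bar_basis_def normalise_def bar_T_id T_elt_def)
qed

section \<open>The Kazhdan--Lusztig basis\<close>

text \<open>At a support element of maximal length, triangularity reduces bar invariance to f = bar
  f for its coefficient f. A coefficient with only negative powers of v cannot satisfy this unless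
  it is zero.\<close>

lemma norm_bar_fixed_zero:
  assumes p: "p \<in> hecke_carrier n" and bar: "norm_bar n p = p"
    and neg: "\<And>w k. w \<in> Sym n \<Longrightarrow> coef (p w) k \<noteq> 0 \<Longrightarrow> k < 0"
  shows "p w = 0"
proof (rule ccontr)
  assume nz: "p w \<noteq> 0"
  let ?A = "{x \<in> Sym n. p x \<noteq> 0}"
  have fin: "finite ?A" using finite_Sym by simp
  have "w \<in> ?A" using nz p by (auto simp: hecke_carrier_def)
  then have "len n ` ?A \<noteq> {}" by blast
  then have "Max (len n ` ?A) \<in> len n ` ?A" using fin by (intro Max_in) auto
  then obtain z where z: "z \<in> ?A" "len n z = Max (len n ` ?A)" by auto
  have mx: "len n x \<le> len n z" if "x \<in> ?A" for x
    unfolding z(2) using fin that by (intro Max_ge) auto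
  have "p z = (\<Sum>x\<in>Sym n. laurent_bar (p x) * bar_basis n x z)"
    using fun_cong[OF bar, of z] by (simp add: norm_bar_def)
  also have "\<dots> = (\<Sum>x\<in>Sym n. if z = x then laurent_bar (p x) else 0)"
  proof (rule sum.cong[OF refl])
    fix x assume x: "x \<in> Sym n"
    show "laurent_bar (p x) * bar_basis n x z = (if z = x then laurent_bar (p x) else 0)"
      using bar_basis_triangular(1)[OF x] bar_basis_triangular(2)[OF x, of z] mx[of x] x by (cases "p x = 0") force+
  qed
  also have "\<dots> = laurent_bar (p z)" using z finite_Sym[of n] by simp
  finally have e: "p z = laurent_bar (p z)" .
  have "coef (p z) k = 0" for k
  proof (rule ccontr)
    assume k: "coef (p z) k \<noteq> 0"
    then have "coef (p z) (- k) \<noteq> 0" using e coef_laurent_bar by metis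
    then show False using neg[of z k] neg[of z "- k"] k z by auto
  qed
  then have "p z = 0" by (intro poly_mapping_eqI) simp
  then show False using z by simp
qed

text \<open>In normalised coordinates P_(y,w) appears as v^(l(y) - l(w)) P_(y,w)(v^2), so the degree
  bound says that only negative powers of v occur for y < w. Negative powers at \<open>w\<close>
  itself are not excluded here; \<open>kl_self\<close> excludes them by means of
  \<open>kl_shape\<close>.\<close>

definition kl_good :: "nat \<Rightarrow> perm \<Rightarrow> hecke \<Rightarrow> bool" where
  "kl_good n w p \<longleftrightarrow> p \<in> hecke_carrier n \<and> norm_bar n p = p \<and>
     (\<forall>y \<in> Sym n. \<forall>k \<ge> 0. coef (p y) k = (if y = w \<and> k = 0 then 1 else 0))"

lemma kl_good_unique:
  assumes "kl_good n w p" "kl_good n w p'"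
  shows "p = p'"
proof -
  have "p x - p' x = 0" for x
  proof (rule norm_bar_fixed_zero[of "\<lambda>x. p x - p' x" n])
    show "(\<lambda>x. p x - p' x) \<in> hecke_carrier n" using assms by (simp add: kl_good_def hecke_carrier_def)
    show "norm_bar n (\<lambda>x. p x - p' x) = (\<lambda>x. p x - p' x)"
      using assms by (simp add: norm_bar_diff kl_good_def)
    fix y k assume "y \<in> Sym n" "coef (p y - p' y) k \<noteq> 0"
    moreover have "coef (p y - p' y) k = 0" if "0 \<le> k"
      using assms that \<open>y \<in> Sym n\<close> by (simp add: kl_good_def lookup_minus)
    ultimately show "k < 0" by linarith
  qed
  then show ?thesis by auto
qed

text \<open>The lower bound and the parity say that each coordinate, multiplied by v^(l(w) - l(y)),
  is a genuine polynomial in q = v^2.\<close>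

definition kl_shape :: "nat \<Rightarrow> perm \<Rightarrow> hecke \<Rightarrow> bool" where
  "kl_shape n w p \<longleftrightarrow> (\<forall>y. p y \<noteq> 0 \<longrightarrow> bruhat_le n y w) \<and>
     (\<forall>y k. coef (p y) k \<noteq> 0 \<longrightarrow> int (len n y) - int (len n w) \<le> k \<and> even (k - (int (len n y) - int (len n w))))"

text \<open>C_s C_u is bar invariant. Its coordinates have no positive powers of v, and their
  constant terms are 1 at \<open>\<sigma> u\<close> and the coefficient of v^-1 in
  \<open>K u z\<close> at each \<open>z\<close> in \<open>A\<close>. Subtracting these integer
  multiples of the \<open>K z\<close> removes the unwanted constants. The family \<open>K\<close> is
  left open so that the lemma serves the existence proof, where \<open>kl\<close> is not yet
  available, as well as the multiplication formulas on both sides.\<close>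

lemma kl_step:
  assumes ba: "bar_action n \<sigma>" and u: "u \<in> Sym n" "len n u < len n (\<sigma> u)"
    and good: "\<And>z. z \<in> Sym n \<Longrightarrow> len n z \<le> len n u \<Longrightarrow> kl_good n z (K z)"
    and supp: "\<And>y. K u y \<noteq> 0 \<Longrightarrow> y = u \<or> len n y < len n u"
  defines "A \<equiv> {z \<in> Sym n. len n z < len n u \<and> len n (\<sigma> z) < len n z}"
  shows "kl_good n (\<sigma> u) (\<lambda>y. C_op n \<sigma> (K u) y - (\<Sum>z\<in>A. of_int (coef (K u z) (- 1)) * K z y))"
    (is "kl_good n _ ?X")
proof -
  have sa: "simple_action n \<sigma>" using ba by (simp add: bar_action_def)
  have gA: "kl_good n z (K z)" if "z \<in> A" for z using good that by (auto simp: A_def)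
  have gu: "kl_good n u (K u)" using good u by simp
  have fA: "finite A" using finite_Sym by (auto simp: A_def)
  have "?X \<in> hecke_carrier n"
    using C_op_carrier[of n \<sigma> "K u"] gA by (auto simp: hecke_carrier_def kl_good_def intro!: sum.neutral)
  moreover have "norm_bar n ?X = ?X"
  proof -
    have "norm_bar n (K u) = K u" "\<And>z. z \<in> A \<Longrightarrow> norm_bar n (K z) = K z"
      using gA gu by (auto simp: kl_good_def)
    then show ?thesis by (simp add: norm_bar_diff norm_bar_C_op[OF ba] norm_bar_sum norm_bar_scale)
  qed
  moreover have "coef (?X y) k = (if y = \<sigma> u \<and> k = 0 then 1 else 0)" if y: "y \<in> Sym n" and k: "0 \<le> k" for y k
  proof -
    note sy = simple_actionD[OF sa y] and su = simple_actionD[OF sa u(1)]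
    have sum: "coef (\<Sum>z\<in>A. of_int (coef (K u z) (- 1)) * K z y) k = (if y \<in> A \<and> k = 0 then coef (K u y) (- 1) else 0)"
    proof -
      have "coef (\<Sum>z\<in>A. of_int (coef (K u z) (- 1)) * K z y) k = (\<Sum>z\<in>A. if y = z then (if k = 0 then coef (K u z) (- 1) else 0) else 0)"
        unfolding lookup_sum coef_of_int_mult
        using gA y k by (intro sum.cong) (auto simp: kl_good_def)
      then show ?thesis using fA by simp
    qed
    have c: "coef (K u z) j = (if z = u \<and> j = 0 then 1 else 0)" if "z \<in> Sym n" "0 \<le> j" for z j
      using gu that by (simp add: kl_good_def)
    have "coef (C_op n \<sigma> (K u) y) k = coef (K u (\<sigma> y)) k + coef (K u y) (k - (if len n (\<sigma> y) < len n y then 1 else - 1))"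
      using y by (simp add: C_op_def lookup_add coef_v_pow_mult)
    moreover have "coef (K u (\<sigma> y)) k = (if y = \<sigma> u \<and> k = 0 then 1 else 0)"
      using c[OF sy(1) k] sy(2) su(2) by auto
    \<comment> \<open>Only at a descent of \<open>\<sigma>\<close> is the coordinate multiplied by
      v, which lifts the coefficient of v^-1 into degree 0; \<open>u\<close> itself is not a
      descent.\<close>
    moreover have "coef (K u y) (k - (if len n (\<sigma> y) < len n y then 1 else - 1)) = (if y \<in> A \<and> k = 0 then coef (K u y) (- 1) else 0)"
    proof (cases "len n (\<sigma> y) < len n y")
      case False
      then show ?thesis using c[OF y, of "k + 1"] k by (auto simp: A_def)
    next
      case True
      then have yu: "y \<noteq> u" using u(2) by auto
      show ?thesis
      proof (cases "k = 0")
        case False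
        then show ?thesis using c[OF y, of "k - 1"] k True yu by auto
      next
        case k0: True
        show ?thesis
        proof (cases "y \<in> A")
          case False
          then have "K u y = 0" using supp[of y] y True yu by (auto simp: A_def)
          then show ?thesis using False by simp
        qed (use k0 True in simp)
      qed
    qed
    ultimately show ?thesis using sum by (simp add: lookup_minus)
  qed
  ultimately show ?thesis by (simp add: kl_good_def)
qed

lemma kl_good_exists:
  "w \<in> Sym n \<Longrightarrow> \<exists>p. kl_good n w p \<and> kl_shape n w p"
proof (induction "len n w" arbitrary: w rule: less_induct)
  case less
  show ?case
  proof (cases "w = id")
    case True
    have "kl_good n w (T_elt id)"
      using True T_elt_carrier[OF Sym_id, of n] norm_bar_T_id[of n]
      by (simp add: kl_good_def) (simp add: T_elt_def coef_laurent_one)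
    moreover have "kl_shape n w (T_elt id)"
      using True by (auto simp: kl_shape_def T_elt_def coef_laurent_one bruhat_le_refl Sym_id split: if_splits)
    ultimately show ?thesis by blast
  next
    case False
    then obtain s where s: "s \<in> simples n" "len n (s \<circ> w) < len n w"
      using ex_left_descent less.prems by blast
    define \<sigma> where "\<sigma> = (\<lambda>w. s \<circ> w :: perm)"
    have ba: "bar_action n \<sigma>" and sa: "simple_action n \<sigma>"
      unfolding \<sigma>_def using s bar_action_left simple_action_left by blast+
    note sw = simple_actionD[OF sa less.prems]
    define u where "u = \<sigma> w"
    have u: "u \<in> Sym n" "\<sigma> u = w" "len n w = Suc (len n u)" "len n u < len n (\<sigma> u)"
      using sw s(2) by (auto simp: u_def \<sigma>_def)
    have up: "\<sigma> u = s \<circ> u" by (simp add: \<sigma>_def)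
    define K where "K = (\<lambda>z. SOME p. kl_good n z p \<and> kl_shape n z p)"
    have K: "kl_good n z (K z) \<and> kl_shape n z (K z)" if "z \<in> Sym n" "len n z \<le> len n u" for z
    proof -
      have "len n z < len n w" using that(2) u(3) by simp
      from someI_ex[OF less.hyps[OF this that(1)]] show ?thesis unfolding K_def .
    qed
    have supp: "y = u \<or> len n y < len n u" if "K u y \<noteq> 0" for y
      using K[OF u(1)] that bruhat_le_len by (auto simp: kl_shape_def)
    define A where "A = {z \<in> Sym n. len n z < len n u \<and> len n (\<sigma> z) < len n z}"
    let ?c = "\<lambda>z. coef (K u z) (- 1)"
    let ?X = "\<lambda>y. C_op n \<sigma> (K u) y - (\<Sum>z\<in>A. of_int (?c z) * K z y)"
    have good: "kl_good n w ?X"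
      using kl_step[OF ba u(1) u(4), of K] K supp unfolding A_def u(2) by blast
    have Ku: "bruhat_le n y u" if "K u y \<noteq> 0" for y using K[OF u(1)] that by (auto simp: kl_shape_def)
    have deg: "int (len n y) - int (len n z) \<le> k \<and> even (k - (int (len n y) - int (len n z)))"
      if "coef (K z y) k \<noteq> 0" "z \<in> Sym n" "len n z \<le> len n u" for y z k
      using K[OF that(2,3)] that(1) unfolding kl_shape_def by blast
    have "kl_shape n w ?X"
      unfolding kl_shape_def
    proof (intro conjI allI impI)
      fix y assume X: "?X y \<noteq> 0"
      then have y: "y \<in> Sym n" using good by (auto simp: kl_good_def hecke_carrier_def)
      have mono: "bruhat_le n x w" "bruhat_le n (s \<circ> x) w" if "bruhat_le n x u" for x
        using bruhat_le_simple_mono[OF that s(1)] u(2,4) unfolding up by auto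
      from X consider "K u (\<sigma> y) \<noteq> 0" | "K u y \<noteq> 0" | "(\<Sum>z\<in>A. of_int (?c z) * K z y) \<noteq> 0"
        using y by (cases "K u (\<sigma> y) = 0"; cases "K u y = 0") (auto simp: C_op_def)
      then show "bruhat_le n y w"
      proof cases
        case 1
        then have "bruhat_le n (s \<circ> (s \<circ> y)) w" using mono(2) Ku by (simp add: \<sigma>_def)
        then show ?thesis by (simp only: simples_cancel(1)[OF s(1)])
      next
        case 2
        then show ?thesis using mono(1) Ku by blast
      next
        case 3
        then obtain z where z: "z \<in> A" "?c z \<noteq> 0" "K z y \<noteq> 0"
          using sum.neutral[of A "\<lambda>z. of_int (?c z) * K z y"] by fastforce
        then have "bruhat_le n z u" using Ku[of z] by fastforce
        moreover have "bruhat_le n y z" using K[of z] z unfolding kl_shape_def A_def by auto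
        ultimately show ?thesis using mono(1) bruhat_le_trans by blast
      qed
    next
      fix y k assume X: "coef (?X y) k \<noteq> 0"
      then have "?X y \<noteq> 0" by (metis lookup_zero)
      then have y: "y \<in> Sym n" using good by (auto simp: kl_good_def hecke_carrier_def)
      note sy = simple_actionD[OF sa y]
      have "coef (?X y) k = coef (K u (\<sigma> y)) k + coef (K u y) (k - (if len n (\<sigma> y) < len n y then 1 else - 1))
          - (\<Sum>z\<in>A. ?c z * coef (K z y) k)"
        using y by (simp add: C_op_def lookup_add lookup_minus lookup_sum coef_v_pow_mult coef_of_int_mult)
      then consider "coef (K u (\<sigma> y)) k \<noteq> 0" | "coef (K u y) (k - (if len n (\<sigma> y) < len n y then 1 else - 1)) \<noteq> 0"
        | "(\<Sum>z\<in>A. ?c z * coef (K z y) k) \<noteq> 0"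
        using X by linarith
      then have "int (len n y) - int (len n w) \<le> k \<and> even (k - (int (len n y) - int (len n w)))"
      proof cases
        case 1
        from deg[OF this u(1) order_refl] sy(3) u(3) show ?thesis by auto
      next
        case 2
        from deg[OF this u(1) order_refl] u(3) show ?thesis by (auto split: if_splits)
      next
        \<comment> \<open>A nonzero coefficient of v^-1 forces l(u) - l(z) to be odd, so the parity
          for \<open>z\<close> agrees with the one for \<open>w\<close>, whose length is l(u) +
          1.\<close>
        case 3
        then obtain z where z: "z \<in> A" "?c z \<noteq> 0" "coef (K z y) k \<noteq> 0"
          using sum.neutral[of A "\<lambda>z. ?c z * coef (K z y) k"] by fastforce
        then have zA: "z \<in> Sym n" "len n z < len n u" by (auto simp: A_def)
        from deg[OF z(2) u(1) order_refl] deg[OF z(3) zA(1)] zA u(3) show ?thesis by auto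
      qed
      then show "int (len n y) - int (len n w) \<le> k" "even (k - (int (len n y) - int (len n w)))" by auto
    qed
    with good show ?thesis by blast
  qed
qed

definition kl :: "nat \<Rightarrow> perm \<Rightarrow> hecke" where
  "kl n w = (THE p. kl_good n w p)"

text \<open>The power q^((l(w) - l(y) - 1)/2) becomes v^-1 after multiplication by v^(l(y) - l(w)),
  so this is mu when y < w.\<close>

definition mu_lower :: "nat \<Rightarrow> perm \<Rightarrow> perm \<Rightarrow> int" where
  "mu_lower n y w = coef (kl n w y) (- 1)"

lemma kl_good_kl: "w \<in> Sym n \<Longrightarrow> kl_good n w (kl n w)"
  unfolding kl_def using kl_good_exists kl_good_unique by (metis (no_types, lifting) theI')

lemma kl_eqI: "kl_good n w p \<Longrightarrow> w \<in> Sym n \<Longrightarrow> kl n w = p"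
  using kl_good_kl kl_good_unique by blast

lemma kl_shape_kl: "w \<in> Sym n \<Longrightarrow> kl_shape n w (kl n w)"
  using kl_good_exists kl_eqI by metis

lemma kl_support: "w \<in> Sym n \<Longrightarrow> kl n w y \<noteq> 0 \<Longrightarrow> bruhat_le n y w"
  using kl_shape_kl by (auto simp: kl_shape_def)

lemma kl_support_len: "w \<in> Sym n \<Longrightarrow> kl n w y \<noteq> 0 \<Longrightarrow> y = w \<or> len n y < len n w"
  using kl_support bruhat_le_len by blast

lemma coef_kl_nonneg:
  "w \<in> Sym n \<Longrightarrow> y \<in> Sym n \<Longrightarrow> 0 \<le> k \<Longrightarrow> coef (kl n w y) k = (if y = w \<and> k = 0 then 1 else 0)"
  using kl_good_kl by (auto simp: kl_good_def)

lemma kl_outside: "w \<in> Sym n \<Longrightarrow> y \<notin> Sym n \<Longrightarrow> kl n w y = 0"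
  using kl_good_kl by (auto simp: kl_good_def hecke_carrier_def)

lemma kl_self: 
  assumes "w \<in> Sym n"
  shows "kl n w w = 1"
proof (rule poly_mapping_eqI)
  fix k
  show "coef (kl n w w) k = coef 1 k"
  proof (cases "0 \<le> k")
    case True then show ?thesis using coef_kl_nonneg[OF assms assms] by (simp add: coef_laurent_one)
  next
    case False
    then have "coef (kl n w w) k = 0" using kl_shape_kl[OF assms] by (fastforce simp: kl_shape_def)
    then show ?thesis using False by (simp add: coef_laurent_one)
  qed
qed

lemma mu_lower_less:
  assumes "w \<in> Sym n" "mu_lower n y w \<noteq> 0"
  shows "bruhat_less n y w"
proof -
  have "kl n w y \<noteq> 0" using assms(2) by (auto simp: mu_lower_def)
  moreover have "y \<noteq> w" using assms by (auto simp: mu_lower_def kl_self coef_laurent_one)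
  ultimately show ?thesis using kl_support assms(1) by (auto simp: bruhat_less_def)
qed

lemma mu_lower_len: "w \<in> Sym n \<Longrightarrow> mu_lower n y w \<noteq> 0 \<Longrightarrow> len n y < len n w"
  using mu_lower_less bruhat_less_len by blast

subsection \<open>Comparison with the Kazhdan--Lusztig polynomials\<close>

lemma coef_poly_at_q: "coef (poly_at_q p) (2 * int i) = coeff p i"
proof -
  have "coef (poly_at_q p) (2 * int i) = (\<Sum>j\<le>degree p. if i = j then coeff p j else 0)"
    unfolding poly_at_q_def lookup_sum by (intro sum.cong) (auto simp: lookup_single when_def)
  then show ?thesis by (auto simp: coeff_eq_0)
qed

lemma coef_poly_at_q_nonzero:
  assumes "coef (poly_at_q p) k \<noteq> 0"
  obtains i where "k = 2 * int i" "i \<le> degree p"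
proof -
  have "coef (poly_at_q p) k = (\<Sum>j\<le>degree p. if 2 * int j = k then coeff p j else 0)"
    unfolding poly_at_q_def lookup_sum by (intro sum.cong) (auto simp: lookup_single when_def)
  then obtain i where "i \<le> degree p" "2 * int i = k"
    using assms sum.neutral[of "{..degree p}" "\<lambda>j. if 2 * int j = k then coeff p j else 0"] by fastforce
  then show ?thesis using that by auto
qed

lemma poly_at_q_0 [simp]: "poly_at_q 0 = 0"
  by (simp add: poly_at_q_def)

lemma poly_at_q_1 [simp]: "poly_at_q 1 = 1"
  by (simp add: poly_at_q_def)

lemma normalise_KL_element:
  "normalise n (KL_element n w P) y = v_pow (int (len n y) - int (len n w)) * poly_at_q (P y)"
  by (simp add: normalise_def KL_element_def v_pow_mult_assoc)

text \<open>The bound l(y) + 2 deg P + 1 <= l(w) turns into negativity of all exponents of v, so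
  uniqueness in normalised coordinates applies.\<close>

lemma is_KL_family_imp_kl:
  assumes w: "w \<in> Sym n" and P: "is_KL_family n w P"
  shows "normalise n (KL_element n w P) = kl n w"
proof (rule kl_eqI[symmetric, OF _ w])
  let ?p = "normalise n (KL_element n w P)"
  have 0: "P y = 0" if "\<not> bruhat_le n y w" for y using P that by (auto simp: is_KL_family_def)
  have "?p \<in> hecke_carrier n"
    using 0 bruhat_le_Sym(1) by (fastforce simp: hecke_carrier_def normalise_KL_element)
  moreover have "norm_bar n ?p = ?p"
    using P by (simp add: norm_bar_normalise is_KL_family_def)
  moreover have "coef (?p y) k = (if y = w \<and> k = 0 then 1 else 0)" if "0 \<le> k" for y k
  proof (cases "y = w")
    case True
    then show ?thesis using P by (simp add: normalise_KL_element is_KL_family_def coef_laurent_one)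
  next
    case False
    have "coef (?p y) k = 0"
    proof (rule ccontr)
      assume "coef (?p y) k \<noteq> 0"
      then have nz: "coef (poly_at_q (P y)) (k - (int (len n y) - int (len n w))) \<noteq> 0"
        by (simp add: normalise_KL_element coef_v_pow_mult)
      then have "P y \<noteq> 0" by auto
      then have "bruhat_less n y w" using 0 False by (auto simp: bruhat_less_def)
      then have "len n y + 2 * degree (P y) + 1 \<le> len n w" using P by (auto simp: is_KL_family_def)
      moreover obtain i where "k - (int (len n y) - int (len n w)) = 2 * int i" "i \<le> degree (P y)"
        using coef_poly_at_q_nonzero[OF nz] by blast
      ultimately show False using that by linarith
    qed
    then show ?thesis using False by simp
  qed
  ultimately show "kl_good n w ?p" by (simp add: kl_good_def)
qed

lemma is_KL_family_coeff:
  assumes "w \<in> Sym n" "is_KL_family n w P"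
  shows "coeff (P y) i = coef (kl n w y) (2 * int i + (int (len n y) - int (len n w)))"
  unfolding is_KL_family_imp_kl[OF assms, symmetric] normalise_KL_element coef_v_pow_mult
  using coef_poly_at_q[of "P y" i] by simp

lemma is_KL_family_exists:
  assumes w: "w \<in> Sym n"
  shows "\<exists>P. is_KL_family n w P"
proof -
  define c where "c = (\<lambda>y i. coef (kl n w y) (2 * int i + (int (len n y) - int (len n w))))"
  \<comment> \<open>For i > l(w) the exponent in \<open>c y i\<close> is positive, and there the
    coordinate vanishes; the sum therefore misses nothing.\<close>
  define P where "P = (\<lambda>y. \<Sum>i\<le>len n w. monom (c y i) i)"
  have big: "c y i = 0" if "len n w < i" for y i
  proof (cases "y \<in> Sym n")
    case True
    then show ?thesis using coef_kl_nonneg[OF w True] that by (simp add: c_def)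
  qed (simp add: c_def kl_outside[OF w])
  have cP: "coeff (P y) i = c y i" for y i
    using big by (auto simp: P_def coeff_sum)
  have shape: "int (len n y) - int (len n w) \<le> k \<and> even (k - (int (len n y) - int (len n w)))" 
    if "coef (kl n w y) k \<noteq> 0" for y k
    using kl_shape_kl[OF w] that unfolding kl_shape_def by blast
  have "coef (poly_at_q (P y)) k = coef (v_pow (int (len n w) - int (len n y)) * kl n w y) k" for y k
  proof (cases "even k \<and> 0 \<le> k")
    case True
    then obtain i where "k = 2 * int i" by (metis evenE zero_le_mult_iff nonneg_int_cases zero_less_numeral not_less)
    then show ?thesis by (simp only: coef_poly_at_q cP c_def coef_v_pow_mult) (simp add: algebra_simps)
  next
    case False
    then have "coef (poly_at_q (P y)) k = 0" using coef_poly_at_q_nonzero by fastforce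
    moreover have "coef (kl n w y) (k - (int (len n w) - int (len n y))) = 0"
      using shape[of y "k - (int (len n w) - int (len n y))"] False by (auto simp: algebra_simps)
    ultimately show ?thesis by (simp add: coef_v_pow_mult)
  qed
  then have "poly_at_q (P y) = v_pow (int (len n w) - int (len n y)) * kl n w y" for y
    by (intro poly_mapping_eqI)
  then have nKL: "normalise n (KL_element n w P) = kl n w"
    by (simp add: normalise_KL_element fun_eq_iff v_pow_mult_assoc)
  have "P y = 0" if "\<not> bruhat_le n y w" for y
  proof -
    have "kl n w y = 0" using kl_support[OF w, of y] that by blast
    then show ?thesis by (intro poly_eqI) (simp add: cP c_def)
  qed
  moreover have "P w = 1"
    by (intro poly_eqI) (simp add: cP c_def kl_self[OF w] coef_laurent_one coeff_1)
  moreover have "len n y + 2 * degree (P y) + 1 \<le> len n w" if l: "bruhat_less n y w" for y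
  proof (cases "P y = 0")
    case True
    then show ?thesis using bruhat_less_len[OF l] by simp
  next
    case False
    have y: "y \<in> Sym n" "y \<noteq> w" using l bruhat_le_Sym by (auto simp: bruhat_less_def)
    have "c y (degree (P y)) \<noteq> 0" using False cP by (metis leading_coeff_0_iff)
    then have "2 * int (degree (P y)) + (int (len n y) - int (len n w)) < 0"
      using coef_kl_nonneg[OF w y(1)] y(2) by (metis c_def not_less)
    then show ?thesis by linarith
  qed
  moreover have "hecke_bar n (KL_element n w P) = KL_element n w P"
  proof -
    have "norm_bar n (kl n w) = kl n w" using kl_good_kl[OF w] by (simp add: kl_good_def)
    then have "normalise n (hecke_bar n (KL_element n w P)) = normalise n (KL_element n w P)"
      using norm_bar_normalise[of n "KL_element n w P"] nKL by simp
    then show ?thesis by (simp only: normalise_inj)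
  qed
  ultimately show ?thesis unfolding is_KL_family_def by blast
qed

lemma coeff_KL_poly:
  assumes w: "w \<in> Sym n"
  shows "coeff (KL_poly n y w) i = coef (kl n w y) (2 * int i + (int (len n y) - int (len n w)))"
proof -
  have "\<exists>!P. is_KL_family n w P"
  proof (rule ex_ex1I[OF is_KL_family_exists[OF w]])
    fix P Q assume "is_KL_family n w P" "is_KL_family n w Q"
    then show "P = Q" by (intro ext poly_eqI) (simp add: is_KL_family_coeff[OF w])
  qed
  from theI'[OF this] show ?thesis unfolding KL_poly_def by (rule is_KL_family_coeff[OF w])
qed

lemma KL_mu_less_eq_mu_lower:
  assumes "bruhat_less n y w"
  shows "KL_mu_less n y w = mu_lower n y w"
proof -
  have w: "w \<in> Sym n" using assms bruhat_le_Sym by (auto simp: bruhat_less_def)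
  have l: "len n y < len n w" by (rule bruhat_less_len[OF assms])
  show ?thesis
  proof (cases "odd (len n w - len n y)")
    case True
    then obtain i where i: "len n w - len n y = 2 * i + 1" by (metis oddE)
    then have "2 * int i + (int (len n y) - int (len n w)) = - 1" using l by linarith
    then show ?thesis using True i by (simp add: KL_mu_less_def coeff_KL_poly[OF w] mu_lower_def)
  next
    case False
    \<comment> \<open>With an even length difference the exponent -1 has the wrong parity for
      \<open>kl_shape\<close>.\<close>
    have "mu_lower n y w = 0"
    proof (rule ccontr)
      assume "mu_lower n y w \<noteq> 0"
      then have "even (- 1 - (int (len n y) - int (len n w)))"
        using kl_shape_kl[OF w] unfolding kl_shape_def mu_lower_def by blast
      moreover have "- 1 - (int (len n y) - int (len n w)) = int (len n w - len n y) - 1" using l by simp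
      ultimately have "even (int (len n w - len n y) - 1)" by (simp only:)
      then show False using False by (simp only: even_diff_iff even_of_nat even_of_nat_iff) simp
    qed
    then show ?thesis using False by (simp add: KL_mu_less_def)
  qed
qed

lemma KL_mu_neq_0_iff:
  assumes "y \<in> Sym n" "w \<in> Sym n"
  shows "KL_mu n y w \<noteq> 0 \<longleftrightarrow> mu_lower n y w \<noteq> 0 \<or> mu_lower n w y \<noteq> 0"
proof -
  have "\<not> (bruhat_less n y w \<and> bruhat_less n w y)" using bruhat_less_len by (metis less_asym)
  then show ?thesis
    using mu_lower_less[OF assms(1)] mu_lower_less[OF assms(2)] KL_mu_less_eq_mu_lower
    by (auto simp: KL_mu_def)
qed

subsection \<open>Multiplication formulas\<close>

lemma C_op_kl_up:
  assumes ba: "bar_action n \<sigma>" and u: "u \<in> Sym n" "len n u < len n (\<sigma> u)"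
  shows "C_op n \<sigma> (kl n u) y = kl n (\<sigma> u) y
    + (\<Sum>z\<in>{z \<in> Sym n. len n (\<sigma> z) < len n z}. of_int (mu_lower n z u) * kl n z y)"
proof -
  have su: "\<sigma> u \<in> Sym n" using simple_actionD ba u by (auto simp: bar_action_def)
  let ?A = "{z \<in> Sym n. len n z < len n u \<and> len n (\<sigma> z) < len n z}"
  have "kl n (\<sigma> u) = (\<lambda>y. C_op n \<sigma> (kl n u) y - (\<Sum>z\<in>?A. of_int (coef (kl n u z) (- 1)) * kl n z y))"
    using kl_good_kl kl_support_len u by (intro kl_eqI[OF kl_step[OF ba u] su]) auto
  then have "C_op n \<sigma> (kl n u) y = kl n (\<sigma> u) y + (\<Sum>z\<in>?A. of_int (mu_lower n z u) * kl n z y)"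
    by (simp add: mu_lower_def)
  also have "(\<Sum>z\<in>?A. of_int (mu_lower n z u) * kl n z y)
     = (\<Sum>z\<in>{z \<in> Sym n. len n (\<sigma> z) < len n z}. of_int (mu_lower n z u) * kl n z y)"
  proof (rule sum.mono_neutral_left)
    show "\<forall>z\<in>{z \<in> Sym n. len n (\<sigma> z) < len n z} - ?A. of_int (mu_lower n z u) * kl n z y = 0"
    proof
      fix z assume "z \<in> {z \<in> Sym n. len n (\<sigma> z) < len n z} - ?A"
      then have "mu_lower n z u = 0" using mu_lower_len[OF u(1), of z] by blast
      then show "of_int (mu_lower n z u) * kl n z y = 0" by simp
    qed
  qed (use finite_Sym in auto)
  finally show ?thesis .
qed

text \<open>C_w is C_s C_u, with u = s w, minus multiples of shorter C_z that have the same descent.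
  On the first term C_s acts by v + v^-1 because of \<open>C_op_square\<close>, on the others by
  induction.\<close>

lemma C_op_kl_down:
  assumes ba: "bar_action n \<sigma>" and w: "w \<in> Sym n" "len n (\<sigma> w) < len n w"
  shows "C_op n \<sigma> (kl n w) y = (v_pow 1 + v_pow (- 1)) * kl n w y"
  using w
proof (induction "len n w" arbitrary: w y rule: less_induct)
  case less
  have sa: "simple_action n \<sigma>" using ba by (simp add: bar_action_def)
  note sw = simple_actionD[OF sa less.prems(1)]
  let ?A = "{z \<in> Sym n. len n (\<sigma> z) < len n z}" and ?u = "\<sigma> w" and ?v = "v_pow 1 + v_pow (- 1)"
  have kw: "kl n w = (\<lambda>y. C_op n \<sigma> (kl n ?u) y - (\<Sum>z\<in>?A. of_int (mu_lower n z ?u) * kl n z y))"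
    using C_op_kl_up[OF ba sw(1)] sw(2) less.prems(2) by (simp add: fun_eq_iff)
  have IH: "of_int (mu_lower n z ?u) * C_op n \<sigma> (kl n z) y = ?v * (of_int (mu_lower n z ?u) * kl n z y)"
    if "z \<in> ?A" for z y
  proof (cases "mu_lower n z ?u = 0")
    case False
    then have "len n z < len n w" using mu_lower_len[OF sw(1)] less.prems(2) less_trans by blast
    from less.hyps[OF this] that show ?thesis by (simp add: mult.left_commute)
  qed simp
  have "C_op n \<sigma> (kl n w) y = ?v * C_op n \<sigma> (kl n ?u) y - (\<Sum>z\<in>?A. of_int (mu_lower n z ?u) * C_op n \<sigma> (kl n z) y)"
    by (subst kw) (simp only: C_op_diff C_op_sum C_op_scale C_op_square[OF sa])
  also have "\<dots> = ?v * C_op n \<sigma> (kl n ?u) y - ?v * (\<Sum>z\<in>?A. of_int (mu_lower n z ?u) * kl n z y)"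
    unfolding sum_distrib_left using IH by (intro arg_cong2[of _ _ _ _ "(-)"] refl sum.cong)
  also have "\<dots> = ?v * kl n w y"
    using fun_cong[OF kw, of y] by (simp only: right_diff_distrib)
  finally show ?case .
qed

lemma kl_descent:
  assumes ba: "bar_action n \<sigma>" and w: "w \<in> Sym n" "len n (\<sigma> w) < len n w"
    and y: "y \<in> Sym n" "len n y < len n (\<sigma> y)"
  shows "kl n w y = v_pow (- 1) * kl n w (\<sigma> y)"
proof -
  have "kl n w (\<sigma> y) + v_pow (- 1) * kl n w y = (v_pow 1 + v_pow (- 1)) * kl n w y"
    using C_op_kl_down[OF ba w, of y] y by (simp add: C_op_def)
  then have "kl n w (\<sigma> y) = v_pow 1 * kl n w y" by (simp add: distrib_right)
  then show ?thesis by (simp add: v_pow_mult_assoc)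
qed

text \<open>By \<open>kl_descent\<close> the coefficient of v^-1 at \<open>y\<close> is the constant
  coefficient at \<open>\<sigma> y\<close>, which is nonzero only at the diagonal. Across a descent
  mu is thus trivial; most later arguments rest on this.\<close>

lemma mu_lower_descent:
  assumes ba: "bar_action n \<sigma>" and w: "w \<in> Sym n" "len n (\<sigma> w) < len n w"
    and y: "y \<in> Sym n" "len n y < len n (\<sigma> y)"
  shows "mu_lower n y w = (if w = \<sigma> y then 1 else 0)"
proof -
  have "\<sigma> y \<in> Sym n" using ba y simple_actionD by (auto simp: bar_action_def)
  then show ?thesis
    using coef_kl_nonneg[OF w(1), of "\<sigma> y" 0]
    by (auto simp: mu_lower_def kl_descent[OF assms] coef_v_pow_mult)
qed

text \<open>The matrix of multiplication by C_s in the Kazhdan-Lusztig basis, with column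
  \<open>z\<close> for the expansion of the product with C_z.\<close>

definition kl_matrix :: "nat \<Rightarrow> (perm \<Rightarrow> perm) \<Rightarrow> perm \<Rightarrow> perm \<Rightarrow> laurent" where
  "kl_matrix n \<sigma> x z = (if len n (\<sigma> z) < len n z then (if x = z then v_pow 1 + v_pow (- 1) else 0)
     else if x = \<sigma> z then 1 else if len n (\<sigma> x) < len n x then of_int (mu_lower n x z) else 0)"

lemma C_op_kl:
  assumes ba: "bar_action n \<sigma>" and z: "z \<in> Sym n"
  shows "C_op n \<sigma> (kl n z) y = (\<Sum>x\<in>Sym n. kl_matrix n \<sigma> x z * kl n x y)"
proof (cases "len n (\<sigma> z) < len n z")
  case True
  have "(\<Sum>x\<in>Sym n. kl_matrix n \<sigma> x z * kl n x y) = (\<Sum>x\<in>Sym n. if x = z then (v_pow 1 + v_pow (- 1)) * kl n x y else 0)"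
    using True by (intro sum.cong) (auto simp: kl_matrix_def)
  then show ?thesis using C_op_kl_down[OF ba z True] z finite_Sym[of n] by simp
next
  case False
  have sa: "simple_action n \<sigma>" using ba by (simp add: bar_action_def)
  note sz = simple_actionD[OF sa z]
  have l: "len n z < len n (\<sigma> z)" using False sz(3) by auto
  let ?m = "\<lambda>x. of_int (mu_lower n x z) * kl n x y"
  have "kl_matrix n \<sigma> x z * kl n x y = (if x = \<sigma> z then kl n x y else 0) + (if len n (\<sigma> x) < len n x then ?m x else 0)" for x
  proof -
    have "mu_lower n (\<sigma> z) z = 0" using l mu_lower_len[OF z, of "\<sigma> z"] by auto
    then show ?thesis using False by (auto simp: kl_matrix_def)
  qed
  then have "(\<Sum>x\<in>Sym n. kl_matrix n \<sigma> x z * kl n x y) = kl n (\<sigma> z) y + (\<Sum>x\<in>Sym n. if len n (\<sigma> x) < len n x then ?m x else 0)"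
    using sz(1) finite_Sym[of n] by (simp add: sum.distrib)
  also have "\<dots> = C_op n \<sigma> (kl n z) y"
    unfolding C_op_kl_up[OF ba z l] using finite_Sym[of n] by (simp add: sum.inter_filter)
  finally show ?thesis by simp
qed

lemma kl_independent:
  assumes eq: "\<And>y. (\<Sum>x\<in>Sym n. a x * kl n x y) = (\<Sum>x\<in>Sym n. b x * kl n x y)" and w: "w \<in> Sym n"
  shows "a w = b w"
proof (rule ccontr)
  assume nz: "a w \<noteq> b w"
  let ?A = "{x \<in> Sym n. a x \<noteq> b x}"
  have fin: "finite ?A" using finite_Sym by simp
  have "len n ` ?A \<noteq> {}" using nz w by blast
  then have "Max (len n ` ?A) \<in> len n ` ?A" using fin by (intro Max_in) auto
  then obtain z where z: "z \<in> ?A" "len n z = Max (len n ` ?A)" by auto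
  have mx: "len n x \<le> len n z" if "x \<in> ?A" for x
    unfolding z(2) using fin that by (intro Max_ge) auto
  have "0 = (\<Sum>x\<in>Sym n. (a x - b x) * kl n x z)"
    using eq[of z] by (simp add: left_diff_distrib sum_subtractf)
  also have "\<dots> = (\<Sum>x\<in>Sym n. if z = x then a x - b x else 0)"
  proof (rule sum.cong[OF refl])
    fix x assume x: "x \<in> Sym n"
    show "(a x - b x) * kl n x z = (if z = x then a x - b x else 0)"
      using kl_support_len[OF x, of z] kl_self[OF x] mx[of x] x by (cases "a x = b x") force+
  qed
  also have "\<dots> = a z - b z" using z finite_Sym[of n] by simp
  finally show False using z by simp
qed

text \<open>Left and right multiplication commute; since the basis is independent, so do their
  matrices.\<close>

lemma kl_matrix_commute:
  assumes s: "s \<in> simples n" and t: "t \<in> simples n" and x: "x \<in> Sym n" and y: "y \<in> Sym n"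
  shows "(\<Sum>z\<in>Sym n. kl_matrix n (\<lambda>w. s \<circ> w) x z * kl_matrix n (\<lambda>w. w \<circ> t) z y)
    = (\<Sum>z\<in>Sym n. kl_matrix n (\<lambda>w. w \<circ> t) x z * kl_matrix n (\<lambda>w. s \<circ> w) z y)"
proof -
  have *: "C_op n \<sigma> (C_op n \<tau> (kl n y)) w
      = (\<Sum>x\<in>Sym n. (\<Sum>z\<in>Sym n. kl_matrix n \<sigma> x z * kl_matrix n \<tau> z y) * kl n x w)"
    if "bar_action n \<sigma>" "bar_action n \<tau>" for \<sigma> \<tau> w
  proof -
    have "C_op n \<tau> (kl n y) = (\<lambda>w. \<Sum>z\<in>Sym n. kl_matrix n \<tau> z y * kl n z w)"
      using C_op_kl[OF that(2) y] by blast
    then have "C_op n \<sigma> (C_op n \<tau> (kl n y)) w = (\<Sum>z\<in>Sym n. kl_matrix n \<tau> z y * C_op n \<sigma> (kl n z) w)"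
      by (simp only: C_op_sum C_op_scale)
    also have "\<dots> = (\<Sum>z\<in>Sym n. \<Sum>x\<in>Sym n. kl_matrix n \<sigma> x z * kl_matrix n \<tau> z y * kl n x w)"
      by (intro sum.cong refl) (simp add: C_op_kl[OF that(1)] sum_distrib_left mult_ac)
    also have "\<dots> = (\<Sum>x\<in>Sym n. \<Sum>z\<in>Sym n. kl_matrix n \<sigma> x z * kl_matrix n \<tau> z y * kl n x w)"
      by (rule sum.swap)
    finally show ?thesis by (simp only: sum_distrib_right)
  qed
  note ba = bar_action_left[OF s] bar_action_right[OF t]
  show ?thesis
    by (rule kl_independent[OF _ x])
      (simp only: *[OF ba, symmetric] *[OF ba(2,1), symmetric] C_op_commute[OF s t])
qed

section \<open>Left cells and right star operations\<close>

lemma left_descents_iff: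
  assumes w: "w \<in> Sym n"
  shows "s \<in> left_descents n w \<longleftrightarrow> s \<in> simples n \<and> len n (s \<circ> w) < len n w"
proof (cases "s \<in> simples n")
  case s: True
  have sw: "s \<circ> w \<in> Sym n" using Sym_comp simples_Sym s w by blast
  have "bruhat_less n (s \<circ> w) w \<longleftrightarrow> len n (s \<circ> w) < len n w"
  proof
    assume l: "len n (s \<circ> w) < len n w"
    have "bruhat_le n (s \<circ> w) (s \<circ> (s \<circ> w))"
      by (rule bruhat_le_left_simple[OF sw s]) (simp only: simples_cancel(1)[OF s] l)
    then show "bruhat_less n (s \<circ> w) w" using l by (auto simp only: simples_cancel(1)[OF s] bruhat_less_def)
  qed (rule bruhat_less_len)
  then show ?thesis using s by (simp add: left_descents_def)
qed (simp add: left_descents_def)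

text \<open>An arrow means that C_x occurs in C_r C_y for a non-descent \<open>r\<close> of
  \<open>y\<close>. The only difficulty is that mu is symmetric: if it comes from y < x, then
  \<open>r\<close> is a descent of \<open>x\<close> but not of \<open>y\<close>, and
  \<open>mu_lower_descent\<close> forces x = r y, which also occurs.\<close>

lemma KL_arrow_iff:
  assumes x: "x \<in> Sym n" and y: "y \<in> Sym n"
  shows "KL_arrow n x y \<longleftrightarrow>
    (\<exists>r \<in> simples n. \<not> len n (r \<circ> y) < len n y \<and> kl_matrix n (\<lambda>w. r \<circ> w) x y \<noteq> 0)"
proof
  assume "KL_arrow n x y"
  then obtain r where r: "r \<in> simples n" "len n (r \<circ> x) < len n x" "\<not> len n (r \<circ> y) < len n y"
    and mu: "KL_mu n x y \<noteq> 0"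
    using left_descents_iff[OF x] left_descents_iff[OF y] by (auto simp: KL_arrow_def)
  have l: "len n y < len n (r \<circ> y)" using len_left_cases[OF y r(1)] r(3) by linarith
  have "kl_matrix n (\<lambda>w. r \<circ> w) x y \<noteq> 0"
  proof (cases "mu_lower n x y = 0")
    case False
    then show ?thesis using r by (simp add: kl_matrix_def)
  next
    case True
    then have "mu_lower n y x \<noteq> 0" using mu KL_mu_neq_0_iff[OF x y] by simp
    then have "x = r \<circ> y"
      using mu_lower_descent[OF bar_action_left[OF r(1)] x r(2) y l] by (auto split: if_splits)
    then show ?thesis using r(3) by (simp add: kl_matrix_def)
  qed
  then show "\<exists>r \<in> simples n. \<not> len n (r \<circ> y) < len n y \<and> kl_matrix n (\<lambda>w. r \<circ> w) x y \<noteq> 0"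
    using r by blast
next
  assume "\<exists>r \<in> simples n. \<not> len n (r \<circ> y) < len n y \<and> kl_matrix n (\<lambda>w. r \<circ> w) x y \<noteq> 0"
  then obtain r where r: "r \<in> simples n" "\<not> len n (r \<circ> y) < len n y"
    and nz: "kl_matrix n (\<lambda>w. r \<circ> w) x y \<noteq> 0" by blast
  have l: "len n y < len n (r \<circ> y)" using len_left_cases[OF y r(1)] r(2) by linarith
  have ry: "r \<circ> y \<in> Sym n" using Sym_comp simples_Sym r(1) y by blast
  have down: "len n (r \<circ> (r \<circ> y)) < len n (r \<circ> y)" by (simp only: simples_cancel(1)[OF r(1)] l)
  have "len n (r \<circ> x) < len n x \<and> (mu_lower n x y \<noteq> 0 \<or> mu_lower n y x \<noteq> 0)"
  proof (cases "x = r \<circ> y")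
    case True
    have "mu_lower n y (r \<circ> y) \<noteq> 0"
      unfolding mu_lower_descent[OF bar_action_left[OF r(1)] ry down y l] by simp
    then show ?thesis using down unfolding True by blast
  next
    case False
    then show ?thesis using nz r(2) by (auto simp: kl_matrix_def split: if_splits)
  qed
  then show "KL_arrow n x y"
    using x y r left_descents_iff[OF x] left_descents_iff[OF y] KL_mu_neq_0_iff[OF x y]
    unfolding KL_arrow_def by blast
qed

lemma KL_arrow_Sym: "KL_arrow n x y \<Longrightarrow> x \<in> Sym n" "KL_arrow n x y \<Longrightarrow> y \<in> Sym n"
  by (auto simp: KL_arrow_def)

text \<open>The C_z with right descent \<open>t\<close> span a left ideal. Here this is seen from
  lengths: x = r y is immediate, and otherwise mu across the descent \<open>t\<close> forces y = x
  t, whence r y = (r x) t is no longer than \<open>x\<close>, although it should be longer than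
  \<open>y\<close>.\<close>

lemma KL_arrow_right_descent:
  assumes a: "KL_arrow n x y" and t: "t \<in> simples n" and yt: "len n (y \<circ> t) < len n y"
  shows "len n (x \<circ> t) < len n x"
proof (rule ccontr)
  note x = KL_arrow_Sym(1)[OF a] and y = KL_arrow_Sym(2)[OF a]
  assume nx: "\<not> len n (x \<circ> t) < len n x"
  then have xt: "len n x < len n (x \<circ> t)" using len_right_cases[OF x t] by linarith
  obtain r where r: "r \<in> simples n" "\<not> len n (r \<circ> y) < len n y"
    and nz: "kl_matrix n (\<lambda>w. r \<circ> w) x y \<noteq> 0"
    using a KL_arrow_iff[OF x y] by blast
  have ry: "len n (r \<circ> y) = Suc (len n y)" using len_left_cases[OF y r(1)] r(2) by linarith
  show False
  proof (cases "x = r \<circ> y")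
    case True
    have "y \<circ> t \<in> Sym n" using Sym_comp simples_Sym t y by blast
    then have "len n (r \<circ> (y \<circ> t)) \<le> Suc (len n (y \<circ> t))"
      using len_left_cases[OF _ r(1), of "y \<circ> t"] by fastforce
    then have "len n (x \<circ> t) < len n x" using yt ry True by (simp only: o_assoc)
    then show False using nx by blast
  next
    case False
    then have rx: "len n (r \<circ> x) < len n x" and m: "mu_lower n x y \<noteq> 0"
      using nz r(2) by (auto simp: kl_matrix_def split: if_splits)
    have y': "y = x \<circ> t"
      using mu_lower_descent[OF bar_action_right[OF t] y yt x xt] m by (auto split: if_splits)
    have "r \<circ> x \<in> Sym n" using Sym_comp simples_Sym r(1) x by blast
    then have "len n (r \<circ> x \<circ> t) \<le> Suc (len n (r \<circ> x))"
      using len_right_cases[OF _ t, of "r \<circ> x"] by fastforce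
    then have "len n (r \<circ> y) \<le> len n x" using rx by (simp only: y' o_assoc)
    then show False using ry xt y' by simp
  qed
qed

section \<open>Right star operations\<close>

definition in_D :: "nat \<Rightarrow> perm \<Rightarrow> perm \<Rightarrow> perm \<Rightarrow> bool" where
  "in_D n s t z \<longleftrightarrow> z \<in> Sym n \<and> len n (z \<circ> s) < len n z \<and> \<not> len n (z \<circ> t) < len n z"

text \<open>Exactly one of z s and z t has right descent \<open>t\<close> but not \<open>s\<close>;
  the test selects it, as \<open>adjacent_descents\<close> shows.\<close>

definition star :: "nat \<Rightarrow> perm \<Rightarrow> perm \<Rightarrow> perm \<Rightarrow> perm" where
  "star n s t z = (if len n (z \<circ> s \<circ> t) < len n (z \<circ> s) then z \<circ> s else z \<circ> t)"

definition adjacent :: "nat \<Rightarrow> perm \<Rightarrow> perm \<Rightarrow> bool" where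
  "adjacent n s t \<longleftrightarrow> (\<exists>i. 1 \<le> i \<and> Suc i < n \<and>
     (s = simple i \<and> t = simple (Suc i) \<or> s = simple (Suc i) \<and> t = simple i))"

lemma adjacent_sym: "adjacent n s t \<Longrightarrow> adjacent n t s"
  by (auto simp: adjacent_def)

lemma adjacent_simples: "adjacent n s t \<Longrightarrow> s \<in> simples n \<and> t \<in> simples n"
  by (auto simp: adjacent_def simples_def)

text \<open>On the three letters of \<open>z\<close> concerned, both conditions say that the third
  letter is smaller than the first.\<close>

lemma adjacent_descents:
  assumes "adjacent n s t" and D: "in_D n s t z"
  shows "len n (z \<circ> s \<circ> t) < len n (z \<circ> s) \<longleftrightarrow> len n (z \<circ> t \<circ> s) < len n (z \<circ> t)"
proof -
  obtain i where i: "1 \<le> i" "Suc i < n"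
    and st: "s = simple i \<and> t = simple (Suc i) \<or> s = simple (Suc i) \<and> t = simple i"
    using assms(1) by (auto simp: adjacent_def)
  have z: "z \<in> Sym n" using D by (simp add: in_D_def)
  have S: "z \<circ> simple i \<in> Sym n" "z \<circ> simple (Suc i) \<in> Sym n"
    using i by (auto intro!: Sym_comp z simple_Sym)
  have i': "1 \<le> i" "i < n" "1 \<le> Suc i" "Suc i < n" using i by auto
  note l = len_comp_simple_less[OF z i'(1,2)] len_comp_simple_less[OF z i'(3,4)]
    len_comp_simple_less[OF S(1) i'(3,4)] len_comp_simple_less[OF S(2) i'(1,2)]
  have ne: "z i \<noteq> z (Suc i)" "z i \<noteq> z (Suc (Suc i))" "z (Suc i) \<noteq> z (Suc (Suc i))"
    using Sym_inj[OF z] by auto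
  have v: "simple i i = Suc i" "simple i (Suc i) = i" "simple i (Suc (Suc i)) = Suc (Suc i)"
    "simple (Suc i) i = i" "simple (Suc i) (Suc i) = Suc (Suc i)" "simple (Suc i) (Suc (Suc i)) = Suc i"
    by (auto simp: simple_def transpose_def)
  from st show ?thesis
  proof
    assume st: "s = simple i \<and> t = simple (Suc i)"
    then show ?thesis using D ne by (auto simp: in_D_def l v)
  next
    assume st: "s = simple (Suc i) \<and> t = simple i"
    then show ?thesis using D ne by (auto simp: in_D_def l v)
  qed
qed

lemma star_in_D:
  assumes a: "adjacent n s t" and D: "in_D n s t z"
  shows "in_D n t s (star n s t z)" "star n t s (star n s t z) = z"
proof -
  have st: "s \<in> simples n" "t \<in> simples n" using adjacent_simples[OF a] by auto
  have z: "z \<in> Sym n" "len n (z \<circ> s) < len n z" "len n z < len n (z \<circ> t)"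
    using D len_right_cases[OF _ st(2), of z] by (auto simp: in_D_def)
  have S: "z \<circ> s \<in> Sym n" "z \<circ> t \<in> Sym n" using Sym_comp simples_Sym st z(1) by blast+
  note c = simples_cancel(2)[OF st(1)] simples_cancel(2)[OF st(2)]
  note ad = adjacent_descents[OF a D]
  have n: "\<not> len n z < len n (z \<circ> s)" using z(2) by simp
  show D': "in_D n t s (star n s t z)"
    unfolding in_D_def star_def using ad z S n
    by (cases "len n (z \<circ> s \<circ> t) < len n (z \<circ> s)") (simp_all only: c if_True if_False simp_thms)
  note ad' = adjacent_descents[OF adjacent_sym[OF a] D']
  have m: "\<not> len n (z \<circ> t) < len n z" using z(3) by simp
  show "star n t s (star n s t z) = z"
  proof (cases "len n (z \<circ> s \<circ> t) < len n (z \<circ> s)")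
    case True
    then have e: "star n s t z = z \<circ> s" by (simp only: star_def if_True)
    then have "\<not> len n (z \<circ> s \<circ> t \<circ> s) < len n (z \<circ> s \<circ> t)" using ad' m by (simp only: c simp_thms)
    then show ?thesis unfolding e star_def[of n t s] by (simp only: c if_False)
  next
    case False
    then have e: "star n s t z = z \<circ> t" by (simp only: star_def if_False)
    show ?thesis unfolding e star_def[of n t s] by (simp only: c z(2) if_True)
  qed
qed

text \<open>Since \<open>z\<close> has the descent \<open>s\<close> and \<open>x\<close> does not,
  mu can be nonzero only for x = z s. This leaves z s and z t, of which just one passes the descent
  conditions.\<close>

lemma kl_matrix_star:
  assumes a: "adjacent n s t" and D: "in_D n s t z" and x: "x \<in> Sym n" "\<not> len n (x \<circ> s) < len n x"
  shows "kl_matrix n (\<lambda>w. w \<circ> t) x z = (if x = star n s t z then 1 else 0)"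
proof -
  have st: "s \<in> simples n" "t \<in> simples n" using adjacent_simples[OF a] by auto
  have z: "z \<in> Sym n" "len n (z \<circ> s) < len n z" "\<not> len n (z \<circ> t) < len n z"
    using D by (auto simp: in_D_def)
  have xs: "len n x < len n (x \<circ> s)" using len_right_cases[OF x(1) st(1)] x(2) by linarith
  have m: "mu_lower n x z = (if x = z \<circ> s then 1 else 0)"
  proof -
    have "z = x \<circ> s \<longleftrightarrow> x = z \<circ> s" using simples_cancel(2)[OF st(1)] by metis
    then show ?thesis
      unfolding mu_lower_descent[OF bar_action_right[OF st(1)] z(1,2) x(1) xs] by (simp only:)
  qed
  note ad = adjacent_descents[OF a D]
  have ne: "z \<circ> s \<noteq> z \<circ> t" using z(2,3) by metis
  have k: "kl_matrix n (\<lambda>w. w \<circ> t) x z = (if x = z \<circ> t then 1 else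
      if len n (x \<circ> t) < len n x then (if x = z \<circ> s then 1 else 0) else 0)"
    unfolding kl_matrix_def m using z(3) by simp
  show ?thesis
  proof (cases "len n (z \<circ> s \<circ> t) < len n (z \<circ> s)")
    case True
    then have "x \<noteq> z \<circ> t" using ad x(2) by metis
    then show ?thesis unfolding k star_def using True by auto
  next
    case False
    then show ?thesis unfolding k star_def using ne by auto
  qed
qed

lemma KL_arrow_star:
  assumes a: "adjacent n s t" and Dx: "in_D n s t x" and Dy: "in_D n s t y" and xy: "KL_arrow n x y"
  shows "KL_arrow n (star n s t x) (star n s t y)"
proof -
  let ?x = "star n s t x" and ?y = "star n s t y"
  have st: "s \<in> simples n" "t \<in> simples n" using adjacent_simples[OF a] by auto
  have x: "x \<in> Sym n" "\<not> len n (x \<circ> t) < len n x" using Dx by (auto simp: in_D_def)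
  have y: "y \<in> Sym n" "len n (y \<circ> s) < len n y" using Dy by (auto simp: in_D_def)
  have x': "?x \<in> Sym n" "\<not> len n (?x \<circ> s) < len n ?x" using star_in_D(1)[OF a Dx] by (auto simp: in_D_def)
  have y': "?y \<in> Sym n" "\<not> len n (?y \<circ> s) < len n ?y" using star_in_D(1)[OF a Dy] by (auto simp: in_D_def)
  obtain r where r: "r \<in> simples n" "\<not> len n (r \<circ> y) < len n y"
    and nz: "kl_matrix n (\<lambda>w. r \<circ> w) x y \<noteq> 0"
    using xy KL_arrow_iff[OF x(1) y(1)] by blast
  let ?L = "kl_matrix n (\<lambda>w. r \<circ> w)" and ?R = "kl_matrix n (\<lambda>w. w \<circ> t)"
  have "y \<noteq> r \<circ> y" using len_left_cases[OF y(1) r(1)] by auto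
  then have "?L y y = 0" using r(2) by (simp add: kl_matrix_def)
  then have ne: "x \<noteq> y" using nz by auto
  \<comment> \<open>A contributing \<open>z\<close> has an arrow to \<open>y\<close> and thus keeps
    the descent \<open>s\<close>. If it also has \<open>t\<close>, column \<open>z\<close> of the
    right matrix is diagonal and misses x*; otherwise \<open>kl_matrix_star\<close> identifies
    \<open>z\<close> with \<open>x\<close>.\<close>
  have 1: "?R ?x z * ?L z y = (if x = z then ?L x y else 0)" if z: "z \<in> Sym n" for z
  proof (cases "?L z y = 0")
    case False
    then have "KL_arrow n z y" using KL_arrow_iff[OF z y(1)] r by blast
    then have zs: "len n (z \<circ> s) < len n z" by (rule KL_arrow_right_descent[OF _ st(1) y(2)])
    show ?thesis
    proof (cases "len n (z \<circ> t) < len n z")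
      case True
      then have "?x \<noteq> z" "x \<noteq> z" using x(2) x'(2) zs by auto
      then show ?thesis using True by (simp add: kl_matrix_def)
    next
      case nzt: False
      then have Dz: "in_D n s t z" using z zs by (simp add: in_D_def)
      have "?x = star n s t z \<longleftrightarrow> x = z" using star_in_D(2)[OF a Dx] star_in_D(2)[OF a Dz] by metis
      then show ?thesis using kl_matrix_star[OF a Dz x'] by auto
    qed
  qed auto
  \<comment> \<open>Here a \<open>z\<close> with right descent \<open>s\<close> is excluded because
    left multiplication would pass \<open>s\<close> on to x*, which lacks it.\<close>
  have 2: "?L ?x z * ?R z y = (if ?y = z then ?L ?x ?y else 0)" if z: "z \<in> Sym n" for z
  proof (cases "len n (z \<circ> s) < len n z")
    case True
    have "?L ?x z = 0"
    proof (rule ccontr)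
      assume nz: "?L ?x z \<noteq> 0"
      show False
      proof (cases "len n (r \<circ> z) < len n z")
        case down: True
        then have "?x = z" using nz by (auto simp: kl_matrix_def split: if_splits)
        then show False using True x'(2) by simp
      next
        case False
        then have "KL_arrow n ?x z" using KL_arrow_iff[OF x'(1) z] r(1) nz by blast
        from KL_arrow_right_descent[OF this st(1) True] show False using x'(2) by blast
      qed
    qed
    moreover have "?y \<noteq> z" using True y'(2) by auto
    ultimately show ?thesis by simp
  next
    case False
    then show ?thesis using kl_matrix_star[OF a Dy z False] by auto
  qed
  have "?L ?x ?y = (\<Sum>z\<in>Sym n. ?L ?x z * ?R z y)" using 2 y'(1) finite_Sym[of n] by simp
  also have "\<dots> = (\<Sum>z\<in>Sym n. ?R ?x z * ?L z y)" by (rule kl_matrix_commute[OF r(1) st(2) x'(1) y(1)])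
  also have "\<dots> = ?L x y" using 1 x(1) finite_Sym[of n] by simp
  finally have nz': "?L ?x ?y \<noteq> 0" using nz by simp
  have "?x \<noteq> ?y" using ne star_in_D(2)[OF a Dx] star_in_D(2)[OF a Dy] by metis
  then have "\<not> len n (r \<circ> ?y) < len n ?y" using nz' by (auto simp: kl_matrix_def)
  then show ?thesis using KL_arrow_iff[OF x'(1) y'(1)] r(1) nz' by blast
qed

lemma KL_preorder_right_descent:
  assumes "KL_preorder n x y" "t \<in> simples n" "len n (y \<circ> t) < len n y"
  shows "len n (x \<circ> t) < len n x"
  using assms(1) unfolding KL_preorder_def
proof (induction rule: converse_rtranclp_induct)
  case base then show ?case by (rule assms(3))
next
  case (step x z)
  then show ?case using KL_arrow_right_descent assms(2) by blast
qed

text \<open>All elements on a path from \<open>x\<close> to \<open>y\<close> stay in the domain of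
  the star operation: they inherit \<open>s\<close> from \<open>y\<close>, and they cannot have
  \<open>t\<close> because \<open>x\<close> would inherit it.\<close>

lemma KL_preorder_star:
  assumes a: "adjacent n s t" and pre: "KL_preorder n x y" and Dx: "in_D n s t x" and Dy: "in_D n s t y"
  shows "KL_preorder n (star n s t x) (star n s t y)"
proof -
  have st: "s \<in> simples n" "t \<in> simples n" using adjacent_simples[OF a] by auto
  have "(KL_arrow n)\<^sup>*\<^sup>* x y" using pre by (simp add: KL_preorder_def)
  then have "in_D n s t x \<longrightarrow> KL_preorder n (star n s t x) (star n s t y)"
  proof (induction rule: converse_rtranclp_induct)
    case base then show ?case by (simp add: KL_preorder_def)
  next
    case (step x z)
    show ?case
    proof
      assume Dx: "in_D n s t x"
      have "KL_preorder n z y" using step by (simp add: KL_preorder_def)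
      then have "len n (z \<circ> s) < len n z" using KL_preorder_right_descent st Dy by (auto simp: in_D_def)
      moreover have "\<not> len n (z \<circ> t) < len n z"
        using KL_arrow_right_descent[OF step(1) st(2)] Dx by (auto simp: in_D_def)
      ultimately have Dz: "in_D n s t z" using KL_arrow_Sym(2)[OF step(1)] by (simp add: in_D_def)
      have "KL_arrow n (star n s t x) (star n s t z)" by (rule KL_arrow_star[OF a Dx Dz step(1)])
      then show "KL_preorder n (star n s t x) (star n s t y)"
        using step.IH Dz unfolding KL_preorder_def by (meson converse_rtranclp_into_rtranclp)
    qed
  qed
  then show ?thesis using Dx by blast
qed

section \<open>Knuth and dual Knuth moves on left cells\<close>

definition cell_equiv :: "nat \<Rightarrow> perm \<Rightarrow> perm \<Rightarrow> bool" where
  "cell_equiv n x y \<longleftrightarrow> x \<in> Sym n \<and> y \<in> Sym n \<and> KL_preorder n x y \<and> KL_preorder n y x"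

lemma cell_equiv_refl: "x \<in> Sym n \<Longrightarrow> cell_equiv n x x"
  by (simp add: cell_equiv_def KL_preorder_def)

lemma cell_equiv_sym: "cell_equiv n x y \<Longrightarrow> cell_equiv n y x"
  by (simp add: cell_equiv_def)

lemma cell_equiv_trans: "cell_equiv n x y \<Longrightarrow> cell_equiv n y z \<Longrightarrow> cell_equiv n x z"
  by (auto simp: cell_equiv_def KL_preorder_def)

lemma left_cell_eq: "w \<in> Sym n \<Longrightarrow> left_cell n w = {u. cell_equiv n u w}"
  by (auto simp: left_cell_def cell_equiv_def)

lemma cell_equiv_right_descent:
  assumes "cell_equiv n x y" "1 \<le> i" "i < n"
  shows "x (Suc i) < x i \<longleftrightarrow> y (Suc i) < y i"
proof -
  have s: "simple i \<in> simples n" using assms by (auto simp: simples_def)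
  have "len n (x \<circ> simple i) < len n x \<longleftrightarrow> len n (y \<circ> simple i) < len n y"
    using assms(1) KL_preorder_right_descent[OF _ s] unfolding cell_equiv_def by blast
  then show ?thesis using assms len_comp_simple_less[of _ n i] by (simp add: cell_equiv_def)
qed

text \<open>The right star operation is a Knuth move on the word \<open>x 1, \<dots>, x n\<close>, here written for three
  consecutive letters of shape \<open>a < b > c\<close>.\<close>

definition knuth_swap :: "nat \<Rightarrow> perm \<Rightarrow> perm" where
  "knuth_swap i x = (if x i < x (Suc (Suc i)) then x \<circ> simple i else x \<circ> simple (Suc i))"

lemma cell_equiv_knuth:
  assumes xy: "cell_equiv n x y" and i: "1 \<le> i" "Suc i < n"
    and peak: "x i < x (Suc i)" "x (Suc (Suc i)) < x (Suc i)"
  shows "cell_equiv n (knuth_swap i x) (knuth_swap i y)"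
proof -
  let ?s = "simple (Suc i)" and ?t = "simple i"
  have a: "adjacent n ?s ?t" using i by (auto simp: adjacent_def)
  have *: "in_D n ?s ?t z \<and> star n ?s ?t z = knuth_swap i z"
    if z: "z \<in> Sym n" "z i < z (Suc i)" "z (Suc (Suc i)) < z (Suc i)" for z
  proof -
    have D: "in_D n ?s ?t z"
      using z i len_comp_simple_less[OF z(1), of i] len_comp_simple_less[OF z(1), of "Suc i"] by (simp add: in_D_def)
    have S: "z \<circ> ?s \<in> Sym n" using i by (auto intro!: Sym_comp z simple_Sym)
    have "len n (z \<circ> ?s \<circ> ?t) < len n (z \<circ> ?s) \<longleftrightarrow> z (Suc (Suc i)) < z i"
      using len_comp_simple_less[OF S, of i] i by (simp add: simple_def transpose_def)
    then show ?thesis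
      using D Sym_less_cases[OF z(1), of i "Suc (Suc i)"] by (auto simp: star_def knuth_swap_def)
  qed
  have S: "x \<in> Sym n" "y \<in> Sym n" using xy by (auto simp: cell_equiv_def)
  \<comment> \<open>The peak of \<open>y\<close> follows from equality of right descents; the outer
    letters may compare differently, so the two moves need not exchange the same positions.\<close>
  have y: "y i < y (Suc i)" "y (Suc (Suc i)) < y (Suc i)"
    using cell_equiv_right_descent[OF xy, of i] cell_equiv_right_descent[OF xy, of "Suc i"] i peak
      Sym_less_cases[OF S(2), of i "Suc i"] by auto
  note X = *[OF S(1) peak] and Y = *[OF S(2) y]
  have "knuth_swap i x \<in> Sym n" "knuth_swap i y \<in> Sym n"
    using star_in_D(1)[OF a] X Y by (metis in_D_def)+
  then show ?thesis
    using KL_preorder_star[OF a] xy X Y unfolding cell_equiv_def by metis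
qed

text \<open>\<open>r\<close> and \<open>r'\<close> witness that neither left descent set contains
  the other, and mu between x and r x is 1, so there are arrows both ways.\<close>

lemma cell_equiv_dual_knuth:
  assumes x: "x \<in> Sym n" and r: "r \<in> simples n" and r': "r' \<in> simples n"
    and up: "len n x < len n (r \<circ> x)" and d: "len n (r' \<circ> x) < len n x"
    and nd: "\<not> len n (r' \<circ> (r \<circ> x)) < len n (r \<circ> x)"
  shows "cell_equiv n x (r \<circ> x)"
proof -
  have rx: "r \<circ> x \<in> Sym n" using Sym_comp simples_Sym r x by blast
  have down: "len n (r \<circ> (r \<circ> x)) < len n (r \<circ> x)" by (simp only: simples_cancel(1)[OF r] up)
  have "mu_lower n x (r \<circ> x) \<noteq> 0"
    unfolding mu_lower_descent[OF bar_action_left[OF r] rx down x up] by simp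
  then have "KL_mu n x (r \<circ> x) \<noteq> 0" "KL_mu n (r \<circ> x) x \<noteq> 0"
    using KL_mu_neq_0_iff[OF x rx] KL_mu_neq_0_iff[OF rx x] by auto
  moreover have "\<not> left_descents n x \<subseteq> left_descents n (r \<circ> x)"
    using d nd r' left_descents_iff[OF x] left_descents_iff[OF rx] by blast
  moreover have "\<not> left_descents n (r \<circ> x) \<subseteq> left_descents n x"
    using down up r left_descents_iff[OF x] left_descents_iff[OF rx] by auto
  ultimately show ?thesis
    using x rx unfolding cell_equiv_def KL_preorder_def KL_arrow_def
    by (intro conjI r_into_rtranclp) auto
qed

section \<open>Words of equivalent permutations\<close>

text \<open>The list is the window of the word of \<open>x\<close> that starts after position
  \<open>k\<close>; the relational form makes splitting a window a conjunction.\<close>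

primrec is_word :: "perm \<Rightarrow> nat \<Rightarrow> nat list \<Rightarrow> bool" where
  "is_word x k [] = True"
| "is_word x k (a # l) = (a = x (Suc k) \<and> is_word x (Suc k) l)"

lemma is_word_append: "is_word x k (l @ m) \<longleftrightarrow> is_word x k l \<and> is_word x (k + length l) m"
  by (induction l arbitrary: k) auto

lemma is_word_cong:
  "(\<And>j. k < j \<Longrightarrow> j \<le> k + length l \<Longrightarrow> x j = y j) \<Longrightarrow> is_word x k l \<longleftrightarrow> is_word y k l"
proof (induction l arbitrary: k)
  case (Cons a l)
  have "x (Suc k) = y (Suc k)" by (rule Cons.prems) auto
  moreover have "is_word x (Suc k) l = is_word y (Suc k) l"
    by (rule Cons.IH, rule Cons.prems) auto
  ultimately show ?case by simp
qed simp

lemma is_word_map: "is_word x k (map x [Suc k..<Suc k + m])"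
proof (induction m)
  case (Suc m)
  have "[Suc k..<Suc k + Suc m] = [Suc k..<Suc k + m] @ [Suc (k + m)]" by simp
  moreover have "length (map x [Suc k..<Suc k + m]) = m" by simp
  moreover have "is_word x (k + m) (map x [Suc (k + m)])" by simp
  ultimately show ?case using Suc by (simp only: map_append is_word_append simp_thms)
qed simp

lemma is_word_swap:
  assumes "is_word x k (l @ [p, q] @ m)"
  shows "is_word (x \<circ> simple (Suc (k + length l))) k (l @ [q, p] @ m)"
proof -
  let ?i = "Suc (k + length l)"
  have f: "simple ?i j = j" if "j \<noteq> ?i" "j \<noteq> Suc ?i" for j using that by (simp add: simple_def)
  have v: "simple ?i ?i = Suc ?i" "simple ?i (Suc ?i) = ?i" by (simp_all add: simple_def)
  have "is_word (x \<circ> simple ?i) k l"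
    using assms is_word_cong[of k l x "x \<circ> simple ?i"] by (simp add: is_word_append f)
  moreover have "is_word (x \<circ> simple ?i) (Suc (Suc (k + length l))) m"
    using assms is_word_cong[of "Suc (Suc (k + length l))" m x "x \<circ> simple ?i"] by (simp add: is_word_append f)
  ultimately show ?thesis using assms by (simp add: is_word_append v)
qed

text \<open>Corresponding windows of two words in one cell. Hiding the permutations and the offset
  allows letters to be dropped at either end, which the inductions below do repeatedly.\<close>

definition word_rel :: "nat \<Rightarrow> nat list \<Rightarrow> nat list \<Rightarrow> bool" where
  "word_rel n l l' \<longleftrightarrow> (\<exists>x y k. cell_equiv n x y \<and> k + length l \<le> n \<and> length l' = length l \<and>
     is_word x k l \<and> is_word y k l')"

lemma word_rel_factor:
  assumes "word_rel n (a @ b @ c) (a' @ b' @ c')" "length a = length a'" "length b = length b'"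
  shows "word_rel n b b'"
proof -
  obtain x y k where "cell_equiv n x y" "k + length (a @ b @ c) \<le> n"
    "is_word x k (a @ b @ c)" "is_word y k (a' @ b' @ c')"
    using assms(1) unfolding word_rel_def by blast
  then show ?thesis using assms(2,3) unfolding word_rel_def
    by (intro exI[of _ x] exI[of _ y] exI[of _ "k + length a"]) (auto simp: is_word_append)
qed

lemma word_rel_prefix: "word_rel n (a @ b) (a' @ b') \<Longrightarrow> length a = length a' \<Longrightarrow> word_rel n a a'"
  using word_rel_factor[of n "[]" a b "[]" a' b'] by simp

lemma word_rel_descent:
  assumes "word_rel n (a @ [p, q] @ c) (a' @ [p', q'] @ c')" "length a = length a'"
  shows "q < p \<longleftrightarrow> q' < p'" "q' \<noteq> p'"
proof -
  have "word_rel n [p, q] [p', q']" using word_rel_factor[OF assms] by simp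
  then obtain x y k where c: "cell_equiv n x y" and k: "k + 2 \<le> n"
    and w: "p = x (Suc k)" "q = x (Suc (Suc k))" "p' = y (Suc k)" "q' = y (Suc (Suc k))"
    by (auto simp: word_rel_def)
  show "q < p \<longleftrightarrow> q' < p'" using cell_equiv_right_descent[OF c, of "Suc k"] k by (simp add: w)
  have "y \<in> Sym n" using c by (simp add: cell_equiv_def)
  then show "q' \<noteq> p'" using Sym_inj by (simp add: w)
qed

definition knuth3 :: "nat \<Rightarrow> nat \<Rightarrow> nat \<Rightarrow> nat list" where
  "knuth3 p q r = (if p < r then [q, p, r] else [p, r, q])"

lemma word_rel_knuth:
  assumes wr: "word_rel n (a @ [p, q, r] @ c) (a' @ [p', q', r'] @ c')" and l: "length a = length a'"
    and peak: "p < q" "r < q"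
  shows "word_rel n (a @ knuth3 p q r @ c) (a' @ knuth3 p' q' r' @ c')"
proof -
  obtain x y k where e: "cell_equiv n x y" and k: "k + length (a @ [p, q, r] @ c) \<le> n"
    and lc: "length (a' @ [p', q', r'] @ c') = length (a @ [p, q, r] @ c)"
    and w: "is_word x k (a @ [p, q, r] @ c)" "is_word y k (a' @ [p', q', r'] @ c')"
    using wr unfolding word_rel_def by blast
  let ?i = "Suc (k + length a)"
  have W: "is_word (knuth_swap ?i z) k (b @ knuth3 p q r @ d)"
    if z: "is_word z k (b @ [p, q, r] @ d)" and b: "length b = length a" for z b p q r d
  proof -
    have v: "p = z ?i" "r = z (Suc (Suc ?i))" using z b by (auto simp: is_word_append)
    show ?thesis
    proof (cases "p < r")
      case True
      then show ?thesis
        using is_word_swap[of z k b p q "r # d"] z b v by (simp add: knuth_swap_def knuth3_def)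
    next
      case False
      then show ?thesis
        using is_word_swap[of z k "b @ [p]" q r d] z b v by (simp add: knuth_swap_def knuth3_def)
    qed
  qed
  have "cell_equiv n (knuth_swap ?i x) (knuth_swap ?i y)"
  proof (rule cell_equiv_knuth[OF e])
    have "p = x ?i" "q = x (Suc ?i)" "r = x (Suc (Suc ?i))" using w(1) by (auto simp: is_word_append)
    then show "x ?i < x (Suc ?i)" "x (Suc (Suc ?i)) < x (Suc ?i)" using peak by auto
  qed (use k in auto)
  moreover have "length (knuth3 p q r) = 3" for p q r by (simp add: knuth3_def)
  ultimately show ?thesis
    unfolding word_rel_def using W[OF w(1) refl] W[OF w(2) l[symmetric]] k lc
    by (intro exI[of _ "knuth_swap ?i x"] exI[of _ "knuth_swap ?i y"] exI[of _ k]) simp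
qed

lemma word_rel_length: "word_rel n l l' \<Longrightarrow> length l' = length l"
  by (auto simp: word_rel_def)

lemma word_rel_sorted: "word_rel n l l' \<Longrightarrow> sorted_wrt (>) l \<Longrightarrow> sorted_wrt (>) l'"
proof (induction l arbitrary: l')
  case Nil
  then show ?case using word_rel_length[OF Nil(1)] by simp
next
  case (Cons a l)
  obtain a' m' where l': "l' = a' # m'" "length m' = length l"
    using word_rel_length[OF Cons.prems(1)] by (cases l') auto
  have wr: "word_rel n l m'" using word_rel_factor[of n "[a]" l "[]" "[a']" m' "[]"] Cons.prems(1) l' by simp
  show ?case
  proof (cases l)
    case Nil
    then show ?thesis using l' by simp
  next
    case (Cons b m)
    then obtain b' m2 where m': "m' = b' # m2" "length m2 = length m" using l' by (cases m') auto
    have "a' > b'"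
      using word_rel_descent(1)[of n "[]" a b m "[]" a' b' m2] Cons.prems Cons l' m' by simp
    moreover have "sorted_wrt (>) m'" using Cons.IH[OF wr] Cons.prems(2) by simp
    moreover have "transp ((>) :: nat \<Rightarrow> nat \<Rightarrow> bool)" by (auto simp: transp_def)
    ultimately show ?thesis using l' m' sorted_wrt2 by metis
  qed
qed

text \<open>The letter \<open>a\<close> passes the decreasing block \<open>B\<close> one letter at a
  time. At each step the peak \<open>a b d\<close> has a < c <= d < b, so the Knuth move exchanges
  \<open>a\<close> and \<open>b\<close>; the same holds in the second word.\<close>

lemma word_rel_move:
  assumes "word_rel n (P @ [a] @ B @ [c] @ Q) (P' @ [a'] @ B' @ [c'] @ Q')"
    and "length P = length P'" "length B = length B'"
    and "sorted_wrt (>) (B @ [c])" "a < c" "sorted_wrt (>) (B' @ [c'])" "a' < c'"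
  shows "word_rel n (P @ B @ [a] @ [c] @ Q) (P' @ B' @ [a'] @ [c'] @ Q')"
  using assms
proof (induction B arbitrary: P P' B')
  case Nil
  then show ?case by simp
next
  case (Cons b B)
  then obtain b' C' where B': "B' = b' # C'" "length C' = length B" by (cases B') auto
  obtain d D where d: "B @ [c] = d # D" by (cases B) auto
  obtain d' D' where d': "C' @ [c'] = d' # D'" by (cases C') auto
  have ge: "c \<le> d" "d < b"
    using Cons.prems(4) d by (cases B; auto)+
  have ge': "c' \<le> d'" "d' < b'"
    using Cons.prems(6) d' B' by (cases C'; auto)+
  have "word_rel n (P @ [a, b, d] @ D @ Q) (P' @ [a', b', d'] @ D' @ Q')"
    using Cons.prems(1) d d' B' by (metis append_Cons append_Nil append_assoc)
  then have "word_rel n (P @ knuth3 a b d @ D @ Q) (P' @ knuth3 a' b' d' @ D' @ Q')"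
    using ge Cons.prems by (intro word_rel_knuth) auto
  moreover have "knuth3 a b d = [b, a, d]" "knuth3 a' b' d' = [b', a', d']"
    using ge ge' Cons.prems by (auto simp: knuth3_def)
  ultimately have "word_rel n (P @ [b] @ [a] @ (d # D) @ Q) (P' @ [b'] @ [a'] @ (d' # D') @ Q')"
    by simp
  then have "word_rel n ((P @ [b]) @ [a] @ B @ [c] @ Q) ((P' @ [b']) @ [a'] @ C' @ [c'] @ Q')"
    using d d' by (metis append_assoc)
  from Cons.IH[OF this] have "word_rel n ((P @ [b]) @ B @ [a] @ [c] @ Q) ((P' @ [b']) @ C' @ [a'] @ [c'] @ Q')"
    using Cons.prems B' by simp
  then show ?case using B' by simp
qed

text \<open>
  If the last moves of the two words differ, the discrepancy propagates to the left by further
  moves until it shows up in the first descent.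
\<close>

lemma word_rel_discrepancy:
  assumes "word_rel n (A @ B @ [b, a]) (A' @ B' @ [a', c'])"
    and "length A = Suc (length B)" "length A' = Suc (length B)" "length B' = length B"
    and "sorted_wrt (>) (B @ [b])" "\<forall>x \<in> set (A @ [a]). \<forall>y \<in> set (B @ [b]). x < y"
    and "sorted_wrt (>) (A' @ [a'])" "c' < a'" "sorted_wrt (>) B'" "list_all2 (<) (tl A') B'"
  shows False
  using assms
proof (induction "length B" arbitrary: A B b a A' B' a' c')
  case 0
  then obtain e e' where "A = [e]" "A' = [e']" "B = []" "B' = []"
    by (auto simp: length_Suc_conv)
  \<comment> \<open>The words begin with an ascent \<open>e < b\<close> and a descent
    \<open>a' < e'\<close>.\<close>
  then show False
    using word_rel_descent(1)[of n "[]" e b "[a]" "[]" e' a' "[c']"] 0 by auto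
next
  case (Suc m)
  obtain A3 e where A: "A = A3 @ [e]" using Suc.prems(2) by (cases A rule: rev_cases) auto
  obtain A3' e' where A': "A' = A3' @ [e']" using Suc.prems(3) by (cases A' rule: rev_cases) auto
  obtain B4 f where B: "B = B4 @ [f]" using Suc.hyps(2) by (cases B rule: rev_cases) auto
  obtain B4' f' where B': "B' = B4' @ [f']" using Suc.hyps(2) Suc.prems(4) by (cases B' rule: rev_cases) auto
  have len: "length A3 = Suc (length B4)" "length A3' = Suc (length B4)" "length B4' = length B4"
    using Suc.prems(2-4) A A' B B' by auto
  have "tl A' = tl A3' @ [e']" using len A' by (cases A3') auto
  then have la: "list_all2 (<) (tl A3') B4'" "e' < f'"
    using Suc.prems(10) B' len by (auto simp: list_all2_append)
  have lt: "e < f" "e < b" "b < f" using Suc.prems(5,6) A B by (auto simp: sorted_wrt_append)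
  have lt': "a' < e'" using Suc.prems(7) A' by (auto simp: sorted_wrt_append)
  \<comment> \<open>\<open>e\<close> and \<open>e'\<close> travel in parallel until they precede
    \<open>f\<close> and \<open>f'\<close>; the shifted inequalities
    \<open>list_all2 (<) (tl A') B'\<close> permit this in the second word.\<close>
  have "word_rel n (A3 @ [e] @ B4 @ [f] @ [b, a]) (A3' @ [e'] @ B4' @ [f'] @ [a', c'])"
    using Suc.prems(1) A A' B B' by simp
  then have "word_rel n (A3 @ B4 @ [e] @ [f] @ [b, a]) (A3' @ B4' @ [e'] @ [f'] @ [a', c'])"
    using len lt la Suc.prems(5,9) B B'
    by (intro word_rel_move) (auto simp: sorted_wrt_append)
  then have "word_rel n ((A3 @ B4) @ [e, f, b] @ [a]) ((A3' @ B4') @ [e', f', a'] @ [c'])" by simp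
  \<comment> \<open>Now \<open>e < b\<close> exchanges \<open>e\<close> and \<open>f\<close>,
    whereas \<open>a' < e'\<close> exchanges \<open>f'\<close> and \<open>a'\<close>. Without the
    last two letters this is the original situation with blocks shorter by one letter.\<close>
  then have "word_rel n ((A3 @ B4) @ knuth3 e f b @ [a]) ((A3' @ B4') @ knuth3 e' f' a' @ [c'])"
    using len lt by (intro word_rel_knuth) auto
  then have "word_rel n ((A3 @ B4 @ [f, e]) @ [b, a]) ((A3' @ B4' @ [e', a']) @ [f', c'])"
    using lt lt' by (simp add: knuth3_def)
  then have "word_rel n (A3 @ B4 @ [f, e]) (A3' @ B4' @ [e', a'])"
    using len by (rule_tac word_rel_prefix) auto
  then show False
    by (rule Suc.hyps(1)[rotated]) (use len la lt' Suc.prems(5,6,7,9) Suc.hyps(2) A A' B B' in \<open>auto simp: sorted_wrt_append\<close>)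
qed

text \<open>The lists are two columns of equal height, read from bottom to top, and
  \<open>list_all2\<close> states that the rows increase. Induction on the height settles first a
  shifted pairing and then, after a Knuth move at the top, all rows but the top one.\<close>

lemma word_rel_two_columns:
  assumes "word_rel n (A @ B) (A' @ B')"
    and "length B = length A" "length A' = length A" "length B' = length A"
    and "sorted_wrt (>) A" "sorted_wrt (>) B" "\<forall>x \<in> set A. \<forall>y \<in> set B. x < y"
  shows "list_all2 (<) A' B'"
  using assms
proof (induction "length A" arbitrary: A B A' B' rule: less_induct)
  case less
  have srt: "sorted_wrt (>) A'" "sorted_wrt (>) B'"
    using word_rel_sorted[OF word_rel_prefix[OF less.prems(1)]]
      word_rel_sorted[OF word_rel_factor[of n A B "[]" A' B' "[]"]] less.prems by simp_all
  consider "A = []" | "length A = 1" | "2 \<le> length A" by (cases A; cases "tl A") auto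
  then show ?case
  proof cases
    case 1
    then show ?thesis using less.prems by simp
  next
    case 2
    then obtain a b a' b' where "A = [a]" "B = [b]" "A' = [a']" "B' = [b']"
      using less.prems(2-4) by (auto simp: length_Suc_conv)
    then show ?thesis using word_rel_descent[of n "[]" a b "[]" "[]" a' b' "[]"] less.prems by auto
  next
    case 3
    obtain h A1 a where A: "A = h # A1 @ [a]"
      using 3 by (cases A; cases "tl A" rule: rev_cases) auto
    obtain B3 m b where B: "B = B3 @ [m, b]"
      using 3 less.prems(2) by (cases B rule: rev_cases; cases "butlast B" rule: rev_cases) auto
    obtain h' A1' a' where A': "A' = h' # A1' @ [a']"
      using 3 less.prems(3) by (cases A'; cases "tl A'" rule: rev_cases) auto
    obtain B3' m' b' where B': "B' = B3' @ [m', b']"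
      using 3 less.prems(4) by (cases B' rule: rev_cases; cases "butlast B'" rule: rev_cases) auto
    have len: "length B3 = length A1" "length A1' = length A1" "length B3' = length A1"
      using less.prems(2-4) A B A' B' by auto
    \<comment> \<open>Without the bottom left letter and the top right letter, each left letter is
      paired with the right letter one row below it. These weaker inequalities let \<open>a'\<close>
      pass \<open>B3'\<close>.\<close>
    have "word_rel n ([h] @ ((A1 @ [a]) @ (B3 @ [m])) @ [b]) ([h'] @ ((A1' @ [a']) @ (B3' @ [m'])) @ [b'])"
      using less.prems(1) A B A' B' by simp
    from word_rel_factor[OF this] len
    have "word_rel n ((A1 @ [a]) @ (B3 @ [m])) ((A1' @ [a']) @ (B3' @ [m']))" by simp
    then have "list_all2 (<) (A1' @ [a']) (B3' @ [m'])"
      by (rule less.hyps[rotated]) (use len less.prems(5-7) A B in \<open>auto simp: sorted_wrt_append\<close>)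
    then have la: "list_all2 (<) A1' B3'" "a' < m'" using len by (auto simp: list_all2_append)
    have lt: "a < m" "a < b" "b < m" using less.prems(6,7) A B by (auto simp: sorted_wrt_append)
    have "word_rel n ((h # A1) @ [a] @ B3 @ [m] @ [b]) ((h' # A1') @ [a'] @ B3' @ [m'] @ [b'])"
      using less.prems(1) A B A' B' by simp
    then have "word_rel n ((h # A1) @ B3 @ [a] @ [m] @ [b]) ((h' # A1') @ B3' @ [a'] @ [m'] @ [b'])"
      using len lt la less.prems(6) srt(2) B B' by (intro word_rel_move) (auto simp: sorted_wrt_append)
    then have "word_rel n ((h # A1 @ B3) @ [a, m, b] @ []) ((h' # A1' @ B3') @ [a', m', b'] @ [])" by simp
    then have k: "word_rel n ((h # A1 @ B3) @ knuth3 a m b @ []) ((h' # A1' @ B3') @ knuth3 a' m' b' @ [])"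
      using len lt by (intro word_rel_knuth) auto
    show ?thesis
    proof (cases "a' < b'")
      case True
      then have "word_rel n (((h # A1) @ (B3 @ [m])) @ [a, b]) (((h' # A1') @ (B3' @ [m'])) @ [a', b'])"
        using k lt by (simp add: knuth3_def)
      then have "word_rel n ((h # A1) @ (B3 @ [m])) ((h' # A1') @ (B3' @ [m']))"
        using len by (rule_tac word_rel_prefix) auto
      then have "list_all2 (<) (h' # A1') (B3' @ [m'])"
        by (rule less.hyps[rotated]) (use len less.prems(5-7) A B in \<open>auto simp: sorted_wrt_append\<close>)
      then have "list_all2 (<) ((h' # A1') @ [a']) ((B3' @ [m']) @ [b'])"
        using True by (intro list_all2_appendI) auto
      then show ?thesis using A' B' by simp
    next
      case False
      \<comment> \<open>If the top row of the second word failed, the move on \<open>a m b\<close>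
        would act at different places in the two words, which is the discrepancy excluded
        above.\<close>
      have "word_rel n (((h # A1) @ B3 @ [m, a]) @ [b]) (((h' # A1') @ B3' @ [a', b']) @ [m'])"
        using k lt False by (simp add: knuth3_def)
      then have wr: "word_rel n ((h # A1) @ B3 @ [m, a]) ((h' # A1') @ B3' @ [a', b'])"
        using len by (rule_tac word_rel_prefix) auto
      have "b' < a'"
        using word_rel_descent(2)[of n "(h # A1) @ B3" m a "[]" "(h' # A1') @ B3'" a' b' "[]"] wr len False by auto
      then have False
        using word_rel_discrepancy[OF wr] len la less.prems(6,7) srt A B A' B'
        by (auto simp: sorted_wrt_append)
      then show ?thesis ..
    qed
  qed
qed

lemma sorted_wrt_greater_map_upt:
  "(\<And>i. a \<le> i \<Longrightarrow> Suc i < b \<Longrightarrow> x (Suc i) < x i) \<Longrightarrow> sorted_wrt (>) (map (x :: nat \<Rightarrow> nat) [a..<b])"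
proof -
  assume *: "\<And>i. a \<le> i \<Longrightarrow> Suc i < b \<Longrightarrow> x (Suc i) < x i"
  have "i < j \<Longrightarrow> a \<le> i \<Longrightarrow> j < b \<Longrightarrow> x j < x i" for i j
  proof (induction j)
    case (Suc j)
    then show ?case using *[of j] by (cases "i = j") (auto intro: less_trans)
  qed simp
  then show ?thesis by (auto simp: sorted_wrt_iff_nth_less)
qed

text \<open>\<open>k\<close> letters precede the two columns and \<open>q\<close> is their common
  height; the hypotheses on \<open>x\<close> describe the shape of \<open>w_J\<close> on such a
  window.\<close>

lemma cell_equiv_two_columns:
  assumes xy: "cell_equiv n x y" and k: "k + 2 * q \<le> n"
    and d1: "\<And>m. 1 \<le> m \<Longrightarrow> m < q \<Longrightarrow> x (Suc (k + m)) < x (k + m)"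
    and d2: "\<And>m. 1 \<le> m \<Longrightarrow> m < q \<Longrightarrow> x (Suc (k + q + m)) < x (k + q + m)"
    and lt: "\<And>m m'. 1 \<le> m \<Longrightarrow> m \<le> q \<Longrightarrow> 1 \<le> m' \<Longrightarrow> m' \<le> q \<Longrightarrow> x (k + m) < x (k + q + m')"
    and m: "1 \<le> m" "m \<le> q"
  shows "y (k + m) < y (k + q + m)"
proof -
  let ?A = "\<lambda>x. map x [Suc k..<Suc k + q]" and ?B = "\<lambda>x. map x [Suc (k + q)..<Suc (k + q) + q]"
  have "is_word z k (?A z @ ?B z)" for z
  proof -
    have "k + length (?A z) = k + q" by simp
    then show ?thesis using is_word_map[of z k q] is_word_map[of z "k + q" q] by (simp only: is_word_append simp_thms)
  qed
  then have "word_rel n (?A x @ ?B x) (?A y @ ?B y)"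
    using xy k unfolding word_rel_def by (intro exI[of _ x] exI[of _ y] exI[of _ k]) auto
  then have "list_all2 (<) (?A y) (?B y)"
  proof (rule word_rel_two_columns)
    show "sorted_wrt (>) (?A x)"
    proof (rule sorted_wrt_greater_map_upt)
      fix i assume "Suc k \<le> i" "Suc i < Suc k + q"
      then show "x (Suc i) < x i" using d1[of "i - k"] by simp
    qed
    show "sorted_wrt (>) (?B x)"
    proof (rule sorted_wrt_greater_map_upt)
      fix i assume "Suc (k + q) \<le> i" "Suc i < Suc (k + q) + q"
      then show "x (Suc i) < x i" using d2[of "i - (k + q)"] by simp
    qed
    show "\<forall>a\<in>set (?A x). \<forall>b\<in>set (?B x). a < b"
    proof -
      have "x i < x j" if "Suc k \<le> i" "i < Suc k + q" "Suc (k + q) \<le> j" "j < Suc (k + q) + q" for i j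
        using lt[of "i - k" "j - (k + q)"] that by simp
      then show ?thesis by auto
    qed
  qed simp_all
  from list_all2_nthD[OF this, of "m - 1"] have "?A y ! (m - 1) < ?B y ! (m - 1)"
    using m by (simp del: upt_Suc)
  moreover have "?A y ! (m - 1) = y (k + m)" "?B y ! (m - 1) = y (k + q + m)"
    using m by (simp_all del: upt_Suc)
  ultimately show ?thesis by simp
qed

section \<open>Tableaux\<close>

lemma downclosed_eq_atLeastAtMost:
  assumes "finite S" "0 \<notin> S" and down: "\<And>i j. i \<in> S \<Longrightarrow> 1 \<le> j \<Longrightarrow> j \<le> i \<Longrightarrow> j \<in> S"
  shows "S = {1..card S}"
proof (cases "S = {}")
  case False
  have "S = {1..Max S}"
  proof
    show "S \<subseteq> {1..Max S}"
    proof
      fix i assume "i \<in> S"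
      then show "i \<in> {1..Max S}" using assms(1,2) by (cases i) auto
    qed
    show "{1..Max S} \<subseteq> S" using down[OF Max_in[OF assms(1) False]] by auto
  qed
  then show ?thesis by (metis card_atLeastAtMost add_diff_cancel_right' Suc_eq_plus1)
qed simp

lemma strictly_decreasing_forced:
  fixes g :: "nat \<Rightarrow> nat"
  assumes r: "\<And>i. 1 \<le> i \<Longrightarrow> i \<le> c \<Longrightarrow> 1 \<le> g i \<and> g i \<le> c"
    and d: "\<And>i. 1 \<le> i \<Longrightarrow> i < c \<Longrightarrow> g (Suc i) < g i" and i: "1 \<le> i" "i \<le> c"
  shows "g i = c + 1 - i"
proof -
  have "g (Suc j) + j \<le> c" if "Suc j \<le> c" for j
    using that
  proof (induction j)
    case 0 then show ?case using r[of 1] by simp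
  next
    case (Suc j) then show ?case using d[of "Suc j"] by simp
  qed
  from this[of "i - 1"] have "g i + i \<le> c + 1" using i by simp
  moreover have "Suc j \<le> g (c - j)" if "j < c" for j
    using that
  proof (induction j)
    case 0 then show ?case using r[of c] by simp
  next
    case (Suc j)
    have "Suc (c - Suc j) = c - j" "1 \<le> c - Suc j" using Suc.prems by simp_all
    then have "g (c - j) < g (c - Suc j)" using d[of "c - Suc j"] by simp
    then show ?case using Suc by simp
  qed
  from this[of "c - i"] have "c + 1 \<le> g i + i" using i by simp
  ultimately show ?thesis by simp
qed

text \<open>Numbering cells by partial sums of row or column lengths is lexicographic; both
  reference tableaux are of this form.\<close>

lemma partial_sums_lex:
  fixes L :: "nat \<Rightarrow> nat"
  assumes "1 \<le> a" "a < a'" "b \<le> L a" "1 \<le> b'"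
  shows "(\<Sum>k = 1..<a. L k) + b < (\<Sum>k = 1..<a'. L k) + b'"
proof -
  have "(\<Sum>k = 1..<a. L k) + L a = (\<Sum>k = 1..<Suc a. L k)" using assms(1) by simp
  also have "\<dots> \<le> (\<Sum>k = 1..<a'. L k)" using assms(2) by (intro sum_mono2) auto
  finally show ?thesis using assms by linarith
qed

locale partition =
  fixes n :: nat and lam :: "nat list"
  assumes part: "is_partition n lam"
begin

abbreviation D :: "(nat \<times> nat) set" where "D \<equiv> diagram lam"
abbreviation t :: "nat \<times> nat \<Rightarrow> nat" where "t \<equiv> col_tableau lam"
abbreviation c :: "nat \<Rightarrow> nat" where "c \<equiv> col_len lam"

lemma D_pos: "(i, j) \<in> D \<Longrightarrow> 1 \<le> i \<and> 1 \<le> j"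
  by (auto simp: diagram_def)

lemma D_down:
  assumes "(i, j) \<in> D" "1 \<le> i'" "i' \<le> i" "1 \<le> j'" "j' \<le> j"
  shows "(i', j') \<in> D"
proof -
  have "lam ! (i - 1) \<le> lam ! (i' - 1)"
  proof (cases "i' = i")
    case False
    then have "i' - 1 < i - 1" "i - 1 < length lam" using assms by (auto simp: diagram_def)
    then show ?thesis using part by (auto simp: is_partition_def sorted_wrt_iff_nth_less)
  qed simp
  then show ?thesis using assms by (auto simp: diagram_def)
qed

lemma D_eq: "D = (SIGMA i:{1..length lam}. {1..lam ! (i - 1)})"
  by (auto simp: diagram_def)

lemma finite_D: "finite D"
  by (simp add: D_eq)

lemma card_D: "card D = n"
proof -
  have "card D = (\<Sum>i\<in>{1..length lam}. lam ! (i - 1))" unfolding D_eq by simp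
  also have "\<dots> = (\<Sum>i = 0..<length lam. lam ! i)"
    by (rule sum.reindex_bij_witness[of _ Suc "\<lambda>i. i - 1"]) auto
  also have "\<dots> = sum_list lam" by (simp add: sum_list_sum_nth)
  finally show ?thesis using part by (simp add: is_partition_def)
qed

lemma mem_D_col: "(i, j) \<in> D \<longleftrightarrow> 1 \<le> i \<and> i \<le> c j"
proof -
  let ?S = "{i. (i, j) \<in> D}"
  have "?S \<subseteq> fst ` D" by force
  then have "finite ?S" using finite_D finite_surj by blast
  then have "?S = {1..card ?S}"
  proof (rule downclosed_eq_atLeastAtMost)
    show "0 \<notin> ?S" using D_pos by auto
    show "b \<in> ?S" if "a \<in> ?S" "1 \<le> b" "b \<le> a" for a b
      using that D_pos D_down[of a j b j] by blast
  qed
  then have "i \<in> ?S \<longleftrightarrow> i \<in> {1..card ?S}" by simp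
  then show ?thesis by (simp add: col_len_def)
qed

lemma mem_D_row: "(i, j) \<in> D \<longleftrightarrow> 1 \<le> j \<and> j \<le> row_len lam i"
proof -
  let ?S = "{j. (i, j) \<in> D}"
  have "?S \<subseteq> snd ` D" by force
  then have "finite ?S" using finite_D finite_surj by blast
  then have "?S = {1..card ?S}"
  proof (rule downclosed_eq_atLeastAtMost)
    show "0 \<notin> ?S" using D_pos by auto
    show "b \<in> ?S" if "a \<in> ?S" "1 \<le> b" "b \<le> a" for a b
      using that D_pos D_down[of i a i b] by blast
  qed
  then have "j \<in> ?S \<longleftrightarrow> j \<in> {1..card ?S}" by simp
  then show ?thesis by (simp add: row_len_def)
qed

lemma t_eq: "t (i, j) = (\<Sum>k = 1..<j. c k) + i"
  by (simp add: col_tableau_def)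

lemma t_less:
  assumes "(i, j) \<in> D" "(i', j') \<in> D" "j < j' \<or> j = j' \<and> i < i'"
  shows "t (i, j) < t (i', j')"
proof (cases "j = j'")
  case False
  then show ?thesis
    unfolding t_eq using assms D_pos[OF assms(1)] mem_D_col[of i j] mem_D_col[of i' j']
    by (intro partial_sums_lex) auto
qed (use assms in \<open>simp add: t_eq\<close>)

lemma row_less:
  assumes "(i, j) \<in> D" "(i', j') \<in> D" "i < i' \<or> i = i' \<and> j < j'"
  shows "row_tableau lam (i, j) < row_tableau lam (i', j')"
proof (cases "i = i'")
  case False
  then have "(\<Sum>k = 1..<i. row_len lam k) + j < (\<Sum>k = 1..<i'. row_len lam k) + j'"
    using assms D_pos[OF assms(1)] mem_D_row[of i j] mem_D_row[of i' j']
    by (intro partial_sums_lex) auto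
  then show ?thesis by (simp add: row_tableau_def)
qed (use assms in \<open>simp add: row_tableau_def\<close>)

lemma t_inj: "inj_on t D"
proof (rule inj_onI)
  fix p q assume pq: "p \<in> D" "q \<in> D" "t p = t q"
  obtain i j i' j' where e: "p = (i, j)" "q = (i', j')" by (cases p, cases q)
  then consider "j < j' \<or> j = j' \<and> i < i'" | "j' < j \<or> j' = j \<and> i' < i" | "p = q" by fastforce
  then show "p = q"
  proof cases
    case 1 then show ?thesis using t_less[of i j i' j'] pq e by auto
  next
    case 2 then show ?thesis using t_less[of i' j' i j] pq e by auto
  qed
qed

lemma t_le: 
  assumes "(i, j) \<in> D"
  shows "1 \<le> t (i, j)" "t (i, j) \<le> n" "(\<Sum>k = 1..<j. c k) + c j \<le> n"
proof -
  have j: "1 \<le> j" "1 \<le> i" "i \<le> c j" using D_pos[OF assms] assms mem_D_col by auto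
  have "(\<Sum>k = 1..<j. c k) + c j = (\<Sum>k\<in>{1..j}. card {1..c k})"
    using j(1) by (simp add: atLeastLessThanSuc_atLeastAtMost[symmetric] del: atLeastLessThanSuc_atLeastAtMost)
  also have "\<dots> = card (SIGMA k:{1..j}. {1..c k})" by (rule card_SigmaI[symmetric]) auto
  also have "\<dots> = card (prod.swap ` (SIGMA k:{1..j}. {1..c k}))" by (rule card_image[symmetric]) auto
  also have "\<dots> \<le> card D" by (rule card_mono[OF finite_D]) (auto simp: mem_D_col)
  finally show "(\<Sum>k = 1..<j. c k) + c j \<le> n" by (simp add: card_D)
  then show "1 \<le> t (i, j)" "t (i, j) \<le> n" using j by (auto simp: t_eq)
qed

lemma t_bij: "bij_betw t D {1..n}"
proof -
  have "t ` D \<subseteq> {1..n}" using t_le by auto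
  moreover have "card (t ` D) = n" using card_image[OF t_inj] card_D by simp
  ultimately have "t ` D = {1..n}" by (intro card_subset_eq) auto
  then show ?thesis using t_inj by (simp add: bij_betw_def)
qed

lemma t_surj: assumes "1 \<le> a" "a \<le> n" obtains i j where "(i, j) \<in> D" "a = t (i, j)"
proof -
  have "a \<in> t ` D" using t_bij assms by (simp add: bij_betw_def)
  then show ?thesis using that by auto
qed

lemma t_less_iff:
  assumes "(i, j) \<in> D" "(i', j') \<in> D"
  shows "t (i, j) < t (i', j') \<longleftrightarrow> j < j' \<or> j = j' \<and> i < i'"
proof
  assume l: "t (i, j) < t (i', j')"
  show "j < j' \<or> j = j' \<and> i < i'"
  proof (rule ccontr)
    assume "\<not> ?thesis"
    then have "j' < j \<or> j' = j \<and> i' < i \<or> (i, j) = (i', j')" by auto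
    then show False using t_less[OF assms(2,1)] l by auto
  qed
qed (use t_less[OF assms] in blast)

definition standard :: "perm \<Rightarrow> bool" where
  "standard v \<longleftrightarrow> v \<in> Sym n \<and> (\<forall>i j i' j'. (i, j) \<in> D \<longrightarrow> (i', j') \<in> D \<longrightarrow> i \<le> i' \<longrightarrow> j \<le> j' \<longrightarrow>
     (i, j) \<noteq> (i', j') \<longrightarrow> v (t (i, j)) < v (t (i', j')))"

lemma standardD:
  "standard v \<Longrightarrow> (i, j) \<in> D \<Longrightarrow> (i', j') \<in> D \<Longrightarrow> i \<le> i' \<Longrightarrow> j \<le> j' \<Longrightarrow>
     (i, j) \<noteq> (i', j') \<Longrightarrow> v (t (i, j)) < v (t (i', j'))"
  unfolding standard_def by blast

lemma standard_Sym: "standard v \<Longrightarrow> v \<in> Sym n"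
  by (simp add: standard_def)

lemma standardI:
  assumes v: "v \<in> Sym n"
    and down: "\<And>i j. (i, j) \<in> D \<Longrightarrow> (Suc i, j) \<in> D \<Longrightarrow> v (t (i, j)) < v (t (Suc i, j))"
    and right: "\<And>i j. (i, j) \<in> D \<Longrightarrow> (i, Suc j) \<in> D \<Longrightarrow> v (t (i, j)) < v (t (i, Suc j))"
  shows "standard v"
proof -
  have d: "(i, j) \<in> D \<Longrightarrow> (i + k, j) \<in> D \<Longrightarrow> v (t (i, j)) \<le> v (t (i + k, j)) \<and> (0 < k \<longrightarrow> v (t (i, j)) < v (t (i + k, j)))" for i j k
  proof (induction k)
    case (Suc k)
    have "(i + k, j) \<in> D" using D_down[OF Suc.prems(2)] D_pos[OF Suc.prems(1)] by simp
    then show ?case using Suc down[of "i + k" j] by fastforce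
  qed simp
  have r: "(i, j) \<in> D \<Longrightarrow> (i, j + k) \<in> D \<Longrightarrow> v (t (i, j)) \<le> v (t (i, j + k)) \<and> (0 < k \<longrightarrow> v (t (i, j)) < v (t (i, j + k)))" for i j k
  proof (induction k)
    case (Suc k)
    have "(i, j + k) \<in> D" using D_down[OF Suc.prems(2)] D_pos[OF Suc.prems(1)] by simp
    then show ?case using Suc right[of i "j + k"] by fastforce
  qed simp
  have "v (t (i, j)) < v (t (i', j'))"
    if *: "(i, j) \<in> D" "(i', j') \<in> D" "i \<le> i'" "j \<le> j'" "(i, j) \<noteq> (i', j')" for i j i' j'
  proof -
    have m: "(i', j) \<in> D" using D_down[OF *(2)] D_pos[OF *(1)] D_pos[OF *(2)] *(4) by simp
    show ?thesis using d[of i j "i' - i"] r[of i' j "j' - j"] * m by fastforce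
  qed
  then show ?thesis unfolding standard_def using v by blast
qed

lemma standard_id: "standard id"
  by (rule standardI[OF Sym_id]) (auto intro: t_less)

text \<open>The inversions of \<open>v_lam\<close> are the pairs of cells that come in opposite
  orders by columns and by rows. Standardness of \<open>v\<close> forbids inverting any other pair,
  so the weak order, read as containment of inversion sets, says the same.\<close>

lemma standard_iff_weak_interval:
  assumes vl: "v_lam \<in> Sym n" and vt: "\<forall>p \<in> D. (v_lam \<circ> t) p = row_tableau lam p" and v: "v \<in> Sym n"
  shows "v \<in> weak_interval n v_lam \<longleftrightarrow> standard v"
proof -
  have vt': "v_lam (t (i, j)) = row_tableau lam (i, j)" if "(i, j) \<in> D" for i j
    using vt that by simp
  have "inversions n v \<subseteq> inversions n v_lam \<longleftrightarrow> standard v"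
  proof
    assume sub: "inversions n v \<subseteq> inversions n v_lam"
    have *: "v (t p) < v (t q)" if pq: "p \<in> D" "q \<in> D" "t p < t q" "row_tableau lam p < row_tableau lam q" for p q
    proof -
      obtain i j i' j' where e: "p = (i, j)" "q = (i', j')" by (cases p, cases q)
      have b: "1 \<le> t p" "t q \<le> n" using t_le pq e by auto
      have "(t p, t q) \<notin> inversions n v_lam" using pq vt' e by (auto simp: inversions_def)
      then have "\<not> v (t q) < v (t p)" using sub pq(3) b by (auto simp: inversions_def)
      then show ?thesis using Sym_less_cases[OF v, of "t p" "t q"] pq(3) by auto
    qed
    show "standard v"
      by (rule standardI[OF v]) (auto intro!: * t_less row_less)
  next
    assume s: "standard v"
    show "inversions n v \<subseteq> inversions n v_lam"
    proof clarify
      fix a b assume "(a, b) \<in> inversions n v"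
      then have ab: "1 \<le> a" "a < b" "b \<le> n" "v b < v a" by (auto simp: inversions_def)
      obtain i j where p: "(i, j) \<in> D" "a = t (i, j)" using t_surj[of a] ab by auto
      obtain i' j' where q: "(i', j') \<in> D" "b = t (i', j')" using t_surj[of b] ab by auto
      have lex: "j < j' \<or> j = j' \<and> i < i'" using ab(2) t_less_iff[OF p(1) q(1)] p q by simp
      then have "\<not> i \<le> i'" using standardD[OF s p(1) q(1)] ab(4) p q by fastforce
      then have "v_lam b < v_lam a" using row_less[OF q(1) p(1)] vt' p q by simp
      then show "(a, b) \<in> inversions n v_lam" using ab by (simp add: inversions_def)
    qed
  qed
  then show ?thesis using left_weak_le_iff_inversions[OF v vl] v by (simp add: weak_interval_def)
qed

subsection \<open>The longest element of the column stabiliser\<close>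

lemma col_simples_iff:
  "s \<in> col_simples lam \<longleftrightarrow> (\<exists>i j. (i, j) \<in> D \<and> (Suc i, j) \<in> D \<and> s = simple (t (i, j)))"
proof
  assume "s \<in> col_simples lam"
  then obtain i i' j where "(i, j) \<in> D" "(i', j) \<in> D" "t (i', j) = Suc (t (i, j))" "s = simple (t (i, j))"
    by (auto simp: col_simples_def)
  moreover from this have "i' = Suc i" by (simp add: t_eq)
  ultimately show "\<exists>i j. (i, j) \<in> D \<and> (Suc i, j) \<in> D \<and> s = simple (t (i, j))" by blast
next
  assume "\<exists>i j. (i, j) \<in> D \<and> (Suc i, j) \<in> D \<and> s = simple (t (i, j))"
  then obtain i j where ij: "(i, j) \<in> D" "(Suc i, j) \<in> D" "s = simple (t (i, j))" by blast
  moreover have "t (Suc i, j) = Suc (t (i, j))" by (simp add: t_eq)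
  ultimately show "s \<in> col_simples lam"
    unfolding col_simples_def by (intro CollectI exI[of _ "t (i, j)"]) blast
qed

lemma col_simples_subset: "col_simples lam \<subseteq> simples n"
proof
  fix s assume "s \<in> col_simples lam"
  then obtain i j where ij: "(i, j) \<in> D" "(Suc i, j) \<in> D" "s = simple (t (i, j))"
    using col_simples_iff by blast
  have "t (i, j) < t (Suc i, j)" using ij by (intro t_less) auto
  then show "s \<in> simples n" using t_le ij by (fastforce simp: simples_def)
qed

lemma parabolic_Sym: "w \<in> parabolic (col_simples lam) \<Longrightarrow> w \<in> Sym n"
  using word_prod_Sym col_simples_subset by (auto simp: parabolic_def)

lemma parabolic_column:
  assumes "w \<in> parabolic (col_simples lam)" "(i, j) \<in> D"
  shows "\<exists>i'. (i', j) \<in> D \<and> w (t (i, j)) = t (i', j)"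
proof -
  have "\<exists>i'. (i', j) \<in> D \<and> word_prod ss (t (i, j)) = t (i', j)" if "set ss \<subseteq> col_simples lam" for ss
    using that
  proof (induction ss)
    case Nil then show ?case using assms(2) by auto
  next
    case (Cons s ss)
    then obtain i' where i': "(i', j) \<in> D" "word_prod ss (t (i, j)) = t (i', j)" by auto
    obtain k l where kl: "(k, l) \<in> D" "(Suc k, l) \<in> D" "s = simple (t (k, l))"
      using Cons.prems col_simples_iff by auto
    have S: "t (Suc k, l) = Suc (t (k, l))" by (simp add: t_eq)
    have eq: "p = q" if "t p = t q" "p \<in> D" "q \<in> D" for p q using t_inj that by (auto simp: inj_on_def)
    consider "t (i', j) = t (k, l)" | "t (i', j) = t (Suc k, l)" | "t (i', j) \<noteq> t (k, l)" "t (i', j) \<noteq> Suc (t (k, l))"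
      using S by force
    then show ?case
    proof cases
      case 1
      then have "(i', j) = (k, l)" using eq kl i' by blast
      then show ?thesis using i' kl S by (intro exI[of _ "Suc k"]) (simp add: simple_def)
    next
      case 2
      then have "(i', j) = (Suc k, l)" using eq kl i' by blast
      then show ?thesis using i' kl S by (intro exI[of _ k]) (simp add: simple_def)
    next
      case 3
      then show ?thesis using i' kl by (intro exI[of _ i']) (simp add: simple_def)
    qed
  qed
  then show ?thesis using assms(1) by (auto simp: parabolic_def)
qed

end

locale column_longest = partition +
  fixes w_J :: perm
  assumes longest: "is_arg_max (len n) (\<lambda>w. w \<in> parabolic (col_simples lam)) w_J"
begin

lemma w_J_parabolic: "w_J \<in> parabolic (col_simples lam)"
  using longest by (simp add: is_arg_max_def)

lemma w_J_Sym: "w_J \<in> Sym n"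
  by (rule parabolic_Sym[OF w_J_parabolic])

text \<open>Multiplying by a generator of the column stabiliser stays inside it and, by maximality,
  does not lengthen; hence the generator is a right descent.\<close>

lemma w_J_decreasing:
  assumes "(i, j) \<in> D" "(Suc i, j) \<in> D"
  shows "w_J (t (Suc i, j)) < w_J (t (i, j))"
proof -
  let ?s = "simple (t (i, j))"
  have s: "?s \<in> col_simples lam" using assms col_simples_iff by blast
  obtain ss where ss: "set ss \<subseteq> col_simples lam" "w_J = word_prod ss"
    using w_J_parabolic by (auto simp: parabolic_def)
  have "w_J \<circ> ?s = word_prod (ss @ [?s])" using ss by (simp add: word_prod_append)
  then have "w_J \<circ> ?s \<in> parabolic (col_simples lam)"
    unfolding parabolic_def using s ss by (intro CollectI exI[of _ "ss @ [?s]"]) auto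
  then have "\<not> len n w_J < len n (w_J \<circ> ?s)" using longest by (auto simp: is_arg_max_def)
  moreover have "?s \<in> simples n" using s col_simples_subset by blast
  ultimately have l: "len n (w_J \<circ> ?s) < len n w_J" using len_right_cases[OF w_J_Sym, of ?s] by linarith
  have S: "t (Suc i, j) = Suc (t (i, j))" by (simp add: t_eq)
  have "1 \<le> t (i, j)" "t (i, j) < n" using t_le assms S by fastforce+
  then show ?thesis using len_comp_simple_less[OF w_J_Sym] l S by simp
qed

text \<open>\<open>w_J\<close> maps each column to itself and decreases along it, so it can only
  reverse the column.\<close>

lemma w_J_t:
  assumes "(i, j) \<in> D"
  shows "w_J (t (i, j)) = t (c j + 1 - i, j)"
proof -
  define b where "b = (\<Sum>k = 1..<j. c k)"
  have tb: "t (i, j) = b + i" for i by (simp add: t_eq b_def)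
  define g where "g = (\<lambda>i. w_J (b + i) - b)"
  have g: "w_J (b + i) = b + g i \<and> 1 \<le> g i \<and> g i \<le> c j" if "1 \<le> i" "i \<le> c j" for i
  proof -
    have "(i, j) \<in> D" using that mem_D_col by blast
    from parabolic_column[OF w_J_parabolic this] show ?thesis by (auto simp: tb g_def mem_D_col)
  qed
  have "g i = c j + 1 - i"
  proof (rule strictly_decreasing_forced[of "c j" g])
    show "1 \<le> g i \<and> g i \<le> c j" if "1 \<le> i" "i \<le> c j" for i using g that by blast
    show "g (Suc i) < g i" if "1 \<le> i" "i < c j" for i
      using w_J_decreasing[of i j] g[of i] g[of "Suc i"] that by (simp add: mem_D_col tb)
    show "1 \<le> i" "i \<le> c j" using assms mem_D_col by auto
  qed
  then show ?thesis using g[of i] assms mem_D_col by (simp add: tb)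
qed

lemma reflect_D: "(i, j) \<in> D \<Longrightarrow> (c j + 1 - i, j) \<in> D"
  by (auto simp: mem_D_col)

lemma w_J_t': "(i, j) \<in> D \<Longrightarrow> w_J (t (c j + 1 - i, j)) = t (i, j)"
  using w_J_t[OF reflect_D, of i j] by (auto simp: mem_D_col)

lemma inv_w_J_t: "(i, j) \<in> D \<Longrightarrow> inv w_J (t (i, j)) = t (c j + 1 - i, j)"
  using w_J_t'[of i j] Sym_inv_eq(2)[OF w_J_Sym] by metis

lemma cell_imp_standard:
  assumes e: "cell_equiv n w_J u"
  shows "standard (u \<circ> inv w_J)"
proof (rule standardI)
  have u: "u \<in> Sym n" using e by (simp add: cell_equiv_def)
  show "u \<circ> inv w_J \<in> Sym n" by (intro Sym_comp u Sym_inv w_J_Sym)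
  have v: "(u \<circ> inv w_J) (t (i, j)) = u (t (c j + 1 - i, j))" if "(i, j) \<in> D" for i j
    using inv_w_J_t[OF that] by simp
  show "(u \<circ> inv w_J) (t (i, j)) < (u \<circ> inv w_J) (t (Suc i, j))" if ij: "(i, j) \<in> D" "(Suc i, j) \<in> D" for i j
  proof -
    \<comment> \<open>Columns are read upwards: this is the position of the entry of row i + 1, and
      the entry of row i follows it.\<close>
    let ?k = "t (c j - i, j)"
    have r: "1 \<le> i" "Suc i \<le> c j" using ij mem_D_col by auto
    have k: "(c j - i, j) \<in> D" "(Suc (c j - i), j) \<in> D" using r by (auto simp: mem_D_col)
    have S: "t (Suc (c j - i), j) = Suc ?k" by (simp add: t_eq)
    have "w_J (Suc ?k) < w_J ?k" using w_J_decreasing[OF k] S by simp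
    moreover have "1 \<le> ?k" "?k < n" using t_le k S by fastforce+
    ultimately have "u (Suc ?k) < u ?k" using cell_equiv_right_descent[OF e] by blast
    moreover have "c j + 1 - i = Suc (c j - i)" "c j + 1 - Suc i = c j - i" using r by auto
    ultimately show ?thesis using v[OF ij(1)] v[OF ij(2)] S by simp
  qed
  show "(u \<circ> inv w_J) (t (i, j)) < (u \<circ> inv w_J) (t (i, Suc j))" if ij: "(i, j) \<in> D" "(i, Suc j) \<in> D" for i j
  proof -
    define b where "b = (\<Sum>k = 1..<j. c k)"
    define p q where "p = c j" and "q = c (Suc j)"
    have j: "1 \<le> j" using D_pos ij by blast
    have i: "1 \<le> i" "i \<le> q" using ij mem_D_col by (auto simp: q_def)
    have "(q, Suc j) \<in> D" using i by (simp add: mem_D_col q_def)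
    then have "(q, j) \<in> D" using D_down i j by (meson le_SucI order_refl order_trans)
    then have qp: "q \<le> p" by (simp add: mem_D_col p_def)
    have b: "t (i, j) = b + i" "t (i, Suc j) = b + p + i" for i
      using j by (simp_all add: t_eq b_def p_def)
    have Dj: "(m, j) \<in> D \<longleftrightarrow> 1 \<le> m \<and> m \<le> p" "(m, Suc j) \<in> D \<longleftrightarrow> 1 \<le> m \<and> m \<le> q" for m
      by (simp_all add: mem_D_col p_def q_def)
    have w: "w_J (b + m) = b + (p + 1 - m)" if "1 \<le> m" "m \<le> p" for m
      using w_J_t[of m j] that by (simp add: Dj b p_def)
    have w': "w_J (b + p + m) = b + p + (q + 1 - m)" if "1 \<le> m" "m \<le> q" for m
      using w_J_t[of m "Suc j"] that by (simp add: Dj b q_def)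
    \<comment> \<open>The bottom \<open>p - q\<close> cells of the longer column are read first and
      have no right neighbour. Skipping them leaves two columns of height \<open>q\<close> side by
      side.\<close>
    define k where "k = b + (p - q)"
    have kp: "k + q = b + p" using qp by (simp add: k_def)
    \<comment> \<open>Row \<open>i\<close> counted from the bottom of the remaining columns.\<close>
    let ?m = "q + 1 - i"
    have "u (k + ?m) < u (k + q + ?m)"
    proof (rule cell_equiv_two_columns[OF e])
      show "k + 2 * q \<le> n"
        using t_le(2)[of q "Suc j"] i kp by (simp add: Dj b)
      show "w_J (Suc (k + m)) < w_J (k + m)" if m: "1 \<le> m" "m < q" for m
        using w[of "p - q + m"] w[of "Suc (p - q + m)"] m qp by (simp add: k_def add.assoc)
      show "w_J (Suc (k + q + m)) < w_J (k + q + m)" if m: "1 \<le> m" "m < q" for m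
        using w'[of m] w'[of "Suc m"] m by (simp add: kp)
      show "w_J (k + m) < w_J (k + q + m')" if m: "1 \<le> m" "m \<le> q" "1 \<le> m'" "m' \<le> q" for m m'
        using w[of "p - q + m"] w'[of m'] m qp by (simp add: kp) (simp add: k_def add.assoc)
    qed (use i in auto)
    moreover have "k + ?m = t (p + 1 - i, j)" "k + q + ?m = t (q + 1 - i, Suc j)"
      using i qp by (simp_all add: b kp k_def)
    ultimately show ?thesis using v[OF ij(1)] v[OF ij(2)] by (simp add: p_def q_def)
  qed
qed

subsection \<open>Standard tableaux are connected by dual Knuth moves\<close>

text \<open>The values a + 1, a, a + 2 occur in this order. Exchanging the outer two trades the left
  descent at \<open>a\<close> for one at a + 1.\<close>

lemma cell_equiv_dual_knuth_values:
  assumes x: "x \<in> Sym n" and a: "1 \<le> a" "Suc (Suc a) \<le> n"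
    and p: "inv x (Suc a) < inv x a" "inv x a < inv x (Suc (Suc a))"
  shows "cell_equiv n x (simple (Suc a) \<circ> x)"
proof -
  have s: "simple (Suc a) \<in> simples n" "simple a \<in> simples n" using a by (auto simp: simples_def)
  have y: "simple (Suc a) \<circ> x \<in> Sym n" by (rule Sym_comp[OF simples_Sym[OF s(1)] x])
  have i: "inv (simple (Suc a) \<circ> x) k = inv x (simple (Suc a) k)" for k
    using simples_comp_inv(1)[OF x s(1)] by simp
  have "\<not> len n (simple (Suc a) \<circ> x) < len n x"
    using len_simple_comp_less[OF x, of "Suc a"] a p by simp
  then have up: "len n x < len n (simple (Suc a) \<circ> x)" using len_left_cases[OF x s(1)] by linarith
  have d: "len n (simple a \<circ> x) < len n x" using len_simple_comp_less[OF x, of a] a p by simp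
  have nd: "\<not> len n (simple a \<circ> (simple (Suc a) \<circ> x)) < len n (simple (Suc a) \<circ> x)"
    using len_simple_comp_less[OF y, of a] a p by (simp add: i) (simp add: simple_def)
  show ?thesis by (rule cell_equiv_dual_knuth[OF x s up d nd])
qed

end

text \<open>Ranks compress the values on a finite set to an initial segment in the same order; they
  refill the unaffected cells in the corner exchange.\<close>

lemma card_rank_bij:
  fixes g :: "'a \<Rightarrow> nat"
  assumes "finite S" "inj_on g S"
  defines "r \<equiv> (\<lambda>e. card {x \<in> S. g x \<le> g e})"
  shows "\<And>e e'. e \<in> S \<Longrightarrow> e' \<in> S \<Longrightarrow> g e < g e' \<Longrightarrow> r e < r e'"
    and "\<And>e. e \<in> S \<Longrightarrow> 1 \<le> r e \<and> r e \<le> card S" and "inj_on r S"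
proof -
  show m: "r e < r e'" if "e \<in> S" "e' \<in> S" "g e < g e'" for e e'
  proof -
    have "e' \<in> {x \<in> S. g x \<le> g e'} - {x \<in> S. g x \<le> g e}" using that by auto
    moreover have "{x \<in> S. g x \<le> g e} \<subseteq> {x \<in> S. g x \<le> g e'}" using that by auto
    ultimately have "{x \<in> S. g x \<le> g e} \<subset> {x \<in> S. g x \<le> g e'}" by blast
    then show ?thesis unfolding r_def using assms(1) by (intro psubset_card_mono) auto
  qed
  show "1 \<le> r e \<and> r e \<le> card S" if "e \<in> S" for e
  proof
    have "{e} \<subseteq> {x \<in> S. g x \<le> g e}" using that by auto
    from card_mono[OF _ this] show "1 \<le> r e" using assms(1) by (simp add: r_def)
    show "r e \<le> card S" unfolding r_def using assms(1) by (intro card_mono) auto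
  qed
  show "inj_on r S"
  proof (rule inj_onI)
    fix e e' assume "e \<in> S" "e' \<in> S" "r e = r e'"
    then have "g e = g e'" using m[of e e'] m[of e' e] by (metis less_irrefl linorder_neqE_nat)
    then show "e = e'" using assms(2) \<open>e \<in> S\<close> \<open>e' \<in> S\<close> by (auto simp: inj_on_def)
  qed
qed

section \<open>Refilling tableaux and exchanging corners\<close>

context column_longest
begin

definition below :: "nat \<times> nat \<Rightarrow> nat \<times> nat \<Rightarrow> bool" where
  "below p q \<longleftrightarrow> fst p \<le> fst q \<and> snd p \<le> snd q"

lemma below_trans: "below p q \<Longrightarrow> below q r \<Longrightarrow> below p r"
  by (auto simp: below_def)

lemma below_antisym: "below p q \<Longrightarrow> below q p \<Longrightarrow> p = q"
  by (auto simp: below_def prod_eq_iff)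

lemma standard_below: "standard v \<Longrightarrow> p \<in> D \<Longrightarrow> q \<in> D \<Longrightarrow> below p q \<Longrightarrow> p \<noteq> q \<Longrightarrow> v (t p) < v (t q)"
  using standardD[of v "fst p" "snd p" "fst q" "snd q"] by (simp add: below_def)

lemma standard_belowI:
  assumes "v \<in> Sym n" "\<And>p q. p \<in> D \<Longrightarrow> q \<in> D \<Longrightarrow> below p q \<Longrightarrow> p \<noteq> q \<Longrightarrow> v (t p) < v (t q)"
  shows "standard v"
  unfolding standard_def using assms by (auto simp: below_def)

lemma t_range: "p \<in> D \<Longrightarrow> 1 \<le> t p \<and> t p \<le> n"
  using t_le[of "fst p" "snd p"] by simp

lemma v_inj: "v \<in> Sym n \<Longrightarrow> p \<in> D \<Longrightarrow> q \<in> D \<Longrightarrow> v (t p) = v (t q) \<longleftrightarrow> p = q"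
  using Sym_inj[of v n] t_inj by (auto simp: inj_on_def)

lemma v_range: "v \<in> Sym n \<Longrightarrow> p \<in> D \<Longrightarrow> 1 \<le> v (t p) \<and> v (t p) \<le> n"
  using Sym_range[of v n "t p"] t_range by simp

lemma v_image: "v \<in> Sym n \<Longrightarrow> v ` t ` D = {1..n}"
proof -
  assume "v \<in> Sym n"
  moreover have "t ` D = {1..n}" using t_bij by (simp add: bij_betw_def)
  ultimately show ?thesis by (simp only: Sym_def mem_Collect_eq permutes_image)
qed

lemma v_image_Diff:
  assumes "v \<in> Sym n" "F \<subseteq> E" "E \<subseteq> D"
  shows "v ` t ` (E - F) = v ` t ` E - v ` t ` F"
proof -
  have "inj_on (\<lambda>p. v (t p)) D" using v_inj[OF assms(1)] by (meson inj_onI)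
  from inj_on_image_set_diff[OF this, of E F] show ?thesis using assms by (auto simp only: image_image)
qed

lemma perm_of_filling:
  assumes inj: "inj_on f D" and range: "\<And>p. p \<in> D \<Longrightarrow> 1 \<le> f p \<and> f p \<le> n"
  obtains v where "v \<in> Sym n" "\<And>p. p \<in> D \<Longrightarrow> v (t p) = f p"
proof -
  define v where "v = (\<lambda>m. if m \<in> {1..n} then f (inv_into D t m) else m)"
  have vt: "v (t p) = f p" if "p \<in> D" for p
    using that t_range[OF that] inv_into_f_f[OF t_inj that] by (simp add: v_def)
  have "f ` D \<subseteq> {1..n}" using range by auto
  moreover have "card (f ` D) = n" using card_image[OF inj] card_D by simp
  ultimately have "f ` D = {1..n}" by (intro card_subset_eq) auto
  then have f: "bij_betw f D {1..n}" using inj by (simp add: bij_betw_def)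
  have "bij_betw (f \<circ> inv_into D t) {1..n} {1..n}"
    by (rule bij_betw_trans[OF bij_betw_inv_into[OF t_bij] f])
  then have "bij_betw v {1..n} {1..n}"
    by (subst bij_betw_cong[of _ _ "f \<circ> inv_into D t"]) (auto simp: v_def)
  then have "v permutes {1..n}" by (rule bij_imp_permutes) (auto simp: v_def)
  then show ?thesis using that vt by (simp add: Sym_def)
qed

definition downclosed :: "(nat \<times> nat) set \<Rightarrow> bool" where
  "downclosed E \<longleftrightarrow> E \<subseteq> D \<and> (\<forall>p \<in> E. \<forall>q \<in> D. below q p \<longrightarrow> q \<in> E)"

text \<open>The hypotheses on rows and columns say that the cell of a + 1 is read before that of a,
  and that of a + 2 last; if the first two share a column, the lower one is read first.\<close>

lemma dual_knuth_step:
  assumes x: "standard x" and a: "1 \<le> a" "Suc (Suc a) \<le> n"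
    and cells: "(i, j) \<in> D" "(i1, j1) \<in> D" "(i2, j2) \<in> D"
    and val: "x (t (i, j)) = a" "x (t (i1, j1)) = Suc (Suc a)" "x (t (i2, j2)) = Suc a"
    and pos: "i < i2" "j2 \<le> j" "j < j1"
  shows "cell_equiv n (x \<circ> w_J) (simple (Suc a) \<circ> x \<circ> w_J)"
proof -
  have S: "x \<in> Sym n" "x \<circ> w_J \<in> Sym n" using x Sym_comp w_J_Sym by (auto simp: standard_def)
  have i: "inv (x \<circ> w_J) m = t (c l + 1 - k, l)" if "(k, l) \<in> D" "x (t (k, l)) = m" for k l m
  proof -
    have "(x \<circ> w_J) (t (c l + 1 - k, l)) = m" using w_J_t'[OF that(1)] that(2) by simp
    then show ?thesis using Sym_inv_eq(2)[OF S(2)] by metis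
  qed
  have "t (c j2 + 1 - i2, j2) < t (c j + 1 - i, j)"
    using pos cells by (intro t_less reflect_D) (auto simp: mem_D_col)
  moreover have "t (c j + 1 - i, j) < t (c j1 + 1 - i1, j1)"
    using pos cells by (intro t_less reflect_D) auto
  ultimately have "cell_equiv n (x \<circ> w_J) (simple (Suc a) \<circ> (x \<circ> w_J))"
    using i[OF cells(1) val(1)] i[OF cells(2) val(2)] i[OF cells(3) val(3)]
    by (intro cell_equiv_dual_knuth_values S a) auto
  then show ?thesis by (simp only: o_assoc)
qed

text \<open>
  Suppose that the largest of the entries \<open>1, \<dots>, k\<close> filling \<open>E\<close> sits in the corner \<open>p\<close> for \<open>v\<close> and
  in the lower corner \<open>p'\<close> for \<open>v'\<close>. There is a corner \<open>d\<close> of \<open>E - {p, p'}\<close> that is read between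
  them. Filling \<open>d, p, p'\<close> with \<open>k - 2, k - 1, k\<close> or \<open>k - 2, k, k - 1\<close> gives two tableaux which
  differ by a dual Knuth move, and each agrees with one of the given tableaux in one more corner.
\<close>

lemma corner_exchange:
  assumes E: "downclosed E" "card E = k" and v: "standard v" and im: "v ` t ` E = {1..k}"
    and p: "(r, l) \<in> E" "v (t (r, l)) = k"
    and p': "(r', l') \<in> E" "\<And>q. q \<in> E \<Longrightarrow> below (r', l') q \<Longrightarrow> q = (r', l')" and lt: "r < r'"
  obtains v1 v2 where "standard v1" "standard v2" "cell_equiv n (v1 \<circ> w_J) (v2 \<circ> w_J)"
    "\<And>q. q \<in> D - E \<Longrightarrow> v1 (t q) = v (t q)" "\<And>q. q \<in> D - E \<Longrightarrow> v2 (t q) = v (t q)"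
    "v2 (t (r', l')) = k" "v1 (t (r, l)) = k"
proof -
  let ?p = "(r, l)" and ?q = "(r', l')"
  have ED: "E \<subseteq> D" using E by (simp add: downclosed_def)
  have finE: "finite E" using ED finite_D finite_subset by blast
  have vS: "v \<in> Sym n" using v by (simp add: standard_def)
  have pmax: "e = ?p" if "e \<in> E" "below ?p e" for e
  proof (rule ccontr)
    assume "e \<noteq> ?p"
    then have "v (t ?p) < v (t e)"
      using standard_below[OF v subsetD[OF ED p(1)] subsetD[OF ED that(1)] that(2)] by blast
    moreover have "v (t e) \<in> {1..k}" using im that by auto
    ultimately show False using p by simp
  qed
  have pD: "?p \<in> D" "?q \<in> D" using p p' ED by auto
  have ne: "?p \<noteq> ?q" using lt by auto
  have l: "l' < l"
  proof (rule ccontr)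
    assume "\<not> l' < l"
    then have "below ?p ?q" using lt by (simp add: below_def)
    then show False using pmax p'(1) ne by auto
  qed
  define M where "M = E - {?p, ?q}"
  \<comment> \<open>The row of the upper corner meets the column of the lower one in a cell of
    \<open>E\<close> other than both, so there is a candidate for \<open>d\<close>.\<close>
  have mD: "(r, l') \<in> D" using D_down[OF pD(1)] D_pos[OF pD(1)] D_pos[OF pD(2)] l by auto
  have mE: "(r, l') \<in> M"
    using E(1) p(1) mD l lt by (auto simp: downclosed_def M_def below_def)
  let ?C = "{e \<in> M. below (r, l') e}"
  have finC: "finite ?C" "?C \<noteq> {}" using finE mE by (auto simp: M_def below_def)
  then have "Max ((\<lambda>e. v (t e)) ` ?C) \<in> (\<lambda>e. v (t e)) ` ?C" by (intro Max_in) auto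
  \<comment> \<open>The largest entry of \<open>?C\<close> is maximal in all of \<open>M\<close>,
    because a cell of \<open>M\<close> beyond \<open>d\<close> would again belong to
    \<open>?C\<close>.\<close>
  then obtain d where d: "d \<in> ?C" "v (t d) = Max ((\<lambda>e. v (t e)) ` ?C)" by auto
  have dE: "d \<in> E" "d \<noteq> ?p" "d \<noteq> ?q" "d \<in> D" using d ED by (auto simp: M_def)
  have dmax: "e = d" if "e \<in> M" "below d e" for e
  proof (rule ccontr)
    assume "e \<noteq> d"
    moreover have "e \<in> D" using that(1) ED by (auto simp: M_def)
    ultimately have "v (t d) < v (t e)" using standard_below[OF v dE(4) _ that(2)] by blast
    moreover have "e \<in> ?C" using that d below_trans by blast
    then have "v (t e) \<le> v (t d)" unfolding d(2) using finC by (intro Max_ge) auto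
    ultimately show False by simp
  qed
  obtain i j where ij: "d = (i, j)" by (cases d)
  have b: "r \<le> i" "l' \<le> j" using d ij by (auto simp: below_def)
  have i: "i < r'"
  proof (rule ccontr)
    assume "\<not> i < r'"
    then have "below ?q d" using b ij by (simp add: below_def)
    then show False using p'(2) dE by blast
  qed
  have j: "j < l"
  proof (rule ccontr)
    assume "\<not> j < l"
    then have "below ?p d" using b ij by (simp add: below_def)
    then show False using pmax dE by blast
  qed
  define M' where "M' = M - {d}"
  have cE: "E = insert ?p (insert ?q (insert d M'))" using p p' dE by (auto simp: M'_def M_def)
  have finM': "finite M'" using finE by (simp add: M'_def M_def)
  have nin: "?p \<notin> insert ?q (insert d M')" "?q \<notin> insert d M'" "d \<notin> M'"
    using ne dE by (auto simp: M'_def M_def)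
  have ck: "k = card M' + 3" using E(2) finM' nin unfolding cE by simp
  let ?r = "\<lambda>e. card {x \<in> M'. v (t x) \<le> v (t e)}"
  have M'D: "M' \<subseteq> D" using ED by (auto simp: M'_def M_def)
  have "inj_on (\<lambda>e. v (t e)) M'" using v_inj[OF vS] M'D by (meson inj_onI subsetD)
  note rank = card_rank_bij[OF finM' this]
  have out: "k < v (t e) \<and> v (t e) \<le> n" if "e \<in> D - E" for e
  proof -
    have "v (t e) \<notin> v ` t ` E"
    proof
      assume "v (t e) \<in> v ` t ` E"
      then obtain e' where "e' \<in> E" "v (t e) = v (t e')" by blast
      then have "e = e'" using v_inj[OF vS, of e e'] that ED by blast
      then show False using that \<open>e' \<in> E\<close> by blast
    qed
    then show ?thesis using im v_range[OF vS, of e] that by auto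
  qed
  \<comment> \<open>\<open>x\<close> goes to the lower corner and \<open>y\<close> to the upper one.
    The remaining cells of \<open>E\<close> apart from \<open>d\<close> keep the relative order of
    \<open>v\<close>, compressed to the values below k - 2.\<close>
  define f where "f = (\<lambda>x y e. if e \<notin> E then v (t e) else if e = ?q then x else if e = ?p then y
    else if e = d then k - 2 else ?r e)"
  have f: "f x y ?p = y" "f x y ?q = x" "f x y d = k - 2" "e \<in> D - E \<Longrightarrow> f x y e = v (t e)"
    "e \<in> M' \<Longrightarrow> f x y e = ?r e" for x y e
    using p p' ne dE by (auto simp: f_def M'_def M_def)
  have fM': "1 \<le> f x y e \<and> f x y e < k - 2" if "e \<in> M'" for x y e
    using rank(2)[OF that] f(5)[OF that] ck by simp
  have cases: "e = ?p \<or> e = ?q \<or> e = d \<or> e \<in> M' \<or> e \<in> D - E" if "e \<in> D" for e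
    using that cE by auto
  have k: "3 \<le> k" "k \<le> n" using ck card_mono[OF finite_D ED] E(2) card_D by auto
  have mono: "f x y e < f x y e'" if xy: "{x, y} = {k - 1, k}" and e: "e \<in> D" "e' \<in> D" "below e e'" "e \<noteq> e'" for x y e e'
  proof -
    have xyk: "k - 2 < x" "k - 2 < y" "x \<le> k" "y \<le> k" using xy k by (auto simp: doubleton_eq_iff)
    from cases[OF e(2)] consider "e' = ?p" | "e' = ?q" | "e' = d" | "e' \<in> M'" | "e' \<in> D - E" by blast
    then show ?thesis
    proof cases
      case 5
      show ?thesis
      proof (cases "e \<in> E")
        case True
        then have "e = ?p \<or> e = ?q \<or> e = d \<or> e \<in> M'" using cE by auto
        then have "f x y e \<le> k" using f(1-3) fM'[of e x y] xyk by (auto simp del: One_nat_def)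
        then show ?thesis using out[OF 5] f(4)[OF 5] by simp
      next
        case False
        then show ?thesis using f(4) 5 e standard_below[OF v] by simp
      qed
    next
      case 1
      then have eE: "e \<in> E" using e E(1) p(1) by (auto simp: downclosed_def)
      moreover have "e \<noteq> ?q" using p'(2)[OF p(1)] e(3) 1 ne by auto
      ultimately have "e = d \<or> e \<in> M'" using cE e(4) 1 by auto
      then show ?thesis using f(1,3) fM'[of e x y] xyk 1 by auto
    next
      case 2
      then have eE: "e \<in> E" using e E(1) p'(1) by (auto simp: downclosed_def)
      moreover have "e \<noteq> ?p" using pmax[OF p'(1)] e(3) 2 ne by auto
      ultimately have "e = d \<or> e \<in> M'" using cE e(4) 2 by auto
      then show ?thesis using f(2,3) fM'[of e x y] xyk 2 by auto
    next
      case 3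
      then have eE: "e \<in> E" using e E(1) dE(1) by (auto simp: downclosed_def)
      moreover have "e \<noteq> ?p" "e \<noteq> ?q" using pmax[OF dE(1)] p'(2)[OF dE(1)] e(3) 3 dE by auto
      ultimately have "e \<in> M'" using cE e(4) 3 by auto
      then show ?thesis using f(3) fM'[of e x y] 3 by auto
    next
      case 4
      then have e'E: "e' \<in> E" "e' \<noteq> ?p" "e' \<noteq> ?q" "e' \<noteq> d" "e' \<in> M" by (auto simp: M'_def M_def)
      then have eE: "e \<in> E" using e E(1) by (auto simp: downclosed_def)
      moreover have "e \<noteq> ?p" "e \<noteq> ?q" "e \<noteq> d" using pmax p'(2) dmax e(3) e'E by blast+
      ultimately have eM: "e \<in> M'" using cE by auto
      have "v (t e) < v (t e')" using standard_below[OF v] e by blast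
      then show ?thesis using rank(1)[OF eM 4] f(5)[OF eM] f(5)[OF 4] by simp
    qed
  qed
  have range: "1 \<le> f x y e \<and> f x y e \<le> n" if xy: "{x, y} = {k - 1, k}" and e: "e \<in> D" for x y e
  proof -
    have xyk: "1 \<le> x" "1 \<le> y" "x \<le> k" "y \<le> k" using xy k by (auto simp: doubleton_eq_iff)
    from cases[OF e] consider "e = ?p" | "e = ?q" | "e = d" | "e \<in> M'" | "e \<in> D - E" by blast
    then show ?thesis
    proof cases
      case 1 then show ?thesis using xyk k f by auto
    next
      case 2 then show ?thesis using xyk k f by auto
    next
      case 3
      have "1 \<le> k - 2 \<and> k - 2 \<le> n" using k by linarith
      then show ?thesis using 3 by (simp only: f)
    next
      case 4 then show ?thesis using fM'[OF 4, of x y] k by linarith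
    next
      case 5 then show ?thesis using out[OF 5] f(4)[OF 5, of x y] by linarith
    qed
  qed
  have inj: "inj_on (f x y) D" if xy: "{x, y} = {k - 1, k}" for x y
  proof (rule inj_onI)
    fix e e' assume e: "e \<in> D" "e' \<in> D" "f x y e = f x y e'"
    have xyk: "k - 2 < x" "k - 2 < y" "x \<le> k" "y \<le> k" "x \<noteq> y" using xy k by (auto simp: doubleton_eq_iff)
    have o: "k < f x y e" if "e \<in> D - E" for e using out[OF that] f(4)[OF that] by simp
    have s: "f x y e \<le> k" if "e \<in> E" for e
    proof -
      from that cE consider "e = ?p" | "e = ?q" | "e = d" | "e \<in> M'" by blast
      then show ?thesis by cases (use f(1-3) fM'[of e x y] xyk in simp_all)
    qed
    consider "e \<in> D - E" "e' \<in> D - E" | "e \<in> M'" "e' \<in> M'"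
      | "e \<in> {?p, ?q, d}" "e' \<in> {?p, ?q, d}"
      | "e \<in> D - E" "e' \<in> E" | "e \<in> E" "e' \<in> D - E"
      | "e \<in> M'" "e' \<in> {?p, ?q, d}" | "e' \<in> M'" "e \<in> {?p, ?q, d}"
      using cases[OF e(1)] cases[OF e(2)] cE by blast
    then show "e = e'"
    proof cases
      case 1 then show ?thesis using f(4) e v_inj[OF vS] by simp
    next
      case 2 then show ?thesis using f(5) e rank(3) by (auto simp: inj_on_def)
    next
      case 3 then show ?thesis using f(1-3) e xyk by auto
    next
      case 4
      then show ?thesis using o[OF 4(1)] s[OF 4(2)] e by simp
    next
      case 5
      then show ?thesis using o[OF 5(2)] s[OF 5(1)] e by simp
    next
      case 6 then show ?thesis using f(1-3) fM'[of e x y] xyk e by auto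
    next
      case 7 then show ?thesis using f(1-3) fM'[of e' x y] xyk e by auto
    qed
  qed
  have ex: "\<exists>v1. standard v1 \<and> (\<forall>e \<in> D. v1 (t e) = f x y e)" if xy: "{x, y} = {k - 1, k}" for x y
  proof -
    obtain v1 where v1: "v1 \<in> Sym n" "\<And>e. e \<in> D \<Longrightarrow> v1 (t e) = f x y e"
      using perm_of_filling[OF inj[OF xy] range[OF xy]] by metis
    then have "standard v1" by (intro standard_belowI) (use mono[OF xy] in auto)
    then show ?thesis using v1 by blast
  qed
  obtain v1 where v1: "standard v1" "\<And>e. e \<in> D \<Longrightarrow> v1 (t e) = f (k - 1) k e" using ex[of "k - 1" k] by auto
  obtain v2 where v2: "standard v2" "\<And>e. e \<in> D \<Longrightarrow> v2 (t e) = f k (k - 1) e" using ex[of k "k - 1"] by auto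
  have sk: "k - 1 = Suc (k - 2)" "k = Suc (Suc (k - 2))" using k by auto
  have swap: "v2 = simple (k - 1) \<circ> v1"
  proof
    fix m
    show "v2 m = (simple (k - 1) \<circ> v1) m"
    proof (cases "1 \<le> m \<and> m \<le> n")
      case True
      then obtain i j where "(i, j) \<in> D" "m = t (i, j)" using t_surj by blast
      then obtain e where e: "e \<in> D" "m = t e" by blast
      have s: "simple (k - 1) (k - 1) = k" "simple (k - 1) k = k - 1"
        using sk by (auto simp: simple_def)
      have s': "simple (k - 1) a = a" if "a \<noteq> k - 1" "a \<noteq> k" for a
        using that sk by (auto simp: simple_def transpose_def)
      from cases[OF e(1)] consider "e = ?p" | "e = ?q" | "e = d" | "e \<in> M'" | "e \<in> D - E" by blast
      then have "f k (k - 1) e = simple (k - 1) (f (k - 1) k e)"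
      proof cases
        case 1 then show ?thesis by (simp only: f s)
      next
        case 2 then show ?thesis by (simp only: f s)
      next
        case 3 
        have "k - 2 \<noteq> k - 1" "k - 2 \<noteq> k" using k by auto
        then have "simple (k - 1) (k - 2) = k - 2" by (rule s')
        then show ?thesis using 3 by (simp only: f)
      next
        case 4
        have "?r e \<noteq> k - 1" "?r e \<noteq> k" using rank(2)[OF 4] ck by auto
        then have "simple (k - 1) (?r e) = ?r e" by (rule s')
        then show ?thesis using f(5)[OF 4] by simp
      next
        case 5
        have "v (t e) \<noteq> k - 1" "v (t e) \<noteq> k" using out[OF 5] by auto
        then have "simple (k - 1) (v (t e)) = v (t e)" by (rule s')
        then show ?thesis using f(4)[OF 5] by simp
      qed
      then show ?thesis using v1(2) v2(2) e by simp
    next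
      case False
      then have "v1 m = m" "v2 m = m" using v1(1) v2(1) by (auto simp: standard_def Sym_def permutes_def)
      moreover have "simple (k - 1) m = m"
        using False sk k by (auto simp: simple_def transpose_def)
      ultimately show ?thesis by simp
    qed
  qed
  have "cell_equiv n (v1 \<circ> w_J) (simple (Suc (k - 2)) \<circ> v1 \<circ> w_J)"
  proof (rule dual_knuth_step[OF v1(1)])
    show "1 \<le> k - 2" "Suc (Suc (k - 2)) \<le> n" using k by auto
    show "(i, j) \<in> D" using dE ij by simp
    show "v1 (t (i, j)) = k - 2" using v1(2)[OF dE(4)] f(3) ij by simp
    show "v1 (t ?p) = Suc (Suc (k - 2))" using v1(2)[OF pD(1)] f(1) sk by simp
    show "v1 (t ?q) = Suc (k - 2)" using v1(2)[OF pD(2)] f(2) sk by simp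
  qed (use pD i j b in auto)
  then have "cell_equiv n (v1 \<circ> w_J) (v2 \<circ> w_J)" unfolding swap sk(1) .
  then show ?thesis
    by (rule that[OF v1(1) v2(1)]) (use v1 v2 f pD in auto)
qed

text \<open>The induction needs subdiagrams: \<open>E\<close> holds the entries on which the
  tableaux may differ. If both have the largest of them in the same corner, that corner is removed;
  otherwise \<open>corner_exchange\<close> provides two intermediate tableaux, each sharing this
  corner with one of the given ones.\<close>

lemma standard_connected:
  assumes "downclosed E" "standard v" "standard v'"
    and "\<And>q. q \<in> D - E \<Longrightarrow> v (t q) = v' (t q)" and "v ` t ` E = {1..card E}"
  shows "cell_equiv n (v \<circ> w_J) (v' \<circ> w_J)"
  using assms
proof (induction "card E" arbitrary: E v v' rule: less_induct)
  case less
  note E = less.prems(1) and v = less.prems(2) and v' = less.prems(3)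
    and agree = less.prems(4) and im = less.prems(5)
  have ED: "E \<subseteq> D" using E by (simp add: downclosed_def)
  have finE: "finite E" using ED finite_D finite_subset by blast
  have vS: "v \<in> Sym n" "v' \<in> Sym n" using v v' by (simp_all add: standard_def)
  show ?case
  proof (cases "E = {}")
    case True
    have "v m = v' m" for m
    proof (cases "1 \<le> m \<and> m \<le> n")
      case m: True
      then obtain i j where "(i, j) \<in> D" "m = t (i, j)" using t_surj by blast
      then show ?thesis using agree True by simp
    next
      case False
      then show ?thesis using vS by (auto simp: Sym_def permutes_def)
    qed
    then have "v = v'" by auto
    then show ?thesis using cell_equiv_refl Sym_comp vS w_J_Sym by blast
  next
    case False
    define k where "k = card E"
    have k: "1 \<le> k" using False finE by (simp add: k_def Suc_le_eq card_gt_0_iff)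
    \<comment> \<open>Outside \<open>E\<close> the tableaux agree, so their entries inside
      \<open>E\<close> form the same complement in {1..n}.\<close>
    have im': "v' ` t ` E = {1..k}"
    proof -
      have "u ` t ` E = {1..n} - u ` t ` (D - E)" if u: "u \<in> Sym n" for u
      proof -
        have "D - (D - E) = E" using ED by blast
        then show ?thesis using v_image_Diff[OF u, of "D - E" D] v_image[OF u] by (metis Diff_subset order_refl)
      qed
      from this[OF vS(1)] this[OF vS(2)] have *: "v ` t ` E = {1..n} - v ` t ` (D - E)" "v' ` t ` E = {1..n} - v' ` t ` (D - E)" .
      have "v ` t ` (D - E) = v' ` t ` (D - E)"
        unfolding image_image using agree by (intro image_cong refl) blast
      then show ?thesis using * im unfolding k_def by simp
    qed
    have corner: "\<exists>p. p \<in> E \<and> u (t p) = k \<and> (\<forall>q \<in> E. below p q \<longrightarrow> q = p)"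
      if u: "standard u" "u ` t ` E = {1..k}" for u
    proof -
      have "k \<in> u ` t ` E" using u k by simp
      then obtain p where p: "p \<in> E" "u (t p) = k" by auto
      have "q = p" if "q \<in> E" "below p q" for q
      proof (rule ccontr)
        assume "q \<noteq> p"
        then have "u (t p) < u (t q)"
          using standard_below[OF u(1) subsetD[OF ED p(1)] subsetD[OF ED that(1)] that(2)] by blast
        moreover have "u (t q) \<in> {1..k}" using u that by auto
        ultimately show False using p by simp
      qed
      then show ?thesis using p by blast
    qed
    have IH: "cell_equiv n (a \<circ> w_J) (b \<circ> w_J)"
      if p: "p \<in> E" "\<forall>q \<in> E. below p q \<longrightarrow> q = p" and ab: "standard a" "standard b"
        and "a ` t ` E = {1..k}" "a (t p) = k" "b (t p) = k" "\<And>q. q \<in> D - E \<Longrightarrow> a (t q) = b (t q)" for p a b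
    proof (rule less.hyps[of "E - {p}"])
      show "card (E - {p}) < card E" by (rule card_Diff1_less[OF finE p(1)])
      show "downclosed (E - {p})" using E p below_antisym unfolding downclosed_def by blast
      show "a (t q) = b (t q)" if "q \<in> D - (E - {p})" for q using that \<open>a (t p) = k\<close> \<open>b (t p) = k\<close>
          \<open>\<And>q. q \<in> D - E \<Longrightarrow> a (t q) = b (t q)\<close> by (cases "q = p") auto
      have aS: "a \<in> Sym n" using ab by (simp add: standard_def)
      have "a ` t ` (E - {p}) = a ` t ` E - {a (t p)}"
        using v_image_Diff[OF aS, of "{p}" E] ED p(1) by simp
      also have "\<dots> = {1..card (E - {p})}"
        using \<open>a ` t ` E = {1..k}\<close> \<open>a (t p) = k\<close> p(1) finE by (auto simp: k_def)
      finally show "a ` t ` (E - {p}) = {1..card (E - {p})}" .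
    qed (use ab in auto)
    have claim: "cell_equiv n (a \<circ> w_J) (b \<circ> w_J)"
      if ab: "standard a" "standard b" "\<And>q. q \<in> D - E \<Longrightarrow> a (t q) = b (t q)"
        "a ` t ` E = {1..k}" "b ` t ` E = {1..k}"
        and p: "p \<in> E" "a (t p) = k" "\<forall>q \<in> E. below p q \<longrightarrow> q = p"
        and p': "p' \<in> E" "b (t p') = k" "\<forall>q \<in> E. below p' q \<longrightarrow> q = p'"
        and lt: "fst p < fst p'" for a b p p'
    proof -
      obtain v1 v2 where v12: "standard v1" "standard v2" "cell_equiv n (v1 \<circ> w_J) (v2 \<circ> w_J)"
        "\<And>q. q \<in> D - E \<Longrightarrow> v1 (t q) = a (t q)" "\<And>q. q \<in> D - E \<Longrightarrow> v2 (t q) = a (t q)"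
        "v2 (t p') = k" "v1 (t p) = k"
        using corner_exchange[OF E k_def[symmetric] ab(1) ab(4), of "fst p" "snd p" "fst p'" "snd p'"] p p' lt by auto
      have 1: "cell_equiv n (a \<circ> w_J) (v1 \<circ> w_J)"
        by (rule IH[OF p(1,3) ab(1) v12(1) ab(4) p(2) v12(7)]) (use v12(4) in simp)
      have 2: "cell_equiv n (b \<circ> w_J) (v2 \<circ> w_J)"
        by (rule IH[OF p'(1,3) ab(2) v12(2) ab(5) p'(2) v12(6)]) (use v12(5) ab(3) in simp)
      show ?thesis using 1 2 v12(3) cell_equiv_trans cell_equiv_sym by blast
    qed
    obtain p where p: "p \<in> E" "v (t p) = k" "\<forall>q \<in> E. below p q \<longrightarrow> q = p"
      using corner[OF v] im k_def by auto
    obtain p' where p': "p' \<in> E" "v' (t p') = k" "\<forall>q \<in> E. below p' q \<longrightarrow> q = p'"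
      using corner[OF v' im'] by auto
    \<comment> \<open>Two corners in one row are comparable and therefore equal, so distinct corners
      are ordered by their rows.\<close>
    have "p = p'" if "fst p = fst p'"
    proof -
      have "below p p' \<or> below p' p" using that by (auto simp: below_def)
      then show ?thesis using p p' by auto
    qed
    then consider "p = p'" | "fst p < fst p'" | "fst p' < fst p" by fastforce
    then show ?thesis
    proof cases
      case 1
      show ?thesis
        by (rule IH[OF p(1,3) v v' _ p(2)]) (use im k_def p' 1 agree in auto)
    next
      case 2
      show ?thesis
        by (rule claim[OF v v' agree _ im' p p' 2]) (use im k_def in auto)
    next
      case 3
      have "cell_equiv n (v' \<circ> w_J) (v \<circ> w_J)"
        by (rule claim[OF v' v _ im' _ p' p 3]) (use im k_def agree in auto)
      then show ?thesis by (rule cell_equiv_sym)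
    qed
  qed
qed

lemma standard_imp_cell:
  assumes v: "standard v"
  shows "cell_equiv n (v \<circ> w_J) w_J"
proof -
  have "cell_equiv n (v \<circ> w_J) (id \<circ> w_J)"
  proof (rule standard_connected[of D])
    show "downclosed D" by (simp add: downclosed_def)
    show "v ` t ` D = {1..card D}"
      using v_image[OF standard_Sym[OF v]] by (simp only: card_D)
  qed (use v standard_id in auto)
  then show ?thesis by simp
qed

end

theorem proposition6p5:
  fixes n :: nat and lam :: "nat list" and w_J v_lam :: perm
  assumes "1 \<le> n"
    and "is_partition n lam"
    and "is_arg_max (len n) (\<lambda>w. w \<in> parabolic (col_simples lam)) w_J"
    and "v_lam \<in> Sym n"
    and "\<forall>c \<in> diagram lam. (v_lam \<circ> col_tableau lam) c = row_tableau lam c"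
  shows "left_cell n w_J = (\<lambda>v. v \<circ> w_J) ` weak_interval n v_lam"
proof -
  interpret column_longest n lam w_J
    by unfold_locales (rule assms)+
  have weak: "v \<in> weak_interval n v_lam \<longleftrightarrow> standard v" if "v \<in> Sym n" for v
    by (rule standard_iff_weak_interval[OF assms(4,5) that])
  show ?thesis
  proof
    show "left_cell n w_J \<subseteq> (\<lambda>v. v \<circ> w_J) ` weak_interval n v_lam"
    proof
      fix u assume "u \<in> left_cell n w_J"
      then have "cell_equiv n w_J u" by (simp add: left_cell_eq[OF w_J_Sym] cell_equiv_sym)
      then have "standard (u \<circ> inv w_J)" by (rule cell_imp_standard)
      moreover have "u = (u \<circ> inv w_J) \<circ> w_J"
        by (simp add: o_assoc[symmetric] Sym_inv_comp(2)[OF w_J_Sym])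
      ultimately show "u \<in> (\<lambda>v. v \<circ> w_J) ` weak_interval n v_lam"
        using weak standard_Sym by blast
    qed
    show "(\<lambda>v. v \<circ> w_J) ` weak_interval n v_lam \<subseteq> left_cell n w_J"
    proof (rule image_subsetI)
      fix v assume v: "v \<in> weak_interval n v_lam"
      then have "v \<in> Sym n" by (simp add: weak_interval_def)
      then have "standard v" using weak v by blast
      then show "v \<circ> w_J \<in> left_cell n w_J"
        using standard_imp_cell by (simp add: left_cell_eq[OF w_J_Sym])
    qed
  qed
qed

end
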